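(* Let $n\ge 2$, let $W$ be the subalgebra $\{u\in U_S\mid [\mathfrak h_n,u]=[\mathfrak m_n,u]=0\}$ of the localized enveloping algebra $U_S$ of $\mathfrak{sl}_{n+1}$, and let $W(e)$ be the finite $W$-algebra attached to the minimal nilpotent element $e=e_{10}+\dots+e_{n0}$. Then there is an isomorphism of associative algebras $W\cong W(e)$.
   Context: All algebras are over $\mathbb{C}$. Fix $n\ge 2$. Let $e_{ij}$, $0\le i,j\le n$, be the matrix units of $\mathfrak{gl}_{n+1}$. Let $\mathfrak h_n$ be the Cartan subalgebra of diagonal matrices of $\mathfrak{sl}_{n+1}$ and $\mathfrak m_n=\bigoplus_{i=1}^n\mathbb{C}e_{0i}$, a commutative subalgebra. $U_S$ is the localization of $U(\mathfrak{sl}_{n+1})$ with respect to the Ore subset $S=\{e_{01}^{i_1}\cdots e_{0n}^{i_n}\mid i_1,\dots,i_n\in\mathbb{Z}_{\ge0}\}$. Finite $W$-algebra: let $e=e_{10}+\dots+e_{n0}$ and let $\theta:\mathfrak m_n\to\mathbb{C}$, $\theta(X)=\mathrm{tr}(Xe)$, so $\theta(e_{0i})=1$ for $1\le i\le n$. Let $\mathbb{C}_{\mathbf 1}=\mathbb{C}v_{\mathbf 1}$ be the corresponding one-dimensional $\mathfrak m_n$-module, $Q_{\mathbf 1}=U(\mathfrak{sl}_{n+1})\otimes_{U(\mathfrak m_n)}\mathbb{C}_{\mathbf 1}$, and $W(e)=\mathrm{End}_{\mathfrak{sl}_{n+1}}(Q_{\mathbf 1})^{\mathrm{op}}$. *)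

theory Defs
  imports
    "Jordan_Normal_Form.Matrix"
    "HOL-Library.Poly_Mapping"
    "HOL-Algebra.QuotRing"
    "HOL-Algebra.Module"
begin

section \<open>Complex vector spaces and associative algebras\<close>

definition complex_alg :: "(complex, complex) module" where
  "complex_alg =
    \<lparr>carrier = UNIV, monoid.mult = (*), one = 1, zero = 0, add = (+), smult = (*)\<rparr>"

text \<open>The locale \<open>algebra\<close> of HOL-Algebra is restricted to commutative algebras.\<close>

locale complex_algebra = Module.module complex_alg A + ring A for A (structure) +
  assumes smult_mult_left:
      "\<lbrakk>x \<in> carrier A; y \<in> carrier A\<rbrakk> \<Longrightarrow> (c \<odot> x) \<otimes> y = c \<odot> (x \<otimes> y)"
    and smult_mult_right:
      "\<lbrakk>x \<in> carrier A; y \<in> carrier A\<rbrakk> \<Longrightarrow> x \<otimes> (c \<odot> y) = c \<odot> (x \<otimes> y)"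

definition algebra_hom ::
    "(complex, 'a) module \<Rightarrow> (complex, 'b) module \<Rightarrow> ('a \<Rightarrow> 'b) set" where
  "algebra_hom A B =
    {f \<in> ring_hom A B. \<forall>c. \<forall>x \<in> carrier A. f (c \<odot>\<^bsub>A\<^esub> x) = c \<odot>\<^bsub>B\<^esub> f x}"

definition algebra_isomorphic ::
    "(complex, 'a) module \<Rightarrow> (complex, 'b) module \<Rightarrow> bool" where
  "algebra_isomorphic A B \<longleftrightarrow> complex_algebra A \<and> complex_algebra B \<and>
    (\<exists>f \<in> algebra_hom A B. bij_betw f (carrier A) (carrier B))"

definition opposite_algebra :: "(complex, 'a) module \<Rightarrow> (complex, 'a) module" where
  "opposite_algebra A = A\<lparr>monoid.mult := \<lambda>x y. y \<otimes>\<^bsub>A\<^esub> x\<rparr>"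

definition commutator :: "(complex, 'a) module \<Rightarrow> 'a \<Rightarrow> 'a \<Rightarrow> 'a" where
  "commutator A x y = (x \<otimes>\<^bsub>A\<^esub> y) \<ominus>\<^bsub>A\<^esub> (y \<otimes>\<^bsub>A\<^esub> x)"

text \<open>
  Quotient of an algebra by a two-sided ideal, or of a vector space by a subspace: the library's
  \<^const>\<open>FactRing\<close> together with the induced scalar multiplication.
\<close>

definition quotient_module ::
    "(complex, 'a) module \<Rightarrow> 'a set \<Rightarrow> (complex, 'a set) module" where
  "quotient_module A I = ring.extend (A Quot I)
    (module.fields (\<lambda>c P. \<Union>p\<in>P. I +>\<^bsub>A\<^esub> (c \<odot>\<^bsub>A\<^esub> p)))"

definition linear_span :: "(complex, 'a) module \<Rightarrow> 'a set \<Rightarrow> 'a set" where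
  "linear_span V X = \<Inter> {H. submodule H complex_alg V \<and> X \<subseteq> H}"

text \<open>
  The vector space with basis \<open>X\<close>.  Here and in the tensor product below, the fields
  \<open>mult\<close> and \<open>one\<close> of the record carry no meaning.
\<close>

definition free_space :: "'x set \<Rightarrow> (complex, 'x \<Rightarrow>\<^sub>0 complex) module" where
  "free_space X =
    \<lparr>carrier = {p. Poly_Mapping.keys p \<subseteq> X}, monoid.mult = (\<lambda>_ _. 0), one = 0, zero = 0,
     add = (+), smult = (\<lambda>c. Poly_Mapping.map ((*) c))\<rparr>"

definition push_forward ::
    "('x \<Rightarrow> 'y) \<Rightarrow> ('x \<Rightarrow>\<^sub>0 complex) \<Rightarrow> ('y \<Rightarrow>\<^sub>0 complex)" where
  "push_forward f p =
    (\<Sum>x \<in> Poly_Mapping.keys p. Poly_Mapping.single (f x) (Poly_Mapping.lookup p x))"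


section \<open>Free algebras\<close>

text \<open>
  Words under concatenation, written additively so that the convolution product of
  \<^theory>\<open>HOL-Library.Poly_Mapping\<close> is the product of the free algebra.
\<close>

datatype 'x free_word = Free_Word (letters: "'x list")

instantiation free_word :: (type) monoid_add
begin

definition zero_free_word :: "'a free_word" where
  "0 = Free_Word []"

definition plus_free_word :: "'a free_word \<Rightarrow> 'a free_word \<Rightarrow> 'a free_word" where
  "v + w = Free_Word (letters v @ letters w)"

instance
  by standard (simp_all add: zero_free_word_def plus_free_word_def)

end

definition free_algebra :: "'x set \<Rightarrow> (complex, 'x free_word \<Rightarrow>\<^sub>0 complex) module" where
  "free_algebra X =
    (free_space {w. set (letters w) \<subseteq> X})\<lparr>monoid.mult := (*), one := 1\<rparr>"

definition generator :: "'x \<Rightarrow> 'x free_word \<Rightarrow>\<^sub>0 complex" where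
  "generator x = Poly_Mapping.single (Free_Word [x]) 1"

definition free_algebra_lift ::
    "(complex, 'a) module \<Rightarrow> ('x \<Rightarrow> 'a) \<Rightarrow> ('x free_word \<Rightarrow>\<^sub>0 complex) \<Rightarrow> 'a" where
  "free_algebra_lift A f p =
    (\<Oplus>\<^bsub>A\<^esub> w \<in> Poly_Mapping.keys p.
      Poly_Mapping.lookup p w \<odot>\<^bsub>A\<^esub> foldr (\<lambda>x a. f x \<otimes>\<^bsub>A\<^esub> a) (letters w) \<one>\<^bsub>A\<^esub>)"


section \<open>Enveloping algebras of Lie algebras of complex matrices\<close>

definition lie_bracket :: "complex mat \<Rightarrow> complex mat \<Rightarrow> complex mat" where
  "lie_bracket X Y = X * Y - Y * X"

definition enveloping_relations ::
    "complex mat set \<Rightarrow> (complex mat free_word \<Rightarrow>\<^sub>0 complex) set" where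
  "enveloping_relations g =
    {generator (X + Y) - (generator X + generator Y) |X Y. X \<in> g \<and> Y \<in> g} \<union>
    {generator (c \<cdot>\<^sub>m X) - Poly_Mapping.map ((*) c) (generator X) |c X. X \<in> g} \<union>
    {generator X * generator Y - generator Y * generator X - generator (lie_bracket X Y)
      |X Y. X \<in> g \<and> Y \<in> g}"

definition enveloping_ideal ::
    "complex mat set \<Rightarrow> (complex mat free_word \<Rightarrow>\<^sub>0 complex) set" where
  "enveloping_ideal g = Idl\<^bsub>free_algebra g\<^esub> (enveloping_relations g)"

type_synonym enveloping = "(complex mat free_word \<Rightarrow>\<^sub>0 complex) set"

definition enveloping_algebra :: "complex mat set \<Rightarrow> (complex, enveloping) module" where
  "enveloping_algebra g = quotient_module (free_algebra g) (enveloping_ideal g)"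

definition enveloping_map :: "complex mat set \<Rightarrow> complex mat \<Rightarrow> enveloping" where
  "enveloping_map g X = enveloping_ideal g +>\<^bsub>free_algebra g\<^esub> generator X"

text \<open>
  The extension of a Lie homomorphism \<open>f\<close> from \<open>g\<close> to an associative algebra \<open>A\<close> to an algebra
  homomorphism from the enveloping algebra: \<^const>\<open>free_algebra_lift\<close> is then constant on each
  coset \<open>P\<close>.
\<close>

definition enveloping_lift ::
    "(complex, 'a) module \<Rightarrow> (complex mat \<Rightarrow> 'a) \<Rightarrow> enveloping \<Rightarrow> 'a" where
  "enveloping_lift A f P = the_elem (free_algebra_lift A f ` P)"


section \<open>Tensor products over a noncommutative algebra\<close>

text \<open>
  \<open>M\<close> is a right module and \<open>N\<close> a left module over the algebra with underlying set \<open>R\<close>, with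
  actions \<open>ra m r\<close> and \<open>la r n\<close>.
\<close>

definition tensor_relations ::
    "'r set \<Rightarrow> (complex, 'm) module \<Rightarrow> ('m \<Rightarrow> 'r \<Rightarrow> 'm) \<Rightarrow>
     (complex, 'n) module \<Rightarrow> ('r \<Rightarrow> 'n \<Rightarrow> 'n) \<Rightarrow> ('m \<times> 'n \<Rightarrow>\<^sub>0 complex) set" where
  "tensor_relations R M ra N la = (let b = (\<lambda>m n. Poly_Mapping.single (m, n) 1) in
    {b (m \<oplus>\<^bsub>M\<^esub> m') n - (b m n + b m' n)
      |m m' n. m \<in> carrier M \<and> m' \<in> carrier M \<and> n \<in> carrier N} \<union>
    {b m (n \<oplus>\<^bsub>N\<^esub> n') - (b m n + b m n')
      |m n n'. m \<in> carrier M \<and> n \<in> carrier N \<and> n' \<in> carrier N} \<union>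
    {b (c \<odot>\<^bsub>M\<^esub> m) n - Poly_Mapping.map ((*) c) (b m n)
      |c m n. m \<in> carrier M \<and> n \<in> carrier N} \<union>
    {b m (c \<odot>\<^bsub>N\<^esub> n) - Poly_Mapping.map ((*) c) (b m n)
      |c m n. m \<in> carrier M \<and> n \<in> carrier N} \<union>
    {b (ra m r) n - b m (la r n) |m r n. m \<in> carrier M \<and> r \<in> R \<and> n \<in> carrier N})"

definition tensor_kernel ::
    "'r set \<Rightarrow> (complex, 'm) module \<Rightarrow> ('m \<Rightarrow> 'r \<Rightarrow> 'm) \<Rightarrow>
     (complex, 'n) module \<Rightarrow> ('r \<Rightarrow> 'n \<Rightarrow> 'n) \<Rightarrow> ('m \<times> 'n \<Rightarrow>\<^sub>0 complex) set" where
  "tensor_kernel R M ra N la =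
    linear_span (free_space (carrier M \<times> carrier N)) (tensor_relations R M ra N la)"

definition tensor_product ::
    "'r set \<Rightarrow> (complex, 'm) module \<Rightarrow> ('m \<Rightarrow> 'r \<Rightarrow> 'm) \<Rightarrow>
     (complex, 'n) module \<Rightarrow> ('r \<Rightarrow> 'n \<Rightarrow> 'n) \<Rightarrow>
     (complex, ('m \<times> 'n \<Rightarrow>\<^sub>0 complex) set) module" where
  "tensor_product R M ra N la =
    quotient_module (free_space (carrier M \<times> carrier N)) (tensor_kernel R M ra N la)"

text \<open>The map \<open>f \<otimes> id\<close> induced by an endomorphism \<open>f\<close> of the right module \<open>M\<close>.\<close>

definition tensor_map_left ::
    "'r set \<Rightarrow> (complex, 'm) module \<Rightarrow> ('m \<Rightarrow> 'r \<Rightarrow> 'm) \<Rightarrow>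
     (complex, 'n) module \<Rightarrow> ('r \<Rightarrow> 'n \<Rightarrow> 'n) \<Rightarrow> ('m \<Rightarrow> 'm) \<Rightarrow>
     ('m \<times> 'n \<Rightarrow>\<^sub>0 complex) set \<Rightarrow> ('m \<times> 'n \<Rightarrow>\<^sub>0 complex) set" where
  "tensor_map_left R M ra N la f P =
    (\<Union>p\<in>P. tensor_kernel R M ra N la +>\<^bsub>free_space (carrier M \<times> carrier N)\<^esub>
      push_forward (\<lambda>(m, n). (f m, n)) p)"


section \<open>Endomorphism algebras\<close>

text \<open>
  Linear endomorphisms of \<open>V\<close> commuting with the operators \<open>act x\<close> for \<open>x \<in> g\<close>.  They are
  extensional functions on the carrier, so that equality of endomorphisms is equality of functions.
\<close>

definition endomorphism_algebra ::
    "'x set \<Rightarrow> ('x \<Rightarrow> 'v \<Rightarrow> 'v) \<Rightarrow> (complex, 'v) module \<Rightarrow> (complex, 'v \<Rightarrow> 'v) module" where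
  "endomorphism_algebra g act V =
    \<lparr>carrier = {f \<in> carrier V \<rightarrow>\<^sub>E carrier V.
       (\<forall>v \<in> carrier V. \<forall>w \<in> carrier V. f (v \<oplus>\<^bsub>V\<^esub> w) = f v \<oplus>\<^bsub>V\<^esub> f w) \<and>
       (\<forall>c. \<forall>v \<in> carrier V. f (c \<odot>\<^bsub>V\<^esub> v) = c \<odot>\<^bsub>V\<^esub> f v) \<and>
       (\<forall>x \<in> g. \<forall>v \<in> carrier V. f (act x v) = act x (f v))},
     monoid.mult = (\<lambda>f h. compose (carrier V) f h),
     one = (\<lambda>v \<in> carrier V. v),
     zero = (\<lambda>v \<in> carrier V. \<zero>\<^bsub>V\<^esub>),
     add = (\<lambda>f h. \<lambda>v \<in> carrier V. f v \<oplus>\<^bsub>V\<^esub> h v),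
     smult = (\<lambda>c f. \<lambda>v \<in> carrier V. c \<odot>\<^bsub>V\<^esub> f v)\<rparr>"


section \<open>Localization at an Ore set\<close>

text \<open>
  \<open>L\<close> with the homomorphism \<open>\<phi>\<close> is the ring of left fractions of \<open>R\<close> with denominators in \<open>S\<close>,
  which is unique up to a unique isomorphism under \<open>R\<close>.
\<close>

definition is_localization ::
    "(complex, 'a) module \<Rightarrow> 'a set \<Rightarrow> (complex, 'b) module \<Rightarrow> ('a \<Rightarrow> 'b) \<Rightarrow> bool" where
  "is_localization R S L \<phi> \<longleftrightarrow>
    complex_algebra L \<and> \<phi> \<in> algebra_hom R L \<and>
    (\<forall>s \<in> S. \<phi> s \<in> Units L) \<and>
    (\<forall>x \<in> carrier L. \<exists>s \<in> S. \<exists>r \<in> carrier R. x = inv\<^bsub>L\<^esub> (\<phi> s) \<otimes>\<^bsub>L\<^esub> \<phi> r) \<and>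
    (\<forall>r \<in> carrier R. \<phi> r = \<zero>\<^bsub>L\<^esub> \<longleftrightarrow> (\<exists>s \<in> S. s \<otimes>\<^bsub>R\<^esub> r = \<zero>\<^bsub>R\<^esub>))"


section \<open>The Lie algebra of traceless matrices\<close>

text \<open>Rows and columns of matrices are indexed by \<open>0, \<dots>, n\<close>.\<close>

definition matrix_unit :: "nat \<Rightarrow> nat \<Rightarrow> nat \<Rightarrow> complex mat" where
  "matrix_unit n i j = mat (n + 1) (n + 1) (\<lambda>(a, b). if a = i \<and> b = j then 1 else 0)"

definition trace :: "complex mat \<Rightarrow> complex" where
  "trace X = (\<Sum>i < dim_row X. X $$ (i, i))"

definition sl :: "nat \<Rightarrow> complex mat set" where
  "sl n = {X \<in> carrier_mat (n + 1) (n + 1). trace X = 0}"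

definition cartan :: "nat \<Rightarrow> complex mat set" where
  "cartan n = {X \<in> sl n. diagonal_mat X}"

text \<open>The span of the matrix units \<open>e\<^sub>0\<^sub>i\<close> with \<open>1 \<le> i \<le> n\<close>.\<close>

definition mm :: "nat \<Rightarrow> complex mat set" where
  "mm n = {X \<in> carrier_mat (n + 1) (n + 1).
    \<forall>a \<le> n. \<forall>b \<le> n. X $$ (a, b) \<noteq> 0 \<longrightarrow> a = 0 \<and> 1 \<le> b}"

abbreviation U_sl :: "nat \<Rightarrow> (complex, enveloping) module" where
  "U_sl n \<equiv> enveloping_algebra (sl n)"

definition denominators :: "nat \<Rightarrow> enveloping set" where
  "denominators n =
    {foldr (\<lambda>j u. (enveloping_map (sl n) (matrix_unit n 0 j) [^]\<^bsub>U_sl n\<^esub> k j) \<otimes>\<^bsub>U_sl n\<^esub> u)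
       [1..<n + 1] \<one>\<^bsub>U_sl n\<^esub> |k :: nat \<Rightarrow> nat. True}"

definition W_algebra ::
    "nat \<Rightarrow> (complex, 'b) module \<Rightarrow> (enveloping \<Rightarrow> 'b) \<Rightarrow> (complex, 'b) module" where
  "W_algebra n L \<phi> = L\<lparr>carrier := {u \<in> carrier L.
    (\<forall>X \<in> cartan n. commutator L (\<phi> (enveloping_map (sl n) X)) u = \<zero>\<^bsub>L\<^esub>) \<and>
    (\<forall>X \<in> mm n. commutator L (\<phi> (enveloping_map (sl n) X)) u = \<zero>\<^bsub>L\<^esub>)}\<rparr>"


section \<open>The finite W-algebra of the minimal nilpotent element\<close>

definition min_nilpotent :: "nat \<Rightarrow> complex mat" where
  "min_nilpotent n = mat (n + 1) (n + 1) (\<lambda>(a, b). if 1 \<le> a \<and> b = 0 then 1 else 0)"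

definition \<theta> :: "nat \<Rightarrow> complex mat \<Rightarrow> complex" where
  "\<theta> n X = trace (X * min_nilpotent n)"

text \<open>
  The right \<open>U(\<mm>)\<close>-action on \<open>U(\<ss>\<ll>)\<close>, through the homomorphism
  \<open>U(\<mm>) \<rightarrow> U(\<ss>\<ll>)\<close> induced by the inclusion, and the left \<open>U(\<mm>)\<close>-action on
  the one-dimensional module given by \<open>\<theta>\<close>.
\<close>

definition right_action :: "nat \<Rightarrow> enveloping \<Rightarrow> enveloping \<Rightarrow> enveloping" where
  "right_action n u r = u \<otimes>\<^bsub>U_sl n\<^esub> enveloping_lift (U_sl n) (enveloping_map (sl n)) r"

definition character_action :: "nat \<Rightarrow> enveloping \<Rightarrow> complex \<Rightarrow> complex" where
  "character_action n r v = enveloping_lift complex_alg (\<theta> n) r * v"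

type_synonym whittaker = "(enveloping \<times> complex \<Rightarrow>\<^sub>0 complex) set"

definition Q_module :: "nat \<Rightarrow> (complex, whittaker) module" where
  "Q_module n = tensor_product (carrier (enveloping_algebra (mm n)))
    (U_sl n) (right_action n) complex_alg (character_action n)"

definition Q_action :: "nat \<Rightarrow> complex mat \<Rightarrow> whittaker \<Rightarrow> whittaker" where
  "Q_action n X = tensor_map_left (carrier (enveloping_algebra (mm n)))
    (U_sl n) (right_action n) complex_alg (character_action n)
    (\<lambda>u. enveloping_map (sl n) X \<otimes>\<^bsub>U_sl n\<^esub> u)"

definition finite_W_algebra :: "nat \<Rightarrow> (complex, whittaker \<Rightarrow> whittaker) module" where
  "finite_W_algebra n =
    opposite_algebra (endomorphism_algebra (sl n) (Q_action n) (Q_module n))"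

end

theory Submission
  imports Defs "HOL-Algebra.Generated_Groups"
begin

text \<open>
  Write \<open>U\<close> for the enveloping algebra, \<open>L\<close> for its localization and \<open>x\<^sub>i\<close> for \<open>e\<^sub>0\<^sub>i\<close>, and let
  \<open>I \<subseteq> U\<close> and \<open>J \<subseteq> L\<close> be the left ideals generated by the elements \<open>x\<^sub>i - 1\<close>.  The module \<open>Q\<close> is
  \<open>U / I\<close>, and its endomorphisms are given by the Whittaker vectors of \<open>Q\<close>, that is, by the
  possible images of the generator.  The isomorphism sends \<open>w \<in> W\<close> to right multiplication by
  \<open>w\<close>.  Two observations make this work.

  First, \<open>U / I = L / J\<close>.  Indeed \<open>(ad x\<^sub>i)\<^sup>3 = 0\<close> on \<open>\<ss>\<ll>\<close>, so \<open>x\<^sub>i - 1\<close> acts locally nilpotently on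
  \<open>U / I\<close> (lemma \<open>nilpotent_all\<close>), whence \<open>x\<^sub>i\<close> acts bijectively there and nothing changes when the
  denominators are inverted (lemmas \<open>\<phi>_J_imp_I\<close> and \<open>lift_mod_J\<close>).

  Second, every class in \<open>L / J\<close> has exactly one representative that commutes with the Cartan
  subalgebra.  The algebra \<open>L\<close> is spanned by weight vectors, and since the weights of
  \<open>x\<^sub>1, \<dots>, x\<^sub>n\<close> form a basis of the root lattice, a vector \<open>c\<close> of weight \<open>\<mu>\<close> can be replaced by
  \<open>c x\<^sup>-\<^sup>\<mu>\<close>, which has weight zero and the same class (lemma \<open>representative_exists\<close>).  In other words
  \<open>L\<close> is the direct sum of the spaces \<open>L\<^sub>0 x\<^sup>\<mu>\<close>, and putting \<open>x = 1\<close> is a well-defined map \<open>L \<rightarrow> L\<^sub>0\<close>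
  that vanishes on \<open>J\<close>, so that \<open>L\<^sub>0\<close> meets \<open>J\<close> trivially (lemma \<open>centralizer_H_Int_J\<close>).

  Now let \<open>w\<close> be the representative of weight zero of a Whittaker vector.  Then \<open>x\<^sub>i w\<close> and \<open>w\<close> have
  the same class, and so do \<open>x\<^sub>i w\<close> and \<open>x\<^sub>i w x\<^sub>i\<^sup>-\<^sup>1\<close>.  The elements \<open>x\<^sub>i w x\<^sub>i\<^sup>-\<^sup>1\<close> and \<open>w\<close> both have
  weight zero, so they are equal, which means \<open>w \<in> W\<close> (lemma \<open>endomorphism_from_W\<close>).
\<close>

section \<open>Complex algebras\<close>

lemma complex_alg_simps [simp]:
  "carrier complex_alg = UNIV" "mult complex_alg = (*)" "\<one>\<^bsub>complex_alg\<^esub> = 1"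
  "\<zero>\<^bsub>complex_alg\<^esub> = 0" "add complex_alg = (+)" "module.smult complex_alg = (*)"
  by (simp_all add: complex_alg_def)

lemma cring_complex_alg: "cring complex_alg"
  by (intro cringI abelian_groupI comm_monoidI) 
    (auto simp: algebra_simps intro: exI[of _ "- _"])

lemma complex_algebraI:
  assumes "ring A"
    and "\<And>c x. x \<in> carrier A \<Longrightarrow> c \<odot>\<^bsub>A\<^esub> x \<in> carrier A"
    and "\<And>c d x. x \<in> carrier A \<Longrightarrow> (c + d) \<odot>\<^bsub>A\<^esub> x = c \<odot>\<^bsub>A\<^esub> x \<oplus>\<^bsub>A\<^esub> d \<odot>\<^bsub>A\<^esub> x"
    and "\<And>c x y. \<lbrakk>x \<in> carrier A; y \<in> carrier A\<rbrakk> \<Longrightarrow>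
      c \<odot>\<^bsub>A\<^esub> (x \<oplus>\<^bsub>A\<^esub> y) = c \<odot>\<^bsub>A\<^esub> x \<oplus>\<^bsub>A\<^esub> c \<odot>\<^bsub>A\<^esub> y"
    and "\<And>c d x. x \<in> carrier A \<Longrightarrow> (c * d) \<odot>\<^bsub>A\<^esub> x = c \<odot>\<^bsub>A\<^esub> (d \<odot>\<^bsub>A\<^esub> x)"
    and "\<And>x. x \<in> carrier A \<Longrightarrow> 1 \<odot>\<^bsub>A\<^esub> x = x"
    and "\<And>c x y. \<lbrakk>x \<in> carrier A; y \<in> carrier A\<rbrakk> \<Longrightarrow>
      (c \<odot>\<^bsub>A\<^esub> x) \<otimes>\<^bsub>A\<^esub> y = c \<odot>\<^bsub>A\<^esub> (x \<otimes>\<^bsub>A\<^esub> y)"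
    and "\<And>c x y. \<lbrakk>x \<in> carrier A; y \<in> carrier A\<rbrakk> \<Longrightarrow>
      x \<otimes>\<^bsub>A\<^esub> (c \<odot>\<^bsub>A\<^esub> y) = c \<odot>\<^bsub>A\<^esub> (x \<otimes>\<^bsub>A\<^esub> y)"
  shows "complex_algebra A"
proof -
  interpret A: ring A by fact
  have "Module.module complex_alg A"
    by (rule moduleI[OF cring_complex_alg A.abelian_group_axioms]) (use assms in auto)
  then show ?thesis
    using assms by (intro complex_algebra.intro complex_algebra_axioms.intro) auto
qed

lemma complex_algebra_complex_alg: "complex_algebra complex_alg"
  using cring.axioms(1)[OF cring_complex_alg] by (intro complex_algebraI) (auto simp: algebra_simps)

text \<open>
  Commutators are formed in records without further fields, whereas the locale
  \<^locale>\<open>complex_algebra\<close> allows any extension of the record.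
\<close>

locale assoc_algebra = complex_algebra A for A :: "(complex, 'a) module" (structure)

context assoc_algebra
begin

lemma smult_closed' [simp, intro]: "x \<in> carrier A \<Longrightarrow> c \<odot> x \<in> carrier A"
  using smult_closed[of c x] by simp

lemma smult_add_left: "x \<in> carrier A \<Longrightarrow> (c + d) \<odot> x = c \<odot> x \<oplus> d \<odot> x"
  using smult_l_distr[of c d x] by simp

lemma smult_add_right: "\<lbrakk>x \<in> carrier A; y \<in> carrier A\<rbrakk> \<Longrightarrow> c \<odot> (x \<oplus> y) = c \<odot> x \<oplus> c \<odot> y"
  using smult_r_distr[of c x y] by simp

lemma smult_smult: "x \<in> carrier A \<Longrightarrow> c \<odot> (d \<odot> x) = (c * d) \<odot> x"
  using smult_assoc1[of c d x] by simp

lemma smult_one' [simp]: "x \<in> carrier A \<Longrightarrow> 1 \<odot> x = x"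
  using smult_one[of x] by simp

lemma smult_zero_left [simp]: "x \<in> carrier A \<Longrightarrow> 0 \<odot> x = \<zero>"
  using smult_l_null[of x] by simp

lemma smult_zero_right [simp]: "c \<odot> \<zero> = \<zero>"
  using smult_r_null[of c] by simp

lemma smult_minus_right: "x \<in> carrier A \<Longrightarrow> c \<odot> (\<ominus> x) = \<ominus> (c \<odot> x)"
  using smult_r_minus[of c x] by simp

lemma minus_one_smult: "x \<in> carrier A \<Longrightarrow> (-1) \<odot> x = \<ominus> x"
  using smult_add_left[of x "-1" 1] minus_equality[of "(-1) \<odot> x" x] by simp

lemma smult_minus_left: "x \<in> carrier A \<Longrightarrow> (- c) \<odot> x = \<ominus> (c \<odot> x)"
  using smult_smult[of x "-1" c] minus_one_smult[of "c \<odot> x"] by simp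

lemma smult_diff_left: "x \<in> carrier A \<Longrightarrow> (c - d) \<odot> x = c \<odot> x \<ominus> d \<odot> x"
  using smult_add_left[of x c "- d"] by (simp add: smult_minus_left a_minus_def)

lemma smult_eq_zero_imp:
  assumes "x \<in> carrier A" "c \<odot> x = \<zero>" "c \<noteq> 0" shows "x = \<zero>"
  using smult_smult[OF assms(1), of "inverse c" c] assms by simp

lemma smult_as_mult: "x \<in> carrier A \<Longrightarrow> c \<odot> x = (c \<odot> \<one>) \<otimes> x"
  by (simp add: smult_mult_left)

lemma diff_self [simp]: "x \<in> carrier A \<Longrightarrow> x \<ominus> x = \<zero>"
  by (simp add: a_minus_def r_neg)

lemma diff_eq_zero_iff [simp]: "x \<in> carrier A \<Longrightarrow> y \<in> carrier A \<Longrightarrow> x \<ominus> y = \<zero> \<longleftrightarrow> x = y"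
  by (metis add.inv_closed local.minus_eq minus_equality minus_minus r_neg)

lemma commutator_closed [simp]:
  "\<lbrakk>x \<in> carrier A; y \<in> carrier A\<rbrakk> \<Longrightarrow> commutator A x y \<in> carrier A"
  by (simp add: commutator_def)

lemma commutator_eq_zero_iff:
  "\<lbrakk>x \<in> carrier A; y \<in> carrier A\<rbrakk> \<Longrightarrow> commutator A x y = \<zero> \<longleftrightarrow> x \<otimes> y = y \<otimes> x"
  by (simp add: commutator_def)

lemma mult_swap: "\<lbrakk>x \<in> carrier A; y \<in> carrier A\<rbrakk> \<Longrightarrow> x \<otimes> y = y \<otimes> x \<oplus> commutator A x y"
  unfolding commutator_def by algebra

lemma commutator_add_right:
  "\<lbrakk>x \<in> carrier A; y \<in> carrier A; z \<in> carrier A\<rbrakk> \<Longrightarrow>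
    commutator A x (y \<oplus> z) = commutator A x y \<oplus> commutator A x z"
  unfolding commutator_def by algebra

lemma commutator_add_left:
  "\<lbrakk>x \<in> carrier A; y \<in> carrier A; z \<in> carrier A\<rbrakk> \<Longrightarrow>
    commutator A (x \<oplus> y) z = commutator A x z \<oplus> commutator A y z"
  unfolding commutator_def by algebra

lemma commutator_mult_right:
  "\<lbrakk>x \<in> carrier A; y \<in> carrier A; z \<in> carrier A\<rbrakk> \<Longrightarrow>
    commutator A x (y \<otimes> z) = commutator A x y \<otimes> z \<oplus> y \<otimes> commutator A x z"
  unfolding commutator_def by algebra

lemma commutator_smult_right:
  "\<lbrakk>x \<in> carrier A; y \<in> carrier A\<rbrakk> \<Longrightarrow> commutator A x (c \<odot> y) = c \<odot> commutator A x y"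
  unfolding commutator_def
  by (simp add: smult_mult_left smult_mult_right smult_add_right smult_minus_right a_minus_def)

lemma commutator_smult_left:
  "\<lbrakk>x \<in> carrier A; y \<in> carrier A\<rbrakk> \<Longrightarrow> commutator A (c \<odot> x) y = c \<odot> commutator A x y"
  unfolding commutator_def
  by (simp add: smult_mult_left smult_mult_right smult_add_right smult_minus_right a_minus_def)

end

lemma complex_algebra_subalgebra:
  fixes A :: "(complex, 'a) module"
  assumes "complex_algebra A" and sub: "B \<subseteq> carrier A"
    and one: "\<one>\<^bsub>A\<^esub> \<in> B"
    and mult: "\<And>x y. \<lbrakk>x \<in> B; y \<in> B\<rbrakk> \<Longrightarrow> x \<otimes>\<^bsub>A\<^esub> y \<in> B"
    and add: "\<And>x y. \<lbrakk>x \<in> B; y \<in> B\<rbrakk> \<Longrightarrow> x \<oplus>\<^bsub>A\<^esub> y \<in> B"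
    and smult: "\<And>c x. x \<in> B \<Longrightarrow> c \<odot>\<^bsub>A\<^esub> x \<in> B"
  shows "complex_algebra (A\<lparr>carrier := B\<rparr>)"
proof -
  interpret assoc_algebra A by (rule assoc_algebra.intro) fact
  have B: "x \<in> B \<Longrightarrow> x \<in> carrier A" for x using sub by blast
  have neg: "\<ominus>\<^bsub>A\<^esub> x \<in> B" if "x \<in> B" for x
    using smult[OF that, of "-1"] minus_one_smult[OF B[OF that]] by simp
  have zero: "\<zero>\<^bsub>A\<^esub> \<in> B"
    using smult[OF one, of 0] by simp
  have "ring (A\<lparr>carrier := B\<rparr>)"
  proof (intro ringI abelian_groupI monoidI, goal_cases)
    case (6 x)
    then show ?case using neg B l_neg by auto
  qed (auto simp: one zero mult add B m_assoc a_assoc l_distr r_distr intro: a_comm a_lcomm)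
  then show ?thesis
    by (rule complex_algebraI)
      (auto simp: smult B smult_add_left smult_add_right smult_smult smult_mult_left smult_mult_right)
qed

text \<open>
  Only the source has to be known to be an algebra, which spares the direct verification of the
  axioms in an endomorphism algebra.
\<close>

lemma complex_algebra_transport:
  fixes A :: "(complex, 'a) module" and B :: "(complex, 'b) module"
  assumes "complex_algebra A" and bij: "bij_betw f (carrier A) (carrier B)"
    and mult: "\<And>x y. \<lbrakk>x \<in> carrier A; y \<in> carrier A\<rbrakk> \<Longrightarrow> f (x \<otimes>\<^bsub>A\<^esub> y) = f x \<otimes>\<^bsub>B\<^esub> f y"
    and add: "\<And>x y. \<lbrakk>x \<in> carrier A; y \<in> carrier A\<rbrakk> \<Longrightarrow> f (x \<oplus>\<^bsub>A\<^esub> y) = f x \<oplus>\<^bsub>B\<^esub> f y"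
    and smult: "\<And>c x. x \<in> carrier A \<Longrightarrow> f (c \<odot>\<^bsub>A\<^esub> x) = c \<odot>\<^bsub>B\<^esub> f x"
    and one: "f \<one>\<^bsub>A\<^esub> = \<one>\<^bsub>B\<^esub>" and zero: "f \<zero>\<^bsub>A\<^esub> = \<zero>\<^bsub>B\<^esub>"
  shows "algebra_isomorphic A B"
proof -
  interpret A: assoc_algebra A by (rule assoc_algebra.intro) fact
  have B: "carrier B = f ` carrier A"
    using bij by (simp add: bij_betw_def)
  have closed: "f x \<in> carrier B" if "x \<in> carrier A" for x
    using that B by blast
  have one_closed: "\<one>\<^bsub>B\<^esub> \<in> carrier B" and zero_closed: "\<zero>\<^bsub>B\<^esub> \<in> carrier B"
    using closed[OF A.one_closed] closed[OF A.zero_closed] by (simp_all only: one zero)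
  have inverse: "\<exists>y\<in>carrier B. y \<oplus>\<^bsub>B\<^esub> x = \<zero>\<^bsub>B\<^esub>" if x: "x \<in> carrier B" for x
  proof -
    obtain a where a: "a \<in> carrier A" "x = f a" using x unfolding B by blast
    have "f (\<ominus>\<^bsub>A\<^esub> a) \<oplus>\<^bsub>B\<^esub> x = \<zero>\<^bsub>B\<^esub>"
      using a by (simp add: add[symmetric] A.l_neg zero)
    then show ?thesis using closed[OF A.a_inv_closed[OF a(1)]] by blast
  qed
  have "ring B"
  proof (intro ringI abelian_groupI monoidI one_closed zero_closed inverse)
    fix x y assume "x \<in> carrier B" "y \<in> carrier B"
    then show "x \<oplus>\<^bsub>B\<^esub> y = y \<oplus>\<^bsub>B\<^esub> x"
      by (auto simp: B add[symmetric] A.a_comm)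
  qed (auto simp: B mult[symmetric] add[symmetric] one[symmetric] zero[symmetric]
        A.m_assoc A.a_assoc A.l_distr A.r_distr)
  then have "complex_algebra B"
    by (rule complex_algebraI)
      (auto simp: B mult[symmetric] add[symmetric] smult[symmetric]
        A.smult_add_left A.smult_add_right A.smult_smult A.smult_mult_left A.smult_mult_right)
  moreover have "f \<in> algebra_hom A B"
    by (auto simp: algebra_hom_def ring_hom_def B mult add smult one)
  ultimately show ?thesis
    using assms by (auto simp: algebra_isomorphic_def)
qed

section \<open>Left ideals and ordered products\<close>

inductive_set left_ideal :: "('a, 'm) ring_scheme \<Rightarrow> 'a set \<Rightarrow> 'a set" for A (structure) and G where
  zero: "\<zero> \<in> left_ideal A G"
| gen: "\<lbrakk>a \<in> carrier A; g \<in> G\<rbrakk> \<Longrightarrow> a \<otimes> g \<in> left_ideal A G"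
| add: "\<lbrakk>x \<in> left_ideal A G; y \<in> left_ideal A G\<rbrakk> \<Longrightarrow> x \<oplus> y \<in> left_ideal A G"

context assoc_algebra
begin

lemma left_ideal_closed: "G \<subseteq> carrier A \<Longrightarrow> x \<in> left_ideal A G \<Longrightarrow> x \<in> carrier A"
  by (rotate_tac, induction rule: left_ideal.induct) auto

lemma left_ideal_mult:
  assumes "G \<subseteq> carrier A" "x \<in> left_ideal A G" "a \<in> carrier A"
  shows "a \<otimes> x \<in> left_ideal A G"
  using assms(2)
proof induction
  case (gen b g)
  then have "a \<otimes> (b \<otimes> g) = (a \<otimes> b) \<otimes> g" using assms by (auto simp: m_assoc)
  then show ?case using gen assms by (auto intro: left_ideal.gen)
next
  case (add x y)
  then show ?case
    using assms left_ideal_closed by (simp add: r_distr left_ideal.add)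
qed (use assms in \<open>auto intro: left_ideal.zero\<close>)

lemma left_ideal_smult:
  "\<lbrakk>G \<subseteq> carrier A; x \<in> left_ideal A G\<rbrakk> \<Longrightarrow> c \<odot> x \<in> left_ideal A G"
  using left_ideal_mult[of G x "c \<odot> \<one>"] left_ideal_closed[of G x] smult_as_mult[of x c] by simp

lemma left_ideal_uminus: "\<lbrakk>G \<subseteq> carrier A; x \<in> left_ideal A G\<rbrakk> \<Longrightarrow> \<ominus> x \<in> left_ideal A G"
  using left_ideal_smult[of G x "-1"] left_ideal_closed[of G x] by (simp add: minus_one_smult)

lemma left_ideal_diff:
  "\<lbrakk>G \<subseteq> carrier A; x \<in> left_ideal A G; y \<in> left_ideal A G\<rbrakk> \<Longrightarrow> x \<ominus> y \<in> left_ideal A G"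
  by (simp add: a_minus_def left_ideal.add left_ideal_uminus)

lemma left_ideal_trans:
  assumes "G \<subseteq> carrier A" "x \<ominus> y \<in> left_ideal A G" "y \<ominus> z \<in> left_ideal A G"
    "x \<in> carrier A" "y \<in> carrier A" "z \<in> carrier A"
  shows "x \<ominus> z \<in> left_ideal A G"
proof -
  have "x \<ominus> z = (x \<ominus> y) \<oplus> (y \<ominus> z)" using assms(4-6) by algebra
  then show ?thesis using assms left_ideal.add by simp
qed

lemma left_ideal_sym:
  assumes "G \<subseteq> carrier A" "x \<ominus> y \<in> left_ideal A G" "x \<in> carrier A" "y \<in> carrier A"
  shows "y \<ominus> x \<in> left_ideal A G"
proof -
  have "y \<ominus> x = \<ominus> (x \<ominus> y)" using assms(3-4) by algebra
  then show ?thesis using assms left_ideal_uminus by simp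
qed

end

text \<open>
  The factors need not commute.  The denominators and the Laurent monomials in the \<open>x\<^sub>i\<close> both have
  this form.
\<close>

definition ordered_product :: "('a, 'm) monoid_scheme \<Rightarrow> ('i \<Rightarrow> 'a) \<Rightarrow> 'i list \<Rightarrow> 'a" where
  "ordered_product G f js = foldr (\<lambda>j u. f j \<otimes>\<^bsub>G\<^esub> u) js \<one>\<^bsub>G\<^esub>"

lemma ordered_product_simps [simp]:
  "ordered_product G f [] = \<one>\<^bsub>G\<^esub>"
  "ordered_product G f (j # js) = f j \<otimes>\<^bsub>G\<^esub> ordered_product G f js"
  by (simp_all add: ordered_product_def)

lemma ordered_product_cong:
  "(\<And>j. j \<in> set js \<Longrightarrow> f j = g j) \<Longrightarrow> ordered_product G f js = ordered_product G g js"
  by (induction js) auto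

context Group.monoid
begin

lemma ordered_product_closed: "f ` set js \<subseteq> carrier G \<Longrightarrow> ordered_product G f js \<in> carrier G"
  by (induction js) auto

lemma ordered_product_commute:
  assumes "f ` set js \<subseteq> carrier G" "a \<in> carrier G" "\<And>j. j \<in> set js \<Longrightarrow> a \<otimes> f j = f j \<otimes> a"
  shows "a \<otimes> ordered_product G f js = ordered_product G f js \<otimes> a"
  using assms
proof (induction js)
  case (Cons j js)
  have c: "a \<in> carrier G" "f j \<in> carrier G" "ordered_product G f js \<in> carrier G"
    using Cons by (auto intro!: ordered_product_closed)
  have "a \<otimes> (f j \<otimes> ordered_product G f js) = (a \<otimes> f j) \<otimes> ordered_product G f js"
    using c by (simp add: m_assoc)
  also have "a \<otimes> f j = f j \<otimes> a"
    using Cons.prems by simp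
  also have "f j \<otimes> a \<otimes> ordered_product G f js = f j \<otimes> (a \<otimes> ordered_product G f js)"
    using c by (simp add: m_assoc)
  also have "a \<otimes> ordered_product G f js = ordered_product G f js \<otimes> a"
    using Cons by simp
  finally show ?case using c by (simp add: m_assoc)
qed auto

lemma ordered_product_mult:
  assumes "f ` set js \<subseteq> carrier G" "g ` set js \<subseteq> carrier G"
    and "\<And>i j. \<lbrakk>i \<in> set js; j \<in> set js\<rbrakk> \<Longrightarrow> f i \<otimes> g j = g j \<otimes> f i"
  shows "ordered_product G f js \<otimes> ordered_product G g js
    = ordered_product G (\<lambda>j. f j \<otimes> g j) js"
  using assms
proof (induction js)
  case (Cons j js)
  have c: "f j \<in> carrier G" "ordered_product G f js \<in> carrier G"
    "g j \<in> carrier G" "ordered_product G g js \<in> carrier G"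
    using Cons by (auto intro!: ordered_product_closed)
  have comm: "ordered_product G f js \<otimes> g j = g j \<otimes> ordered_product G f js"
    using Cons.prems by (intro ordered_product_commute[symmetric]) auto
  have "(f j \<otimes> ordered_product G f js) \<otimes> (g j \<otimes> ordered_product G g js)
      = f j \<otimes> (ordered_product G f js \<otimes> g j) \<otimes> ordered_product G g js"
    using c by (simp add: m_assoc)
  also have "\<dots> = f j \<otimes> g j \<otimes> (ordered_product G f js \<otimes> ordered_product G g js)"
    using c by (simp add: comm m_assoc)
  also have "ordered_product G f js \<otimes> ordered_product G g js
      = ordered_product G (\<lambda>j. f j \<otimes> g j) js"
    using Cons by simp
  finally show ?case by simp
qed auto

lemma ordered_product_single:
  assumes "distinct js" "i \<in> set js" "a \<in> carrier G"
  shows "ordered_product G (\<lambda>j. if j = i then a else \<one>) js = a"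
proof -
  have one: "ordered_product G (\<lambda>j. if j = i then a else \<one>) js = \<one>" if "i \<notin> set js" for js
    using that by (induction js) auto
  show ?thesis
    using assms by (induction js) (auto simp: one)
qed

end

section \<open>Weight decompositions\<close>

lemma (in Group.group) int_pow_commute:
  assumes x: "x \<in> carrier G" and y: "y \<in> carrier G" and xy: "x \<otimes> y = y \<otimes> x"
  shows "x [^] (a::int) \<otimes> y [^] (b::int) = y [^] b \<otimes> x [^] a"
proof -
  have *: "u [^] (m::int) \<otimes> v = v \<otimes> u [^] m"
    if u: "u \<in> carrier G" and v: "v \<in> carrier G" and uv: "u \<otimes> v = v \<otimes> u" for u v m
  proof -
    have "subgroup {z \<in> carrier G. z \<otimes> v = v \<otimes> z} G"
    proof (rule subgroupI)
      fix z w
      assume z: "z \<in> {z \<in> carrier G. z \<otimes> v = v \<otimes> z}"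
      have zc: "z \<in> carrier G" using z by simp
      have "v \<otimes> inv z = inv z \<otimes> (z \<otimes> v) \<otimes> inv z"
        using zc v by (simp add: m_assoc[symmetric])
      also have "z \<otimes> v = v \<otimes> z" using z by simp
      also have "inv z \<otimes> (v \<otimes> z) \<otimes> inv z = inv z \<otimes> v"
        using zc v by (simp add: m_assoc)
      finally show "inv z \<in> {z \<in> carrier G. z \<otimes> v = v \<otimes> z}"
        using z by simp
      assume w: "w \<in> {z \<in> carrier G. z \<otimes> v = v \<otimes> z}"
      have "v \<otimes> (z \<otimes> w) = (v \<otimes> z) \<otimes> w" using zc w v by (simp add: m_assoc)
      also have "v \<otimes> z = z \<otimes> v" using z by simp
      also have "z \<otimes> v \<otimes> w = z \<otimes> (v \<otimes> w)" using zc w v by (simp add: m_assoc)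
      also have "v \<otimes> w = w \<otimes> v" using w by simp
      also have "z \<otimes> (w \<otimes> v) = (z \<otimes> w) \<otimes> v" using zc w v by (simp add: m_assoc)
      finally show "z \<otimes> w \<in> {z \<in> carrier G. z \<otimes> v = v \<otimes> z}"
        using z w by simp
    qed (use v in auto)
    from subgroup_int_pow_closed[OF this, of u m] show ?thesis
      using u uv by simp
  qed
  show ?thesis
    using *[OF y int_pow_closed[OF x, of a] *[OF x y xy, symmetric], of b] by simp
qed

context assoc_algebra
begin

definition weight_vector :: "(nat \<Rightarrow> 'a) \<Rightarrow> (nat \<Rightarrow> int) \<Rightarrow> 'a \<Rightarrow> bool" where
  "weight_vector H \<mu> c \<longleftrightarrow> c \<in> carrier A \<and> (\<forall>k. commutator A (H k) c = of_int (\<mu> k) \<odot> c)"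

lemma weight_vector_closed: "weight_vector H \<mu> c \<Longrightarrow> c \<in> carrier A"
  by (simp add: weight_vector_def)

lemma weight_vector_zero: "range H \<subseteq> carrier A \<Longrightarrow> weight_vector H \<mu> \<zero>"
  by (auto simp: weight_vector_def commutator_def image_subset_iff)

lemma weight_vector_one: "range H \<subseteq> carrier A \<Longrightarrow> weight_vector H (\<lambda>_. 0) \<one>"
  by (auto simp: weight_vector_def commutator_def image_subset_iff)

lemma weight_vector_add:
  "\<lbrakk>range H \<subseteq> carrier A; weight_vector H \<mu> c; weight_vector H \<mu> d\<rbrakk> \<Longrightarrow>
    weight_vector H \<mu> (c \<oplus> d)"
  by (auto simp: weight_vector_def image_subset_iff commutator_add_right smult_add_right)

lemma weight_vector_smult:
  "\<lbrakk>range H \<subseteq> carrier A; weight_vector H \<mu> c\<rbrakk> \<Longrightarrow> weight_vector H \<mu> (a \<odot> c)"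
  by (auto simp: weight_vector_def image_subset_iff commutator_smult_right smult_smult mult.commute)

lemma weight_vector_mult:
  assumes "range H \<subseteq> carrier A" "weight_vector H \<mu> c" "weight_vector H \<nu> d"
  shows "weight_vector H (\<lambda>k. \<mu> k + \<nu> k) (c \<otimes> d)"
  using assms
  by (auto simp: weight_vector_def image_subset_iff commutator_mult_right smult_mult_left
      smult_mult_right smult_add_left)

text \<open>
  A derivation \<open>D\<close> satisfies \<open>D (c\<^sup>-\<^sup>1) = - c\<^sup>-\<^sup>1 D(c) c\<^sup>-\<^sup>1\<close>.
\<close>

lemma weight_vector_inv:
  assumes H: "range H \<subseteq> carrier A" and c: "weight_vector H \<mu> c" "c \<in> Units A"
  shows "weight_vector H (\<lambda>k. - \<mu> k) (inv c)"
  unfolding weight_vector_def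
proof (intro conjI allI)
  fix k
  have cl: "c \<in> carrier A" "inv c \<in> carrier A" "H k \<in> carrier A"
    using c H by auto
  have Hc: "H k \<otimes> c = of_int (\<mu> k) \<odot> c \<oplus> c \<otimes> H k"
  proof -
    have "H k \<otimes> c = commutator A (H k) c \<oplus> c \<otimes> H k"
      using mult_swap[of "H k" c] cl a_comm[of "c \<otimes> H k"] by simp
    then show ?thesis using c by (simp add: weight_vector_def)
  qed
  have "inv c \<otimes> H k = inv c \<otimes> (H k \<otimes> c) \<otimes> inv c"
    using cl c by (simp add: m_assoc)
  also have "\<dots> = of_int (\<mu> k) \<odot> inv c \<oplus> H k \<otimes> inv c"
  proof -
    have "inv c \<otimes> (c \<otimes> H k) = H k"
      using cl c by (simp add: m_assoc[symmetric])
    then show ?thesis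
      unfolding Hc using cl c
      by (simp add: r_distr l_distr smult_mult_left smult_mult_right m_assoc[symmetric])
  qed
  finally have e: "inv c \<otimes> H k = of_int (\<mu> k) \<odot> inv c \<oplus> H k \<otimes> inv c" .
  have "commutator A (H k) (inv c) = H k \<otimes> inv c \<ominus> (of_int (\<mu> k) \<odot> inv c \<oplus> H k \<otimes> inv c)"
    unfolding commutator_def e ..
  also have "\<dots> = \<ominus> (of_int (\<mu> k) \<odot> inv c)"
    using cl smult_closed'[of "inv c" "of_int (\<mu> k)"] m_closed[of "H k" "inv c"] by algebra
  finally show "commutator A (H k) (inv c) = of_int (- \<mu> k) \<odot> inv c"
    using cl by (simp add: smult_minus_left)
qed (use c in auto)

text \<open>
  Distinct weights \<open>\<mu>\<close> and \<open>\<nu>\<close> differ at some \<open>k\<close>, and applying \<open>ad (H k) - \<nu> k\<close> to a vanishing sum removes the component of weight \<open>\<nu>\<close> while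
  it multiplies the component of weight \<open>\<mu>\<close> by a nonzero number.
\<close>

lemma weight_vectors_independent:
  assumes H: "range H \<subseteq> carrier A" and "finite F"
    and "\<And>\<mu>. weight_vector H \<mu> (c \<mu>)" "(\<Oplus>\<mu>\<in>F. c \<mu>) = \<zero>" "\<mu> \<in> F"
  shows "c \<mu> = \<zero>"
  using assms(2-)
proof (induction F arbitrary: c \<mu> rule: finite_induct)
  case (insert \<nu> F)
  have cl: "c \<mu> \<in> carrier A" for \<mu>
    using insert.prems(1) weight_vector_closed by blast
  have sum: "c \<nu> \<oplus> (\<Oplus>\<mu>\<in>F. c \<mu>) = \<zero>"
    using insert cl by (simp add: Pi_def)
  have F0: "c \<mu> = \<zero>" if \<mu>: "\<mu> \<in> F" for \<mu>
  proof -
    have "\<mu> \<noteq> \<nu>" using \<mu> insert by auto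
    then obtain k where k: "\<mu> k \<noteq> \<nu> k" by blast
    have Hk: "H k \<in> carrier A" using H by auto
    define c' where "c' \<kappa> = of_int (\<kappa> k - \<nu> k) \<odot> c \<kappa>" for \<kappa>
    have c': "c' \<kappa> = commutator A (H k) (c \<kappa>) \<ominus> of_int (\<nu> k) \<odot> c \<kappa>" for \<kappa>
      using insert.prems(1)[of \<kappa>] cl
      by (simp add: c'_def weight_vector_def smult_diff_left)
    have cl': "c' \<kappa> \<in> carrier A" for \<kappa> using cl by (simp add: c'_def)
    have sums: "finite G \<Longrightarrow> (\<Oplus>\<kappa>\<in>G. c' \<kappa>)
        = commutator A (H k) (\<Oplus>\<kappa>\<in>G. c \<kappa>) \<ominus> of_int (\<nu> k) \<odot> (\<Oplus>\<kappa>\<in>G. c \<kappa>)" for G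
    proof (induction G rule: finite_induct)
      case empty
      then show ?case using Hk by (simp add: commutator_def a_minus_def)
    next
      case (insert \<kappa> G)
      define s where "s = (\<Oplus>\<kappa>\<in>G. c \<kappa>)"
      have s: "s \<in> carrier A" unfolding s_def using cl by (intro finsum_closed) auto
      have "(\<Oplus>\<kappa>\<in>insert \<kappa> G. c' \<kappa>) = c' \<kappa> \<oplus> (\<Oplus>\<kappa>\<in>G. c' \<kappa>)"
        using insert cl' by (simp add: Pi_def)
      also have "\<dots> = (commutator A (H k) (c \<kappa>) \<ominus> of_int (\<nu> k) \<odot> c \<kappa>)
          \<oplus> (commutator A (H k) s \<ominus> of_int (\<nu> k) \<odot> s)"
        unfolding insert.IH c'[of \<kappa>] s_def ..
      also have "\<dots> = (commutator A (H k) (c \<kappa>) \<oplus> commutator A (H k) s)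
          \<ominus> (of_int (\<nu> k) \<odot> c \<kappa> \<oplus> of_int (\<nu> k) \<odot> s)"
        using commutator_closed[OF Hk cl[of \<kappa>]] commutator_closed[OF Hk s]
          smult_closed'[OF cl[of \<kappa>], of "of_int (\<nu> k)"] smult_closed'[OF s, of "of_int (\<nu> k)"]
        by algebra
      also have "\<dots> = commutator A (H k) (c \<kappa> \<oplus> s) \<ominus> of_int (\<nu> k) \<odot> (c \<kappa> \<oplus> s)"
        using cl s Hk by (simp add: commutator_add_right smult_add_right)
      also have "c \<kappa> \<oplus> s = (\<Oplus>\<kappa>\<in>insert \<kappa> G. c \<kappa>)"
        unfolding s_def using insert cl by (simp add: Pi_def)
      finally show ?case .
    qed
    have "(\<Oplus>\<kappa>\<in>F. c' \<kappa>) = c' \<nu> \<oplus> (\<Oplus>\<kappa>\<in>F. c' \<kappa>)"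
      using cl cl' by (simp add: c'_def[of \<nu>] Pi_def)
    also have "\<dots> = (\<Oplus>\<kappa>\<in>insert \<nu> F. c' \<kappa>)"
      using insert cl' by (simp add: Pi_def)
    also have "\<dots> = \<zero>"
      using sums[of "insert \<nu> F"] insert Hk by (simp add: commutator_def a_minus_def)
    finally have "(\<Oplus>\<kappa>\<in>F. c' \<kappa>) = \<zero>" .
    moreover have "weight_vector H \<kappa> (c' \<kappa>)" for \<kappa>
      unfolding c'_def using insert.prems(1) H weight_vector_smult by blast
    ultimately have "c' \<mu> = \<zero>"
      using insert.IH[of c'] \<mu> by blast
    then show ?thesis
      using k cl by (auto simp: c'_def intro: smult_eq_zero_imp[of _ "of_int (\<mu> k - \<nu> k)"])
  qed
  then have "(\<Oplus>\<mu>\<in>F. c \<mu>) = \<zero>"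
    by (simp cong: finsum_cong)
  then have "c \<nu> = \<zero>" using sum cl by simp
  then show ?case using F0 insert.prems by auto
qed simp

end

section \<open>Representatives of weight zero\<close>

text \<open>
  In the application the \<open>H k\<close> form the basis of the Cartan subalgebra that is dual to the weights of
  the \<open>x i\<close>.  Weights are functions on all natural numbers; the convention \<open>H k = \<zero>\<close> for the other
  indices makes the weight of every nonzero vector vanish there, so that a weight is determined by
  its values on \<open>{1..n}\<close>.
\<close>

locale torus_algebra = assoc_algebra L for L :: "(complex, 'b) module" (structure) +
  fixes n :: nat and H x :: "nat \<Rightarrow> 'b"
  assumes H_closed: "H k \<in> carrier L"
    and H_zero: "k \<notin> {1..n} \<Longrightarrow> H k = \<zero>"
    and x_unit: "i \<in> {1..n} \<Longrightarrow> x i \<in> Units L"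
    and x_comm: "\<lbrakk>i \<in> {1..n}; j \<in> {1..n}\<rbrakk> \<Longrightarrow> x i \<otimes> x j = x j \<otimes> x i"
    and x_weight: "i \<in> {1..n} \<Longrightarrow> commutator L (H k) (x i) = (if k = i then x i else \<zero>)"
begin

lemma H_range: "range H \<subseteq> carrier L"
  using H_closed by auto

lemma x_closed: "i \<in> {1..n} \<Longrightarrow> x i \<in> carrier L"
  using x_unit by auto

abbreviation weight where "weight \<equiv> weight_vector H"

definition centralizer_H :: "'b set" where
  "centralizer_H = {u \<in> carrier L. \<forall>k. commutator L (H k) u = \<zero>}"

lemma centralizer_H_iff: "u \<in> centralizer_H \<longleftrightarrow> weight (\<lambda>_. 0) u"
  by (auto simp: centralizer_H_def weight_vector_def)

lemma group_units: "Group.group (units_of L)"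
  by (rule units_group)

sublocale units: Group.group "units_of L"
  by (rule group_units)

lemma x_weight_vector: "i \<in> {1..n} \<Longrightarrow> weight (\<lambda>k. if k = i then 1 else 0) (x i)"
  using x_closed x_weight by (auto simp: weight_vector_def)

definition x_monomial :: "(nat \<Rightarrow> int) \<Rightarrow> 'b" where
  "x_monomial \<mu> = ordered_product (units_of L) (\<lambda>i. x i [^]\<^bsub>units_of L\<^esub> \<mu> i) [1..<n + 1]"

lemma x_pow_unit: "i \<in> {1..n} \<Longrightarrow> x i [^]\<^bsub>units_of L\<^esub> (m::int) \<in> Units L"
  using units.int_pow_closed[of "x i" m] x_unit by (simp add: units_of_carrier)

lemma x_monomial_unit: "x_monomial \<mu> \<in> Units L"
  using units.ordered_product_closed[of "\<lambda>i. x i [^]\<^bsub>units_of L\<^esub> \<mu> i" "[1..<n + 1]"] x_pow_unit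
  by (auto simp: x_monomial_def units_of_carrier image_subset_iff simp del: upt_Suc)

lemma x_monomial_closed [simp]: "x_monomial \<mu> \<in> carrier L"
  using x_monomial_unit by auto

lemma x_pow_comm:
  assumes "i \<in> {1..n}" "j \<in> {1..n}"
  shows "x i [^]\<^bsub>units_of L\<^esub> (a::int) \<otimes> x j [^]\<^bsub>units_of L\<^esub> (b::int)
    = x j [^]\<^bsub>units_of L\<^esub> b \<otimes> x i [^]\<^bsub>units_of L\<^esub> a"
  using units.int_pow_commute[of "x i" "x j" a b] assms x_unit x_comm
  by (simp add: units_of_carrier units_of_mult)

lemma x_monomial_mult: "x_monomial \<mu> \<otimes> x_monomial \<nu> = x_monomial (\<lambda>i. \<mu> i + \<nu> i)"
proof -
  have "x_monomial \<mu> \<otimes>\<^bsub>units_of L\<^esub> x_monomial \<nu> = ordered_product (units_of L)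
    (\<lambda>i. x i [^]\<^bsub>units_of L\<^esub> \<mu> i \<otimes>\<^bsub>units_of L\<^esub> x i [^]\<^bsub>units_of L\<^esub> \<nu> i) [1..<n + 1]"
    unfolding x_monomial_def
    by (rule units.ordered_product_mult)
      (auto simp: units_of_carrier x_pow_unit units_of_mult x_pow_comm simp del: upt_Suc)
  also have "\<dots> = x_monomial (\<lambda>i. \<mu> i + \<nu> i)"
    unfolding x_monomial_def
    by (intro ordered_product_cong units.int_pow_mult[symmetric])
      (use x_unit in \<open>auto simp: units_of_carrier\<close>)
  finally show ?thesis by (simp add: units_of_mult)
qed

lemma x_monomial_zero: "x_monomial (\<lambda>_. 0) = \<one>"
proof -
  have "ordered_product (units_of L) (\<lambda>i. \<one>\<^bsub>units_of L\<^esub>) js = \<one>\<^bsub>units_of L\<^esub>" for js :: "nat list"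
    by (induction js) auto
  then show ?thesis by (simp add: x_monomial_def units_of_one)
qed

lemma x_monomial_single:
  assumes "i \<in> {1..n}"
  shows "x_monomial (\<lambda>k. if k = i then 1 else 0) = x i"
proof -
  have "x_monomial (\<lambda>k. if k = i then 1 else 0)
      = ordered_product (units_of L) (\<lambda>k. if k = i then x i else \<one>\<^bsub>units_of L\<^esub>) [1..<n + 1]"
    unfolding x_monomial_def
    by (rule ordered_product_cong) (use x_unit in \<open>auto simp: units_of_carrier units.int_pow_1\<close>)
  also have "\<dots> = x i"
    by (rule units.ordered_product_single) (use assms x_unit in \<open>auto simp: units_of_carrier\<close>)
  finally show ?thesis .
qed

lemma x_monomial_induct:
  assumes sub: "subgroup P (units_of L)" and x: "\<And>i. i \<in> {1..n} \<Longrightarrow> x i \<in> P"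
  shows "x_monomial \<mu> \<in> P"
proof -
  have "ordered_product (units_of L) (\<lambda>i. x i [^]\<^bsub>units_of L\<^esub> \<mu> i) js \<in> P" if "set js \<subseteq> {1..n}" for js
    using that
  proof (induction js)
    case (Cons i js)
    have "x i [^]\<^bsub>units_of L\<^esub> \<mu> i \<in> P"
      using units.subgroup_int_pow_closed[OF sub x, of i "\<mu> i"] Cons by simp
    then show ?case
      using Cons subgroup.m_closed[OF sub] by auto
  qed (use subgroup.one_closed[OF sub] in auto)
  from this[of "[1..<n + 1]"] show ?thesis
    by (simp add: x_monomial_def atLeastLessThanSuc_atLeastAtMost del: upt_Suc)
qed

text \<open>
  Only the exponents with index in \<open>{1..n}\<close> enter the monomial, hence the truncation.
\<close>

lemma x_monomial_weight: "weight (\<lambda>k. if k \<in> {1..n} then \<mu> k else 0) (x_monomial \<mu>)"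
proof -
  have nat: "weight (\<lambda>k. if k = i then int m else 0) (x i [^]\<^bsub>units_of L\<^esub> m)"
    if "i \<in> {1..n}" for i m
  proof (induction m)
    case 0
    then show ?case using weight_vector_one[OF H_range] by (simp add: units_of_one cong: if_cong)
  next
    case (Suc m)
    have "weight (\<lambda>k. (if k = i then int m else 0) + (if k = i then 1 else 0))
        (x i [^]\<^bsub>units_of L\<^esub> m \<otimes> x i)"
      by (rule weight_vector_mult[OF H_range Suc x_weight_vector[OF that]])
    moreover have "(\<lambda>k. (if k = i then int m else 0) + (if k = i then 1 else 0))
        = (\<lambda>k. if k = i then int (Suc m) else 0)" by auto
    ultimately show ?case by (simp add: units_of_mult)
  qed
  have int: "weight (\<lambda>k. if k = i then m else 0) (x i [^]\<^bsub>units_of L\<^esub> m)"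
    if i: "i \<in> {1..n}" for i and m :: int
  proof (cases "m \<ge> 0")
    case True
    then obtain p where "m = int p" using nonneg_int_cases by blast
    then show ?thesis using nat[OF i, of p] by (simp add: int_pow_int cong: if_cong)
  next
    case False
    then have p: "m = - int (nat (- m))" by simp
    define p where "p = nat (- m)"
    note p = p[folded p_def]
    have u: "x i [^]\<^bsub>units_of L\<^esub> p \<in> Units L"
      using x_pow_unit[OF i, of "int p"] by (simp add: int_pow_int)
    have "x i [^]\<^bsub>units_of L\<^esub> m = inv (x i [^]\<^bsub>units_of L\<^esub> p)"
      using units.int_pow_neg[of "x i" "int p"] x_unit[OF i] u p
      by (simp add: units_of_carrier int_pow_int units_of_inv)
    moreover have "weight (\<lambda>k. - (if k = i then int p else 0)) (inv (x i [^]\<^bsub>units_of L\<^esub> p))"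
      by (rule weight_vector_inv[OF H_range nat[OF i] u])
    moreover have "(\<lambda>k. - (if k = i then int p else 0)) = (\<lambda>k. if k = i then m else 0)"
      using p by auto
    ultimately show ?thesis by simp
  qed
  have "weight (\<lambda>k. if k \<in> set js then \<mu> k else 0)
      (ordered_product (units_of L) (\<lambda>i. x i [^]\<^bsub>units_of L\<^esub> \<mu> i) js)"
    if "set js \<subseteq> {1..n}" "distinct js" for js
    using that
  proof (induction js)
    case Nil
    then show ?case using weight_vector_one[OF H_range] by (simp add: units_of_one)
  next
    case (Cons i js)
    have i: "i \<in> {1..n}" using Cons by auto
    have "weight (\<lambda>k. (if k = i then \<mu> i else 0) + (if k \<in> set js then \<mu> k else 0))
      (x i [^]\<^bsub>units_of L\<^esub> \<mu> i \<otimes> ordered_product (units_of L) (\<lambda>i. x i [^]\<^bsub>units_of L\<^esub> \<mu> i) js)"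
      using Cons by (intro weight_vector_mult[OF H_range int[OF i]]) auto
    moreover have "(\<lambda>k. (if k = i then \<mu> i else 0) + (if k \<in> set js then \<mu> k else 0))
        = (\<lambda>k. if k \<in> set (i # js) then \<mu> k else 0)"
      using Cons by auto
    ultimately show ?case by (simp add: units_of_mult)
  qed
  from this[of "[1..<n + 1]"] show ?thesis
    by (simp add: x_monomial_def atLeastLessThanSuc_atLeastAtMost del: upt_Suc)
qed

definition J :: "'b set" where
  "J = left_ideal L ((\<lambda>i. x i \<ominus> \<one>) ` {1..n})"

lemma J_gens: "(\<lambda>i. x i \<ominus> \<one>) ` {1..n} \<subseteq> carrier L"
  using x_closed by auto

lemmas J_closed = left_ideal_closed[OF J_gens, folded J_def]
  and J_mult = left_ideal_mult[OF J_gens, folded J_def]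
  and J_smult = left_ideal_smult[OF J_gens, folded J_def]
  and J_trans = left_ideal_trans[OF J_gens, folded J_def]
  and J_sym = left_ideal_sym[OF J_gens, folded J_def]
  and J_add = left_ideal.add[where A = L and G = "(\<lambda>i. x i \<ominus> \<one>) ` {1..n}", folded J_def]
  and J_zero = left_ideal.zero[where A = L and G = "(\<lambda>i. x i \<ominus> \<one>) ` {1..n}", folded J_def]

lemma J_gen: "\<lbrakk>a \<in> carrier L; i \<in> {1..n}\<rbrakk> \<Longrightarrow> a \<otimes> x i \<ominus> a \<in> J"
proof -
  assume a: "a \<in> carrier L" and i: "i \<in> {1..n}"
  have "a \<otimes> x i \<ominus> a = a \<otimes> (x i \<ominus> \<one>)"
    using a x_closed[OF i] by (simp add: a_minus_def r_distr r_minus)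
  then show ?thesis using a i by (auto simp: J_def intro: left_ideal.gen)
qed

lemma J_induct [consumes 1, case_names zero gen add]:
  assumes "u \<in> J" "P \<zero>" "\<And>a i. \<lbrakk>a \<in> carrier L; i \<in> {1..n}\<rbrakk> \<Longrightarrow> P (a \<otimes> x i \<ominus> a)"
    "\<And>u v. \<lbrakk>u \<in> J; v \<in> J; P u; P v\<rbrakk> \<Longrightarrow> P (u \<oplus> v)"
  shows "P u"
  using assms(1) unfolding J_def
proof (induction rule: left_ideal.induct)
  case (gen a g)
  then obtain i where i: "i \<in> {1..n}" "g = x i \<ominus> \<one>" by auto
  have "a \<otimes> g = a \<otimes> x i \<ominus> a"
    using gen(1) x_closed[OF i(1)] unfolding i(2) by (simp add: a_minus_def r_distr r_minus)
  then show ?case using assms(3) gen i by simp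
qed (use assms in \<open>auto simp: J_def\<close>)

text \<open>
  The units \<open>m\<close> that act trivially from the right modulo \<open>J\<close> form a group: from
  \<open>a m\<^sup>-\<^sup>1 m - a m\<^sup>-\<^sup>1 \<in> J\<close> one reads off the claim for \<open>m\<^sup>-\<^sup>1\<close>.
\<close>

lemma x_monomial_mod_J: "a \<in> carrier L \<Longrightarrow> a \<otimes> x_monomial \<mu> \<ominus> a \<in> J"
proof -
  define P where "P = {m \<in> Units L. \<forall>a\<in>carrier L. a \<otimes> m \<ominus> a \<in> J}"
  have "subgroup P (units_of L)"
  proof (rule units.subgroupI)
    show "P \<subseteq> carrier (units_of L)" by (auto simp: P_def units_of_carrier)
    have "\<one> \<in> P" using J_zero by (auto simp: P_def)
    then show "P \<noteq> {}" by auto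
    fix m assume m: "m \<in> P"
    have "a \<otimes> inv m \<ominus> a \<in> J" if a: "a \<in> carrier L" for a
    proof -
      have "(a \<otimes> inv m) \<otimes> m \<ominus> a \<otimes> inv m \<in> J"
        using m a by (auto simp: P_def)
      moreover have "(a \<otimes> inv m) \<otimes> m = a"
        using m a by (simp add: P_def m_assoc Units_l_inv Units_closed)
      ultimately have "a \<ominus> a \<otimes> inv m \<in> J" by simp
      then show ?thesis using m a J_sym by (simp add: P_def)
    qed
    then show "inv\<^bsub>units_of L\<^esub> m \<in> P"
      using m by (auto simp: P_def units_of_inv)
    fix m' assume m': "m' \<in> P"
    have "a \<otimes> (m \<otimes> m') \<ominus> a \<in> J" if a: "a \<in> carrier L" for a
    proof -
      have "(a \<otimes> m) \<otimes> m' \<ominus> a \<otimes> m \<in> J" "a \<otimes> m \<ominus> a \<in> J"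
        using m m' a by (auto simp: P_def)
      then show ?thesis
        using J_trans[of "(a \<otimes> m) \<otimes> m'" "a \<otimes> m" a] m m' a
        by (simp add: P_def m_assoc Units_closed)
    qed
    then show "m \<otimes>\<^bsub>units_of L\<^esub> m' \<in> P"
      using m m' by (auto simp: P_def units_of_mult)
  qed
  then have "x_monomial \<mu> \<in> P"
    by (rule x_monomial_induct) (use x_unit J_gen in \<open>auto simp: P_def\<close>)
  then show "a \<in> carrier L \<Longrightarrow> ?thesis" by (auto simp: P_def)
qed

text \<open>
  The graph of the projection \<open>\<Oplus> L\<^sub>0 x\<^sup>\<mu> \<rightarrow> L\<^sub>0\<close> given by \<open>x = 1\<close>.  It is introduced as a relation
  because its two properties have different sources: it is single-valued by the independence of
  weight vectors, and it is everywhere defined only if weight vectors span \<open>L\<close>.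
\<close>

inductive untwist :: "'b \<Rightarrow> 'b \<Rightarrow> bool" where
  zero: "untwist \<zero> \<zero>"
| weight: "weight \<mu> c \<Longrightarrow> untwist c (c \<otimes> x_monomial (\<lambda>k. - \<mu> k))"
| add: "\<lbrakk>untwist a a'; untwist b b'\<rbrakk> \<Longrightarrow> untwist (a \<oplus> b) (a' \<oplus> b')"

lemma untwist_closed: "untwist a a' \<Longrightarrow> a \<in> carrier L \<and> a' \<in> carrier L"
  by (induction rule: untwist.induct) (auto simp: weight_vector_closed)

lemma untwist_smult: "untwist a a' \<Longrightarrow> untwist (c \<odot> a) (c \<odot> a')"
proof (induction rule: untwist.induct)
  case (weight \<mu> d)
  then show ?case
    using untwist.weight[OF weight_vector_smult[OF H_range weight], of c] weight_vector_closed
    by (simp add: smult_mult_left)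
next
  case (add a a' b b')
  then show ?case using untwist.add[OF add.IH] untwist_closed by (simp add: smult_add_right)
qed (use untwist.zero in auto)

lemma untwist_diff:
  "\<lbrakk>untwist a a'; untwist b b'\<rbrakk> \<Longrightarrow> untwist (a \<ominus> b) (a' \<ominus> b')"
  using untwist.add[of a a' "(-1) \<odot> b" "(-1) \<odot> b'"] untwist_smult[of b b' "-1"] untwist_closed
  by (auto simp: minus_one_smult a_minus_def)

lemma untwist_centralizes: "untwist a a' \<Longrightarrow> a' \<in> centralizer_H"
proof (induction rule: untwist.induct)
  case zero
  then show ?case using weight_vector_zero[OF H_range] by (simp add: centralizer_H_iff)
next
  case (weight \<mu> c)
  define m where "m = x_monomial (\<lambda>k. - \<mu> k)"
  have w: "weight (\<lambda>k. \<mu> k + (if k \<in> {1..n} then - \<mu> k else 0)) (c \<otimes> m)"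
    unfolding m_def by (rule weight_vector_mult[OF H_range weight x_monomial_weight])
  have cm: "c \<otimes> m \<in> carrier L" using w weight_vector_closed by blast
  have "commutator L (H k) (c \<otimes> m) = \<zero>" for k
    using w cm H_zero[of k] by (cases "k \<in> {1..n}") (auto simp: weight_vector_def commutator_def)
  then show ?case using cm by (simp add: centralizer_H_def m_def)
next
  case (add a a' b b')
  then show ?case using weight_vector_add[OF H_range] by (simp add: centralizer_H_iff)
qed

lemma untwist_mod_J: "untwist a a' \<Longrightarrow> a' \<ominus> a \<in> J"
proof (induction rule: untwist.induct)
  case (weight \<mu> c)
  then show ?case using x_monomial_mod_J weight_vector_closed by blast
next
  case (add a a' b b')
  have "(a' \<oplus> b') \<ominus> (a \<oplus> b) = (a' \<ominus> a) \<oplus> (b' \<ominus> b)"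
    using untwist_closed[OF add(1)] untwist_closed[OF add(2)] by algebra
  then show ?case using add J_add by simp
qed (simp add: J_zero)

text \<open>
  Right multiplication by \<open>x i\<close> raises the weight by the weight of \<open>x i\<close>, which the additional
  factor in the inverse monomial compensates.
\<close>

lemma untwist_mult_x: "\<lbrakk>untwist a a'; i \<in> {1..n}\<rbrakk> \<Longrightarrow> untwist (a \<otimes> x i) a'"
proof (induction rule: untwist.induct)
  case zero
  then show ?case using x_closed untwist.zero by simp
next
  case (weight \<mu> c)
  let ?e = "\<lambda>k. if k = i then 1 else 0 :: int"
  have "untwist (c \<otimes> x i) (c \<otimes> x i \<otimes> x_monomial (\<lambda>k. - (\<mu> k + ?e k)))"
    by (rule untwist.weight[OF weight_vector_mult[OF H_range weight(1) x_weight_vector[OF weight(2)]]])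
  also have "c \<otimes> x i \<otimes> x_monomial (\<lambda>k. - (\<mu> k + ?e k))
      = c \<otimes> (x_monomial ?e \<otimes> x_monomial (\<lambda>k. - (\<mu> k + ?e k)))"
    using weight x_closed weight_vector_closed by (simp add: m_assoc x_monomial_single)
  also have "x_monomial ?e \<otimes> x_monomial (\<lambda>k. - (\<mu> k + ?e k)) = x_monomial (\<lambda>k. - \<mu> k)"
    by (simp add: x_monomial_mult)
  finally show ?case .
next
  case (add a a' b b')
  then show ?case using untwist.add[of "a \<otimes> x i" a' "b \<otimes> x i" b'] untwist_closed x_closed
    by (simp add: l_distr)
qed

text \<open>
  Collecting the summands of equal weight turns a derivation of \<^const>\<open>untwist\<close> into a finite family
  indexed by weights, to which independence applies.
\<close>

lemma untwist_family:
  assumes "untwist a a'"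
  shows "\<exists>F c. finite F \<and> (\<forall>\<mu>. weight \<mu> (c \<mu>)) \<and> (\<forall>\<mu>. \<mu> \<notin> F \<longrightarrow> c \<mu> = \<zero>) \<and>
    a = (\<Oplus>\<mu>\<in>F. c \<mu>) \<and> a' = (\<Oplus>\<mu>\<in>F. c \<mu> \<otimes> x_monomial (\<lambda>k. - \<mu> k))"
  using assms
proof induction
  case zero
  show ?case
    by (rule exI[of _ "{}"], rule exI[of _ "\<lambda>_. \<zero>"]) (auto simp: weight_vector_zero[OF H_range])
next
  case (weight \<mu> d)
  then show ?case
    using weight_vector_closed[OF weight]
    by (intro exI[of _ "{\<mu>}"] exI[of _ "\<lambda>\<nu>. if \<nu> = \<mu> then d else \<zero>"])
      (auto simp: weight_vector_zero[OF H_range])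
next
  case (add a a' b b')
  from add.IH(1) obtain F c where F: "finite F" "\<And>\<mu>. weight \<mu> (c \<mu>)" "\<And>\<mu>. \<mu> \<notin> F \<Longrightarrow> c \<mu> = \<zero>"
      "a = (\<Oplus>\<mu>\<in>F. c \<mu>)" "a' = (\<Oplus>\<mu>\<in>F. c \<mu> \<otimes> x_monomial (\<lambda>k. - \<mu> k))"
    by blast
  from add.IH(2) obtain G d where G: "finite G" "\<And>\<mu>. weight \<mu> (d \<mu>)" "\<And>\<mu>. \<mu> \<notin> G \<Longrightarrow> d \<mu> = \<zero>"
      "b = (\<Oplus>\<mu>\<in>G. d \<mu>)" "b' = (\<Oplus>\<mu>\<in>G. d \<mu> \<otimes> x_monomial (\<lambda>k. - \<mu> k))"
    by blast
  have cl: "c \<mu> \<in> carrier L" "d \<mu> \<in> carrier L" for \<mu>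
    using F G weight_vector_closed by blast+
  have ext: "(\<Oplus>\<mu>\<in>F. f \<mu>) = (\<Oplus>\<mu>\<in>F \<union> G. f \<mu>)" "(\<Oplus>\<mu>\<in>G. g \<mu>) = (\<Oplus>\<mu>\<in>F \<union> G. g \<mu>)"
    if "\<And>\<mu>. f \<mu> \<in> carrier L" "\<And>\<mu>. \<mu> \<notin> F \<Longrightarrow> f \<mu> = \<zero>"
      "\<And>\<mu>. g \<mu> \<in> carrier L" "\<And>\<mu>. \<mu> \<notin> G \<Longrightarrow> g \<mu> = \<zero>" for f g
    using that F G by (auto intro!: add.finprod_mono_neutral_cong_left)
  show ?case
  proof (intro exI conjI allI impI)
    show "finite (F \<union> G)" using F G by simp
    show "weight \<mu> (c \<mu> \<oplus> d \<mu>)" for \<mu>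
      using F G weight_vector_add[OF H_range] by blast
    show "c \<mu> \<oplus> d \<mu> = \<zero>" if "\<mu> \<notin> F \<union> G" for \<mu>
      using that F G by auto
    show "a \<oplus> b = (\<Oplus>\<mu>\<in>F \<union> G. c \<mu> \<oplus> d \<mu>)"
      unfolding F(4) G(4) using cl F(3) G(3)
      by (subst ext(1)[of c d], simp, simp, simp, simp, subst ext(2)[of c d], simp, simp, simp, simp)
        (simp add: finsum_addf Pi_def)
    show "a' \<oplus> b' = (\<Oplus>\<mu>\<in>F \<union> G. (c \<mu> \<oplus> d \<mu>) \<otimes> x_monomial (\<lambda>k. - \<mu> k))"
      unfolding F(5) G(5) using cl F(3) G(3)
      by (subst ext(1)[where g = "\<lambda>\<mu>. d \<mu> \<otimes> x_monomial (\<lambda>k. - \<mu> k)"], simp, simp, simp, simp,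
          subst ext(2)[where f = "\<lambda>\<mu>. c \<mu> \<otimes> x_monomial (\<lambda>k. - \<mu> k)"], simp, simp, simp, simp)
        (simp add: finsum_addf Pi_def l_distr)
  qed
qed

lemma untwist_zero: "untwist \<zero> a' \<Longrightarrow> a' = \<zero>"
proof -
  assume "untwist \<zero> a'"
  from untwist_family[OF this] obtain F c where F: "finite F" "\<And>\<mu>. weight \<mu> (c \<mu>)"
    "\<zero> = (\<Oplus>\<mu>\<in>F. c \<mu>)" "a' = (\<Oplus>\<mu>\<in>F. c \<mu> \<otimes> x_monomial (\<lambda>k. - \<mu> k))"
    by blast
  have "c \<mu> = \<zero>" if "\<mu> \<in> F" for \<mu>
    using weight_vectors_independent[OF H_range F(1,2) F(3)[symmetric] that] .
  then show ?thesis unfolding F(4) by (simp cong: finsum_cong)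
qed

end

locale spanned_torus_algebra = torus_algebra +
  assumes spanned: "u \<in> carrier L \<Longrightarrow> \<exists>u'. untwist u u'"
begin

text \<open>
  Every element is congruent to its untwisted form.
\<close>

lemma representative_exists:
  assumes "u \<in> carrier L" shows "\<exists>w \<in> centralizer_H. w \<ominus> u \<in> J"
  using spanned[OF assms] untwist_centralizes untwist_mod_J by blast

text \<open>
  The untwisted forms of \<open>a x\<^sub>i\<close> and of \<open>a\<close> agree, so the generators of \<open>J\<close> untwist to zero.
\<close>

lemma untwist_J: "u \<in> J \<Longrightarrow> untwist u \<zero>"
proof (induction rule: J_induct)
  case (gen a i)
  then obtain a' where a': "untwist a a'" using spanned by blast
  have "untwist (a \<otimes> x i \<ominus> a) (a' \<ominus> a')"
    by (rule untwist_diff[OF untwist_mult_x[OF a' gen(2)] a'])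
  moreover have "a' \<ominus> a' = \<zero>" using untwist_closed[OF a'] by simp
  ultimately show ?case by simp
next
  case (add u v)
  then show ?case using untwist.add[of u \<zero> v \<zero>] by simp
qed (rule untwist.zero)

text \<open>
  Such an element untwists both to itself and to zero.
\<close>

lemma centralizer_H_Int_J:
  assumes "u \<in> centralizer_H" "u \<in> J" shows "u = \<zero>"
proof -
  have u: "u \<in> carrier L" using assms(1) by (simp add: centralizer_H_def)
  have "untwist u (u \<otimes> x_monomial (\<lambda>k. - 0))"
    by (rule untwist.weight) (use assms(1) in \<open>simp add: centralizer_H_iff\<close>)
  then have "untwist u u" using u by (simp add: x_monomial_zero)
  from untwist_diff[OF this untwist_J[OF assms(2)]] have "untwist (u \<ominus> u) (u \<ominus> \<zero>)" .
  then have "untwist \<zero> u" using u by (simp add: minus_eq r_neg)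
  then show ?thesis by (rule untwist_zero)
qed

end

section \<open>Endomorphisms of the Whittaker quotient\<close>

inductive_set generated_subalgebra :: "(complex, 'a) module \<Rightarrow> 'a set \<Rightarrow> 'a set"
  for A (structure) and G where
  one: "\<one> \<in> generated_subalgebra A G"
| mult: "\<lbrakk>g \<in> G; a \<in> generated_subalgebra A G\<rbrakk> \<Longrightarrow> g \<otimes> a \<in> generated_subalgebra A G"
| add: "\<lbrakk>a \<in> generated_subalgebra A G; b \<in> generated_subalgebra A G\<rbrakk> \<Longrightarrow>
    a \<oplus> b \<in> generated_subalgebra A G"
| smult: "a \<in> generated_subalgebra A G \<Longrightarrow> c \<odot> a \<in> generated_subalgebra A G"

lemma (in assoc_algebra) generated_subalgebra_closed:
  "G \<subseteq> carrier A \<Longrightarrow> a \<in> generated_subalgebra A G \<Longrightarrow> a \<in> carrier A"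
  by (rotate_tac, induction rule: generated_subalgebra.induct) auto

text \<open>
  Here \<open>\<rho>\<close> presents the module \<open>Q\<close> over the Lie algebra \<open>g\<close> as \<open>L / J\<close>, and \<open>g\<close> acts through
  \<open>\<sigma>\<close>.  Endomorphisms of \<open>Q\<close> are only known to commute with \<open>g\<close>, not with the whole of \<open>L\<close>; they are
  determined by the image of \<open>\<rho> \<one>\<close> because the image of \<open>g\<close> generates \<open>L\<close> modulo \<open>J\<close>.
\<close>

locale whittaker_model = spanned_torus_algebra L n H x
  for L :: "(complex, 'b) module" (structure) and n H x +
  fixes g :: "'x set" and \<sigma> :: "'x \<Rightarrow> 'b"
    and Q :: "(complex, 'v) module" and act :: "'x \<Rightarrow> 'v \<Rightarrow> 'v" and \<rho> :: "'b \<Rightarrow> 'v"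
  assumes \<sigma>_closed: "X \<in> g \<Longrightarrow> \<sigma> X \<in> carrier L"
    and x_in_\<sigma>: "i \<in> {1..n} \<Longrightarrow> \<exists>X\<in>g. \<sigma> X = x i"
    and generated_mod_J: "a \<in> carrier L \<Longrightarrow> \<exists>b \<in> generated_subalgebra L (\<sigma> ` g). a \<ominus> b \<in> J"
    and \<rho>_image: "\<rho> ` carrier L = carrier Q"
    and \<rho>_eq_iff: "\<lbrakk>a \<in> carrier L; b \<in> carrier L\<rbrakk> \<Longrightarrow> \<rho> a = \<rho> b \<longleftrightarrow> a \<ominus> b \<in> J"
    and \<rho>_add: "\<lbrakk>a \<in> carrier L; b \<in> carrier L\<rbrakk> \<Longrightarrow> \<rho> (a \<oplus> b) = \<rho> a \<oplus>\<^bsub>Q\<^esub> \<rho> b"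
    and \<rho>_smult: "a \<in> carrier L \<Longrightarrow> \<rho> (c \<odot> a) = c \<odot>\<^bsub>Q\<^esub> \<rho> a"
    and \<rho>_zero: "\<rho> \<zero> = \<zero>\<^bsub>Q\<^esub>"
    and \<rho>_act: "\<lbrakk>X \<in> g; a \<in> carrier L\<rbrakk> \<Longrightarrow> \<rho> (\<sigma> X \<otimes> a) = act X (\<rho> a)"
begin

definition W :: "'b set" where
  "W = {u \<in> carrier L. (\<forall>k. commutator L (H k) u = \<zero>) \<and>
    (\<forall>i\<in>{1..n}. commutator L (x i) u = \<zero>)}"

text \<open>
  The map \<open>\<rho> a \<mapsto> \<rho> (a w)\<close>; the choice of the preimage \<open>a\<close> does not matter when \<open>w \<in> W\<close>.
\<close>

definition right_mult :: "'b \<Rightarrow> 'v \<Rightarrow> 'v" where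
  "right_mult w = (\<lambda>v \<in> carrier Q. \<rho> (inv_into (carrier L) \<rho> v \<otimes> w))"

lemma W_closed: "w \<in> W \<Longrightarrow> w \<in> carrier L"
  by (simp add: W_def)

lemma W_centralizes: "w \<in> W \<Longrightarrow> w \<in> centralizer_H"
  by (simp add: W_def centralizer_H_def)

lemma W_commutes_x: "\<lbrakk>w \<in> W; i \<in> {1..n}\<rbrakk> \<Longrightarrow> x i \<otimes> w = w \<otimes> x i"
  using commutator_eq_zero_iff[of "x i" w] x_closed by (auto simp: W_def)

text \<open>
  As \<open>w\<close> commutes with \<open>x\<^sub>i\<close>, it can be moved past \<open>x\<^sub>i - 1\<close>.  This makes right multiplication by \<open>w\<close>
  well defined on \<open>L / J\<close>.
\<close>

lemma J_mult_W: "\<lbrakk>u \<in> J; w \<in> W\<rbrakk> \<Longrightarrow> u \<otimes> w \<in> J"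
proof (induction rule: J_induct)
  case zero
  then show ?case using J_zero W_closed by simp
next
  case (gen a i)
  have cl: "a \<in> carrier L" "w \<in> carrier L" "x i \<in> carrier L"
    using gen W_closed x_closed by auto
  have "(a \<otimes> x i \<ominus> a) \<otimes> w = a \<otimes> (x i \<otimes> w) \<ominus> a \<otimes> w"
    using cl by algebra
  also have "\<dots> = (a \<otimes> w) \<otimes> x i \<ominus> a \<otimes> w"
    using cl gen by (simp add: W_commutes_x m_assoc)
  finally show ?case using J_gen[of "a \<otimes> w" i] cl gen by simp
next
  case (add u v)
  then show ?case using J_add J_closed W_closed by (simp add: l_distr)
qed

lemma \<rho>_closed: "a \<in> carrier L \<Longrightarrow> \<rho> a \<in> carrier Q"
  using \<rho>_image by auto

lemma Q_cases:
  assumes "v \<in> carrier Q" obtains a where "a \<in> carrier L" "v = \<rho> a"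
  using assms \<rho>_image by auto

lemma right_mult:
  assumes a: "a \<in> carrier L" and w: "w \<in> W"
  shows "right_mult w (\<rho> a) = \<rho> (a \<otimes> w)"
proof -
  define b where "b = inv_into (carrier L) \<rho> (\<rho> a)"
  have b: "b \<in> carrier L" "\<rho> b = \<rho> a"
    unfolding b_def using a by (auto intro: inv_into_into f_inv_into_f)
  have "(b \<ominus> a) \<otimes> w \<in> J"
    using J_mult_W[OF _ w] \<rho>_eq_iff[OF b(1) a] b by simp
  also have "(b \<ominus> a) \<otimes> w = b \<otimes> w \<ominus> a \<otimes> w"
    using a b W_closed[OF w] by algebra
  finally have "\<rho> (b \<otimes> w) = \<rho> (a \<otimes> w)"
    using \<rho>_eq_iff[of "b \<otimes> w" "a \<otimes> w"] a b W_closed[OF w] by simp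
  then show ?thesis
    using \<rho>_closed[OF a] by (simp add: right_mult_def b_def)
qed

lemma right_mult_ext: "w \<in> W \<Longrightarrow> right_mult w \<in> carrier Q \<rightarrow>\<^sub>E carrier Q"
  using W_closed by (auto simp: right_mult elim!: Q_cases intro!: \<rho>_closed) 
    (simp add: right_mult_def)

lemma ext_eqI:
  assumes "f \<in> carrier Q \<rightarrow>\<^sub>E B" "h \<in> carrier Q \<rightarrow>\<^sub>E C" "\<And>a. a \<in> carrier L \<Longrightarrow> f (\<rho> a) = h (\<rho> a)"
  shows "f = h"
  using assms by (auto simp: PiE_iff intro!: extensionalityI[of f "carrier Q" h] elim!: Q_cases)

abbreviation End where "End \<equiv> endomorphism_algebra g act Q"

lemma right_mult_endomorphism: "w \<in> W \<Longrightarrow> right_mult w \<in> carrier End"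
  using right_mult_ext W_closed \<sigma>_closed
  by (auto simp: endomorphism_algebra_def \<rho>_add[symmetric] \<rho>_smult[symmetric] \<rho>_act[symmetric]
      right_mult l_distr smult_mult_left m_assoc elim!: Q_cases)

lemma representative_unique:
  assumes "u \<in> centralizer_H" "v \<in> centralizer_H" "\<rho> u = \<rho> v" shows "u = v"
proof -
  have cl: "u \<in> carrier L" "v \<in> carrier L" using assms by (auto simp: centralizer_H_def)
  have "u \<ominus> v = u \<oplus> (-1) \<odot> v" using cl by (simp add: minus_one_smult a_minus_def)
  then have "u \<ominus> v \<in> centralizer_H"
    using assms weight_vector_add[OF H_range] weight_vector_smult[OF H_range]
    by (simp add: centralizer_H_iff)
  moreover have "u \<ominus> v \<in> J" using \<rho>_eq_iff[OF cl] assms by simp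
  ultimately have "u \<ominus> v = \<zero>" by (rule centralizer_H_Int_J)
  then show ?thesis using cl by simp
qed

text \<open>
  Take for \<open>w\<close> the representative of weight zero of the image of \<open>\<rho> \<one>\<close>.
\<close>

lemma endomorphism_from_W:
  assumes f: "f \<in> carrier End" shows "\<exists>w\<in>W. f = right_mult w"
proof -
  have f_ext: "f \<in> carrier Q \<rightarrow>\<^sub>E carrier Q"
    and f_add: "\<And>v v'. \<lbrakk>v \<in> carrier Q; v' \<in> carrier Q\<rbrakk> \<Longrightarrow> f (v \<oplus>\<^bsub>Q\<^esub> v') = f v \<oplus>\<^bsub>Q\<^esub> f v'"
    and f_smult: "\<And>c v. v \<in> carrier Q \<Longrightarrow> f (c \<odot>\<^bsub>Q\<^esub> v) = c \<odot>\<^bsub>Q\<^esub> f v"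
    and f_act: "\<And>X v. \<lbrakk>X \<in> g; v \<in> carrier Q\<rbrakk> \<Longrightarrow> f (act X v) = act X (f v)"
    using f by (auto simp: endomorphism_algebra_def)
  have "f (\<rho> \<one>) \<in> carrier Q" using f_ext \<rho>_closed by auto
  then obtain u where u: "u \<in> carrier L" "f (\<rho> \<one>) = \<rho> u" by (rule Q_cases)
  obtain w where w: "w \<in> centralizer_H" "w \<ominus> u \<in> J"
    using representative_exists[OF u(1)] by blast
  have wc: "w \<in> carrier L" using w by (simp add: centralizer_H_def)
  have fw: "f (\<rho> \<one>) = \<rho> w" using \<rho>_eq_iff[OF wc u(1)] u w by simp
  have gens: "\<sigma> ` g \<subseteq> carrier L" using \<sigma>_closed by auto
  have f_gen: "f (\<rho> b) = \<rho> (b \<otimes> w)" if "b \<in> generated_subalgebra L (\<sigma> ` g)" for b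
    using that
  proof induction
    case one
    then show ?case using fw wc by simp
  next
    case (mult s a)
    have a: "a \<in> carrier L" using generated_subalgebra_closed[OF gens mult(2)] .
    obtain X where X: "X \<in> g" "s = \<sigma> X" using mult by auto
    have "f (\<rho> (s \<otimes> a)) = act X (f (\<rho> a))"
      using X a by (simp add: \<rho>_act f_act \<rho>_closed)
    also have "\<dots> = \<rho> (s \<otimes> (a \<otimes> w))"
      using X a wc mult.IH by (simp add: \<rho>_act)
    finally show ?case using X a wc \<sigma>_closed by (simp add: m_assoc)
  next
    case (add a b)
    then show ?case
      using generated_subalgebra_closed[OF gens] wc
      by (simp add: \<rho>_add f_add \<rho>_closed l_distr)
  next
    case (smult a c)
    then show ?case
      using generated_subalgebra_closed[OF gens] wc
      by (simp add: \<rho>_smult f_smult \<rho>_closed smult_mult_left)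
  qed
  \<comment> \<open>The vector \<open>\<rho> \<one>\<close> is fixed by \<open>x i\<close>, hence so is its image \<open>\<rho> w\<close>; comparing representatives
    that centralize the torus turns this into commutation of \<open>w\<close> with \<open>x i\<close>.\<close>
  have comm: "x i \<otimes> w = w \<otimes> x i" if i: "i \<in> {1..n}" for i
  proof -
    have xi: "x i \<in> carrier L" "x i \<in> Units L" "inv (x i) \<in> carrier L"
      using i x_closed x_unit by auto
    have "x i \<in> \<sigma> ` g" using x_in_\<sigma>[OF i] by (metis imageI)
    then have "x i \<otimes> \<one> \<in> generated_subalgebra L (\<sigma> ` g)"
      by (intro generated_subalgebra.intros)
    then have "f (\<rho> (x i)) = \<rho> (x i \<otimes> w)" using f_gen xi by fastforce
    moreover have "\<rho> (x i) = \<rho> \<one>"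
      using J_gen[OF one_closed i] \<rho>_eq_iff[of "x i" \<one>] xi by simp
    ultimately have 1: "\<rho> (x i \<otimes> w) = \<rho> w" using fw by simp
    define w' where "w' = x i \<otimes> w \<otimes> inv (x i)"
    have w'c: "w' \<in> carrier L" unfolding w'_def using xi wc by simp
    have w'x: "w' \<otimes> x i = x i \<otimes> w" unfolding w'_def using xi wc by (simp add: m_assoc)
    have "\<rho> (x i \<otimes> w) = \<rho> w'"
      using J_gen[OF w'c i] \<rho>_eq_iff[of "x i \<otimes> w" w'] xi wc w'c w'x by simp
    then have "\<rho> w' = \<rho> w" using 1 by simp
    moreover have "w' \<in> centralizer_H"
    proof -
      let ?e = "\<lambda>k. if k = i then 1 else 0 :: int"
      have "weight (\<lambda>k. (?e k + 0) + - ?e k) w'"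
        unfolding w'_def using w i xi
        by (intro weight_vector_mult[OF H_range] weight_vector_inv[OF H_range] x_weight_vector)
          (auto simp: centralizer_H_iff)
      then show ?thesis by (simp add: centralizer_H_iff)
    qed
    ultimately have "w' = w" using representative_unique w by blast
    then show ?thesis using w'x by simp
  qed
  have wW: "w \<in> W"
    using w comm commutator_eq_zero_iff[OF x_closed wc] by (auto simp: W_def centralizer_H_def)
  have "f = right_mult w"
  proof (rule ext_eqI[OF f_ext right_mult_ext[OF wW]])
    fix a assume a: "a \<in> carrier L"
    obtain b where b: "b \<in> generated_subalgebra L (\<sigma> ` g)" "a \<ominus> b \<in> J"
      using generated_mod_J[OF a] by blast
    have bc: "b \<in> carrier L" using generated_subalgebra_closed[OF gens b(1)] .
    have "\<rho> a = \<rho> b" using \<rho>_eq_iff[OF a bc] b by simp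
    then show "f (\<rho> a) = right_mult w (\<rho> a)"
      using f_gen[OF b(1)] right_mult[OF bc wW] by simp
  qed
  then show ?thesis using wW by blast
qed

lemma right_mult_bij: "bij_betw right_mult W (carrier End)"
proof (rule bij_betw_imageI)
  show "inj_on right_mult W"
  proof (rule inj_onI)
    fix w w' assume w: "w \<in> W" "w' \<in> W" "right_mult w = right_mult w'"
    then have "\<rho> w = \<rho> w'" using right_mult[of \<one>] W_closed by (metis l_one one_closed)
    then show "w = w'" using representative_unique W_centralizes w by blast
  qed
  show "right_mult ` W = carrier End"
    using right_mult_endomorphism endomorphism_from_W by blast
qed

lemma W_one: "\<one> \<in> W"
  using H_closed x_closed by (auto simp: W_def commutator_def)

lemma W_mult: "\<lbrakk>u \<in> W; v \<in> W\<rbrakk> \<Longrightarrow> u \<otimes> v \<in> W"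
  by (auto simp: W_def H_closed x_closed commutator_mult_right)

lemma W_add: "\<lbrakk>u \<in> W; v \<in> W\<rbrakk> \<Longrightarrow> u \<oplus> v \<in> W"
  by (auto simp: W_def H_closed x_closed commutator_add_right)

lemma W_smult: "u \<in> W \<Longrightarrow> c \<odot> u \<in> W"
  by (auto simp: W_def H_closed x_closed commutator_smult_right)

lemma W_zero: "\<zero> \<in> W"
  using W_smult[OF W_one, of 0] by simp

lemma right_mult_eqI:
  assumes "w \<in> W" "h \<in> extensional (carrier Q)" "\<And>a. a \<in> carrier L \<Longrightarrow> \<rho> (a \<otimes> w) = h (\<rho> a)"
  shows "right_mult w = h"
proof (rule extensionalityI)
  show "right_mult w \<in> extensional (carrier Q)"
    by (simp add: right_mult_def)
  fix v assume "v \<in> carrier Q"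
  then show "right_mult w v = h v"
    using assms by (auto simp: right_mult elim!: Q_cases)
qed fact

theorem W_isomorphic_endomorphisms:
  "algebra_isomorphic (L\<lparr>carrier := W\<rparr>) (opposite_algebra End)"
proof (rule complex_algebra_transport[of _ right_mult])
  show "complex_algebra (L\<lparr>carrier := W\<rparr>)"
    by (rule complex_algebra_subalgebra[OF complex_algebra_axioms])
      (auto simp: W_closed W_one W_mult W_add W_smult)
  show "bij_betw right_mult (carrier (L\<lparr>carrier := W\<rparr>)) (carrier (opposite_algebra End))"
    using right_mult_bij by (simp add: opposite_algebra_def)
  show "right_mult \<one>\<^bsub>L\<lparr>carrier := W\<rparr>\<^esub> = \<one>\<^bsub>opposite_algebra End\<^esub>"
    by (simp, rule right_mult_eqI)
      (auto simp: W_one opposite_algebra_def endomorphism_algebra_def \<rho>_closed)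
  show "right_mult \<zero>\<^bsub>L\<lparr>carrier := W\<rparr>\<^esub> = \<zero>\<^bsub>opposite_algebra End\<^esub>"
    by (simp, rule right_mult_eqI)
      (auto simp: W_zero opposite_algebra_def endomorphism_algebra_def \<rho>_closed \<rho>_zero)
  fix u v c
  assume u: "u \<in> carrier (L\<lparr>carrier := W\<rparr>)"
  show "right_mult (c \<odot>\<^bsub>L\<lparr>carrier := W\<rparr>\<^esub> u) = c \<odot>\<^bsub>opposite_algebra End\<^esub> right_mult u"
    by (simp, rule right_mult_eqI) (use u in \<open>auto simp: W_smult opposite_algebra_def
        endomorphism_algebra_def \<rho>_closed right_mult \<rho>_smult[symmetric] smult_mult_right W_closed\<close>)
  assume v: "v \<in> carrier (L\<lparr>carrier := W\<rparr>)"
  show "right_mult (u \<oplus>\<^bsub>L\<lparr>carrier := W\<rparr>\<^esub> v) = right_mult u \<oplus>\<^bsub>opposite_algebra End\<^esub> right_mult v"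
    by (simp, rule right_mult_eqI) (use u v in \<open>auto simp: W_add opposite_algebra_def
        endomorphism_algebra_def \<rho>_closed right_mult \<rho>_add[symmetric] r_distr W_closed\<close>)
  \<comment> \<open>Right multiplications compose in reverse order, whence the opposite algebra.\<close>
  show "right_mult (u \<otimes>\<^bsub>L\<lparr>carrier := W\<rparr>\<^esub> v) = right_mult u \<otimes>\<^bsub>opposite_algebra End\<^esub> right_mult v"
    by (simp, rule right_mult_eqI) (use u v in \<open>auto simp: W_mult opposite_algebra_def
        endomorphism_algebra_def \<rho>_closed right_mult m_assoc W_closed compose_eq\<close>)
qed

end

section \<open>Quotient spaces and free spaces\<close>

locale complex_subspace = Module.module complex_alg V for V :: "(complex, 'v) module" (structure) +
  fixes K :: "'v set"
  assumes submodule: "submodule K complex_alg V"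
begin

lemma abelian_subgroup: "abelian_subgroup K V"
  using submodule.axioms(1)[OF submodule] M.abelian_group_axioms
  by (intro abelian_subgroupI3 additive_subgroup.intro)

sublocale K: abelian_subgroup K V
  by (rule abelian_subgroup)

lemma smult_in: "a \<in> K \<Longrightarrow> c \<odot> a \<in> K"
  using submodule.smult_closed[OF submodule, of c a] by simp

lemma coset_eq_iff:
  assumes "a \<in> carrier V" "b \<in> carrier V"
  shows "K +> a = K +> b \<longleftrightarrow> a \<ominus> b \<in> K"
  using assms K.a_repr_independence'[of a b] K.a_repr_independenceD[of a b] K.a_rcos_module[of b a]
  by (auto simp: a_minus_def)

lemma quotient_carrier: "carrier (quotient_module V K) = (\<lambda>a. K +> a) ` carrier V"
  by (auto simp: quotient_module_def ring.defs module.defs FactRing_def A_RCOSETS_def' image_iff)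

lemma quotient_zero: "\<zero>\<^bsub>quotient_module V K\<^esub> = K"
  by (simp add: quotient_module_def ring.defs module.defs FactRing_def)

lemma quotient_add:
  "\<lbrakk>a \<in> carrier V; b \<in> carrier V\<rbrakk> \<Longrightarrow>
    (K +> a) \<oplus>\<^bsub>quotient_module V K\<^esub> (K +> b) = K +> (a \<oplus> b)"
  by (simp add: quotient_module_def ring.defs module.defs FactRing_def K.a_rcos_sum)

text \<open>
  Scalar multiplication on quotients and the maps induced on tensor products are both defined by
  such a union.
\<close>

lemma coset_map:
  assumes a: "a \<in> carrier V"
    and closed: "\<And>v. v \<in> carrier V \<Longrightarrow> f v \<in> carrier V"
    and add: "\<And>u v. \<lbrakk>u \<in> carrier V; v \<in> carrier V\<rbrakk> \<Longrightarrow> f (u \<oplus> v) = f u \<oplus> f v"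
    and K: "\<And>v. v \<in> K \<Longrightarrow> f v \<in> K"
  shows "(\<Union>p\<in>K +> a. K +> f p) = K +> f a"
proof -
  have "K +> f p = K +> f a" if "p \<in> K +> a" for p
  proof -
    obtain k where k: "k \<in> K" "p = k \<oplus> a" using \<open>p \<in> K +> a\<close> by (auto simp: a_r_coset_def')
    have "k \<in> carrier V" using k by auto
    then have "f p \<ominus> f a = f k"
      using a k closed by (simp add: add a_minus_def M.a_assoc M.r_neg)
    then show ?thesis
      using coset_eq_iff[of "f p" "f a"] closed a k K \<open>k \<in> carrier V\<close> by simp
  qed
  moreover have "a \<in> K +> a" using K.a_rcos_self a by blast
  ultimately show ?thesis by blast
qed

lemma quotient_smult:
  "a \<in> carrier V \<Longrightarrow> c \<odot>\<^bsub>quotient_module V K\<^esub> (K +> a) = K +> (c \<odot> a)"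
  using coset_map[of a "\<lambda>v. c \<odot> v"] smult_in[of _ c] smult_closed[of c] smult_r_distr[of c]
  by (simp add: quotient_module_def ring.defs module.defs)

end

lemma quotient_algebra:
  fixes A :: "(complex, 'a) module"
  assumes A: "complex_algebra A" and I: "ideal I A"
  shows "complex_algebra (quotient_module A I)"
    and "(+>\<^bsub>A\<^esub>) I \<in> algebra_hom A (quotient_module A I)"
    and "(\<lambda>a. I +>\<^bsub>A\<^esub> a) ` carrier A = carrier (quotient_module A I)"
    and "\<And>a b. \<lbrakk>a \<in> carrier A; b \<in> carrier A\<rbrakk> \<Longrightarrow> I +>\<^bsub>A\<^esub> a = I +>\<^bsub>A\<^esub> b \<longleftrightarrow> a \<ominus>\<^bsub>A\<^esub> b \<in> I"
proof -
  interpret A: assoc_algebra A by (rule assoc_algebra.intro) fact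
  interpret I: ideal I A by fact
  have smult: "c \<odot>\<^bsub>A\<^esub> a \<in> I" if "a \<in> I" for c a
    using I.I_l_closed[OF that, of "c \<odot>\<^bsub>A\<^esub> \<one>\<^bsub>A\<^esub>"] A.smult_as_mult[OF I.Icarr[OF that], of c] by simp
  interpret S: complex_subspace A I
    by (intro complex_subspace.intro complex_subspace_axioms.intro submodule.intro
        submodule_axioms.intro A.module_axioms I.a_subgroup smult)
  let ?B = "quotient_module A I"
  have mult: "(I +>\<^bsub>A\<^esub> a) \<otimes>\<^bsub>?B\<^esub> (I +>\<^bsub>A\<^esub> b) = I +>\<^bsub>A\<^esub> (a \<otimes>\<^bsub>A\<^esub> b)"
    if "a \<in> carrier A" "b \<in> carrier A" for a b
    using I.rcoset_mult_add[OF that] by (simp add: quotient_module_def ring.defs module.defs FactRing_def)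
  interpret Q: ring "A Quot I" by (rule I.quotient_is_ring)
  have ops: "carrier ?B = carrier (A Quot I)" "mult ?B = mult (A Quot I)" "add ?B = add (A Quot I)"
      "\<one>\<^bsub>?B\<^esub> = \<one>\<^bsub>A Quot I\<^esub>" "\<zero>\<^bsub>?B\<^esub> = \<zero>\<^bsub>A Quot I\<^esub>"
    by (simp_all add: quotient_module_def ring.defs module.defs)
  have "ring ?B"
  proof (intro ringI abelian_groupI monoidI, unfold ops)
    fix P assume "P \<in> carrier (A Quot I)"
    then show "\<exists>R\<in>carrier (A Quot I). R \<oplus>\<^bsub>A Quot I\<^esub> P = \<zero>\<^bsub>A Quot I\<^esub>"
      using Q.l_neg Q.a_inv_closed by blast
  qed (simp_all add: Q.m_assoc Q.l_distr Q.r_distr Q.a_ac)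
  then show "complex_algebra ?B"
    by (rule complex_algebraI)
      (auto simp: S.quotient_carrier S.quotient_add S.quotient_smult mult A.smult_add_left
        A.smult_add_right A.smult_smult A.smult_mult_left A.smult_mult_right)
  have "\<one>\<^bsub>?B\<^esub> = I +>\<^bsub>A\<^esub> \<one>\<^bsub>A\<^esub>"
    by (simp add: quotient_module_def ring.defs module.defs FactRing_def)
  then show "(+>\<^bsub>A\<^esub>) I \<in> algebra_hom A ?B"
    by (auto simp: algebra_hom_def ring_hom_def S.quotient_carrier S.quotient_add S.quotient_smult mult)
  show "(\<lambda>a. I +>\<^bsub>A\<^esub> a) ` carrier A = carrier ?B"
    by (simp add: S.quotient_carrier)
  show "\<And>a b. \<lbrakk>a \<in> carrier A; b \<in> carrier A\<rbrakk> \<Longrightarrow> I +>\<^bsub>A\<^esub> a = I +>\<^bsub>A\<^esub> b \<longleftrightarrow> a \<ominus>\<^bsub>A\<^esub> b \<in> I"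
    by (rule S.coset_eq_iff)
qed

lemma lookup_scale [simp]:
  "Poly_Mapping.lookup (Poly_Mapping.map ((*) (c::complex)) p) x = c * Poly_Mapping.lookup p x"
  by (simp add: Poly_Mapping.map.rep_eq when_def)

lemma free_space_simps [simp]:
  "carrier (free_space X) = {p. Poly_Mapping.keys p \<subseteq> X}"
  "add (free_space X) = (+)" "\<zero>\<^bsub>free_space X\<^esub> = 0"
  "module.smult (free_space X) = (\<lambda>c. Poly_Mapping.map ((*) c))"
  by (simp_all add: free_space_def)

lemma keys_scale: "Poly_Mapping.keys (Poly_Mapping.map ((*) (c::complex)) p) \<subseteq> Poly_Mapping.keys p"
  by (auto simp: in_keys_iff)

lemma keys_add_subset:
  "Poly_Mapping.keys p \<subseteq> X \<Longrightarrow> Poly_Mapping.keys q \<subseteq> X \<Longrightarrow> Poly_Mapping.keys (p + q) \<subseteq> X"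
  using keys_add[of p q] by blast

lemma keys_diff_subset:
  "Poly_Mapping.keys (p :: _ \<Rightarrow>\<^sub>0 complex) \<subseteq> X \<Longrightarrow> Poly_Mapping.keys q \<subseteq> X \<Longrightarrow>
    Poly_Mapping.keys (p - q) \<subseteq> X"
  using keys_diff[of p q] by blast

lemma keys_uminus: "Poly_Mapping.keys (- p :: _ \<Rightarrow>\<^sub>0 complex) = Poly_Mapping.keys p"
  by (auto simp: in_keys_iff)

lemma keys_scale_subset:
  "Poly_Mapping.keys p \<subseteq> X \<Longrightarrow> Poly_Mapping.keys (Poly_Mapping.map ((*) (c::complex)) p) \<subseteq> X"
  using keys_scale[of c p] by blast

lemma keys_single_subset: "x \<in> X \<Longrightarrow> Poly_Mapping.keys (Poly_Mapping.single x (c::complex)) \<subseteq> X"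
  by simp

lemmas keys_subset_intros =
  keys_add_subset keys_diff_subset keys_scale_subset keys_single_subset

lemma scale_add_right:
  "Poly_Mapping.map ((*) (c::complex)) (p + q) = Poly_Mapping.map ((*) c) p + Poly_Mapping.map ((*) c) q"
  by (rule poly_mapping_eqI) (simp add: lookup_add algebra_simps)

lemma scale_add_left:
  "Poly_Mapping.map ((*) (c + d::complex)) p = Poly_Mapping.map ((*) c) p + Poly_Mapping.map ((*) d) p"
  by (rule poly_mapping_eqI) (simp add: lookup_add algebra_simps)

lemma scale_scale:
  "Poly_Mapping.map ((*) (c::complex)) (Poly_Mapping.map ((*) d) p) = Poly_Mapping.map ((*) (c * d)) p"
  by (rule poly_mapping_eqI) (simp add: mult.assoc)

lemma scale_one: "Poly_Mapping.map ((*) (1::complex)) p = p"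
  by (rule poly_mapping_eqI) simp

lemma scale_zero: "Poly_Mapping.map ((*) (0::complex)) p = 0"
  by (rule poly_mapping_eqI) simp

lemma scale_zero_right: "Poly_Mapping.map ((*) (c::complex)) 0 = 0"
  by (rule poly_mapping_eqI) simp

lemma scale_diff:
  "Poly_Mapping.map ((*) (c::complex)) (p - q) = Poly_Mapping.map ((*) c) p - Poly_Mapping.map ((*) c) q"
  by (rule poly_mapping_eqI) (simp add: lookup_minus algebra_simps)

lemma abelian_group_free_space: "abelian_group (free_space X)"
proof (rule abelian_groupI)
  fix p assume "p \<in> carrier (free_space X)"
  then show "\<exists>q\<in>carrier (free_space X). q \<oplus>\<^bsub>free_space X\<^esub> p = \<zero>\<^bsub>free_space X\<^esub>"
    by (intro bexI[of _ "- p"]) (auto simp: keys_uminus)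
qed (auto simp: add.assoc add.commute dest: subsetD[OF keys_add])

lemma module_free_space: "Module.module complex_alg (free_space X)"
  by (rule moduleI[OF cring_complex_alg abelian_group_free_space])
    (auto simp: scale_add_left scale_add_right scale_scale scale_one intro!: keys_scale_subset
      dest: subsetD[OF keys_scale])

lemma minus_free_space:
  assumes "p \<in> carrier (free_space X)" "q \<in> carrier (free_space X)"
  shows "p \<ominus>\<^bsub>free_space X\<^esub> q = p - q"
proof -
  interpret abelian_group "free_space X" by (rule abelian_group_free_space)
  have "\<ominus>\<^bsub>free_space X\<^esub> q = - q"
    by (rule minus_equality) (use assms in \<open>auto simp: keys_uminus\<close>)
  then show ?thesis by (simp add: a_minus_def)
qed

lemma poly_mapping_keys_induct [consumes 1, case_names zero single_add]:
  assumes "Poly_Mapping.keys p \<subseteq> X" "P 0"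
    and "\<And>x c q. \<lbrakk>x \<in> X; Poly_Mapping.keys q \<subseteq> X; P q\<rbrakk> \<Longrightarrow> P (Poly_Mapping.single x c + q)"
  shows "P (p :: 'x \<Rightarrow>\<^sub>0 complex)"
proof -
  have "finite (Poly_Mapping.keys p)" by simp
  then show ?thesis
    using assms(1)
  proof (induction "Poly_Mapping.keys p" arbitrary: p rule: finite_psubset_induct)
    case (psubset p)
    show ?case
    proof (cases "p = 0")
      case True
      then show ?thesis using assms(2) by simp
    next
      case False
      then obtain x where x: "x \<in> Poly_Mapping.keys p"
        using keys_eq_empty by (metis ex_in_conv poly_mapping_eqI in_keys_iff lookup_zero)
      define q where "q = p - Poly_Mapping.single x (Poly_Mapping.lookup p x)"
      have q: "Poly_Mapping.keys q = Poly_Mapping.keys p - {x}"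
        by (auto simp: q_def in_keys_iff lookup_minus lookup_single when_def split: if_splits)
      have "P q" using psubset q x by (intro psubset.hyps) auto
      then have "P (Poly_Mapping.single x (Poly_Mapping.lookup p x) + q)"
        using assms(3) x psubset.prems q by blast
      then show ?thesis by (simp add: q_def)
    qed
  qed
qed

definition linear_extension ::
    "(complex, 'a) module \<Rightarrow> ('x \<Rightarrow> 'a) \<Rightarrow> ('x \<Rightarrow>\<^sub>0 complex) \<Rightarrow> 'a" where
  "linear_extension A f p =
    (\<Oplus>\<^bsub>A\<^esub> x \<in> Poly_Mapping.keys p. Poly_Mapping.lookup p x \<odot>\<^bsub>A\<^esub> f x)"

context assoc_algebra
begin

lemma linear_extension_superset:
  assumes "finite S" "Poly_Mapping.keys p \<subseteq> S" "f ` S \<subseteq> carrier A"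
  shows "linear_extension A f p = (\<Oplus>x\<in>S. Poly_Mapping.lookup p x \<odot> f x)"
  unfolding linear_extension_def
  by (rule add.finprod_mono_neutral_cong_left) (use assms in \<open>auto simp: image_subset_iff in_keys_iff\<close>)

lemma linear_extension_closed:
  "\<lbrakk>f ` X \<subseteq> carrier A; Poly_Mapping.keys p \<subseteq> X\<rbrakk> \<Longrightarrow> linear_extension A f p \<in> carrier A"
  unfolding linear_extension_def by (rule finsum_closed) auto

lemma linear_extension_zero: "linear_extension A f 0 = \<zero>"
  by (simp add: linear_extension_def)

lemma linear_extension_single: "f x \<in> carrier A \<Longrightarrow> linear_extension A f (Poly_Mapping.single x c) = c \<odot> f x"
  by (subst linear_extension_superset[of "{x}"]) auto

lemma linear_extension_add:
  assumes f: "f ` X \<subseteq> carrier A" and p: "Poly_Mapping.keys p \<subseteq> X" and q: "Poly_Mapping.keys q \<subseteq> X"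
  shows "linear_extension A f (p + q) = linear_extension A f p \<oplus> linear_extension A f q"
proof -
  let ?S = "Poly_Mapping.keys p \<union> Poly_Mapping.keys q"
  have S: "finite ?S" "f ` ?S \<subseteq> carrier A" using assms by auto
  have c: "\<And>x. x \<in> ?S \<Longrightarrow> f x \<in> carrier A" using S by auto
  have "linear_extension A f (p + q) = (\<Oplus>x\<in>?S. Poly_Mapping.lookup (p + q) x \<odot> f x)"
    by (rule linear_extension_superset[OF S(1) keys_add S(2)])
  also have "\<dots> = (\<Oplus>x\<in>?S. Poly_Mapping.lookup p x \<odot> f x \<oplus> Poly_Mapping.lookup q x \<odot> f x)"
    using c by (intro finsum_cong') (auto simp: lookup_add smult_add_left)
  also have "\<dots> = (\<Oplus>x\<in>?S. Poly_Mapping.lookup p x \<odot> f x) \<oplus> (\<Oplus>x\<in>?S. Poly_Mapping.lookup q x \<odot> f x)"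
    using c by (intro finsum_addf) auto
  also have "\<dots> = linear_extension A f p \<oplus> linear_extension A f q"
    using linear_extension_superset[OF S(1) _ S(2)] by simp
  finally show ?thesis .
qed

lemma linear_extension_scale:
  assumes f: "f ` X \<subseteq> carrier A" and p: "Poly_Mapping.keys p \<subseteq> X"
  shows "linear_extension A f (Poly_Mapping.map ((*) c) p) = c \<odot> linear_extension A f p"
  using p
proof (induction rule: poly_mapping_keys_induct)
  case zero
  then show ?case by (simp add: linear_extension_zero scale_zero_right)
next
  case (single_add x d q)
  have x: "f x \<in> carrier A" using f single_add by auto
  have "linear_extension A f (Poly_Mapping.map ((*) c) (Poly_Mapping.single x d + q))
    = linear_extension A f (Poly_Mapping.single x (c * d)) \<oplus> linear_extension A f (Poly_Mapping.map ((*) c) q)"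
    unfolding scale_add_right Poly_Mapping.map_single[of _ "(*) c", OF mult_zero_right]
    by (rule linear_extension_add[OF f]) (use single_add in \<open>auto intro!: keys_subset_intros dest: subsetD[OF keys_scale]\<close>)
  also have "\<dots> = c \<odot> (linear_extension A f (Poly_Mapping.single x d) \<oplus> linear_extension A f q)"
    using x single_add linear_extension_closed[OF f]
    by (simp add: linear_extension_single smult_smult smult_add_right)
  also have "\<dots> = c \<odot> linear_extension A f (Poly_Mapping.single x d + q)"
    using linear_extension_add[OF f, of "Poly_Mapping.single x d" q] single_add by simp
  finally show ?case .
qed

lemma linear_extension_diff:
  assumes f: "f ` X \<subseteq> carrier A" and p: "Poly_Mapping.keys p \<subseteq> X" and q: "Poly_Mapping.keys q \<subseteq> X"
  shows "linear_extension A f (p - q) = linear_extension A f p \<ominus> linear_extension A f q"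
proof -
  have eq: "p - q = p + Poly_Mapping.map ((*) (-1)) q"
    by (rule poly_mapping_eqI) (simp add: lookup_add lookup_minus)
  show ?thesis
    unfolding eq using linear_extension_add[OF f p keys_scale_subset[OF q, of "-1"]] linear_extension_scale[OF f q, of "-1"]
      linear_extension_closed[OF f q]
    by (simp add: minus_one_smult a_minus_def)
qed

end

section \<open>Free algebras and enveloping algebras\<close>

abbreviation words :: "'x set \<Rightarrow> 'x free_word set" where
  "words X \<equiv> {w. set (letters w) \<subseteq> X}"

lemma free_algebra_simps [simp]:
  "carrier (free_algebra X) = {p. Poly_Mapping.keys p \<subseteq> words X}"
  "add (free_algebra X) = (+)" "\<zero>\<^bsub>free_algebra X\<^esub> = 0"
  "module.smult (free_algebra X) = (\<lambda>c. Poly_Mapping.map ((*) c))"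
  "mult (free_algebra X) = (*)" "\<one>\<^bsub>free_algebra X\<^esub> = 1"
  by (simp_all add: free_algebra_def)

lemma letters_simps [simp]: "letters 0 = []" "letters (v + w) = letters v @ letters w"
  by (simp_all add: zero_free_word_def plus_free_word_def)

lemma one_poly_mapping: "(1 :: 'x free_word \<Rightarrow>\<^sub>0 complex) = Poly_Mapping.single 0 1"
  by simp

lemma keys_mult_words:
  assumes "Poly_Mapping.keys p \<subseteq> words X" "Poly_Mapping.keys (q :: _ \<Rightarrow>\<^sub>0 complex) \<subseteq> words X"
  shows "Poly_Mapping.keys (p * q) \<subseteq> words X"
proof
  fix w assume "w \<in> Poly_Mapping.keys (p * q)"
  then obtain u v where "w = u + v" "u \<in> Poly_Mapping.keys p" "v \<in> Poly_Mapping.keys q"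
    using keys_mult[of p q] by blast
  then show "w \<in> words X" using assms by auto
qed

lemma scale_mult_left:
  "Poly_Mapping.map ((*) (c::complex)) p * q = Poly_Mapping.map ((*) c) (p * (q :: 'x free_word \<Rightarrow>\<^sub>0 complex))"
  by (simp add: Poly_Mapping.mult_map_scale_conv_mult mult.assoc)

lemma single_zero_commute:
  "Poly_Mapping.single 0 (c::complex) * p = p * Poly_Mapping.single (0 :: 'x free_word) c"
proof -
  have "Poly_Mapping.keys p \<subseteq> UNIV" by simp
  then show ?thesis
    by (induction rule: poly_mapping_keys_induct)
      (simp_all add: distrib_left distrib_right mult_single mult.commute)
qed

lemma scale_mult_right:
  "(p :: 'x free_word \<Rightarrow>\<^sub>0 complex) * Poly_Mapping.map ((*) c) q = Poly_Mapping.map ((*) c) (p * q)"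
proof -
  have "p * Poly_Mapping.map ((*) c) q = (p * Poly_Mapping.single 0 c) * q"
    by (simp add: Poly_Mapping.mult_map_scale_conv_mult mult.assoc)
  also have "\<dots> = Poly_Mapping.single 0 c * p * q"
    by (simp add: single_zero_commute)
  finally show ?thesis by (simp add: Poly_Mapping.mult_map_scale_conv_mult mult.assoc)
qed

lemma free_algebra_algebra: "complex_algebra (free_algebra X)"
proof (rule complex_algebraI)
  have "abelian_group (free_algebra X)"
    using abelian_group_free_space[of "words X"]
    by (simp add: free_algebra_def abelian_group_def abelian_monoid_def abelian_group_axioms_def)
  then show "ring (free_algebra X)"
    by (rule ringI)
      (simp_all add: Group.monoid_def keys_mult_words mult.assoc distrib_left distrib_right)
qed (auto simp: scale_add_left scale_add_right scale_scale scale_one scale_mult_left scale_mult_right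
    dest!: subsetD[OF keys_scale])

lemma generator_in_free_algebra: "x \<in> X \<Longrightarrow> generator x \<in> carrier (free_algebra X)"
  by (simp add: generator_def)

lemma free_algebra_minus:
  assumes "p \<in> carrier (free_algebra X)" "q \<in> carrier (free_algebra X)"
  shows "p \<ominus>\<^bsub>free_algebra X\<^esub> q = p - q"
  using minus_free_space[of p "words X" q] assms
  by (simp add: free_algebra_def a_minus_def a_inv_def m_inv_def)

text \<open>
  A word is a product of generators, and every element is a combination of words.
\<close>

lemma free_algebra_generated:
  assumes "p \<in> carrier (free_algebra X)"
  shows "p \<in> generated_subalgebra (free_algebra X) (generator ` X)"
proof -
  have word: "Poly_Mapping.single (Free_Word xs) 1 \<in> generated_subalgebra (free_algebra X) (generator ` X)"
    if "set xs \<subseteq> X" for xs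
    using that
  proof (induction xs)
    case Nil
    then show ?case
      using generated_subalgebra.one[of "free_algebra X" "generator ` X"]
      by (simp add: one_poly_mapping zero_free_word_def del: single_one)
  next
    case (Cons x xs)
    have "generator x \<otimes>\<^bsub>free_algebra X\<^esub> Poly_Mapping.single (Free_Word xs) 1
        \<in> generated_subalgebra (free_algebra X) (generator ` X)"
      using Cons by (intro generated_subalgebra.mult) auto
    then show ?case by (simp add: generator_def mult_single plus_free_word_def)
  qed
  have "Poly_Mapping.keys p \<subseteq> words X" using assms by simp
  then show ?thesis
  proof (induction rule: poly_mapping_keys_induct)
    case zero
    show ?case
      using generated_subalgebra.smult[OF generated_subalgebra.one[of "free_algebra X" "generator ` X"],
          where c = 0]
      by (simp add: scale_zero)
  next
    case (single_add w c q)
    have "c \<odot>\<^bsub>free_algebra X\<^esub> Poly_Mapping.single w 1 = Poly_Mapping.single w c"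
      by simp
    then have "Poly_Mapping.single w c \<in> generated_subalgebra (free_algebra X) (generator ` X)"
      using generated_subalgebra.smult[OF word[of "letters w"], where c = c] single_add by simp
    from generated_subalgebra.add[OF this single_add.IH] show ?case by simp
  qed
qed

context assoc_algebra
begin

lemma ordered_product_append:
  "f ` (set xs \<union> set ys) \<subseteq> carrier A \<Longrightarrow>
    ordered_product A f (xs @ ys) = ordered_product A f xs \<otimes> ordered_product A f ys"
  using ordered_product_closed[of f]
  by (induction xs) (auto simp: m_assoc image_Un)

lemma free_algebra_lift_eq:
  "free_algebra_lift A f = linear_extension A (\<lambda>w. ordered_product A f (letters w))"
  by (simp add: free_algebra_lift_def linear_extension_def ordered_product_def fun_eq_iff)

text \<open>
  On words the lift is the product of the values of the letters, which is multiplicative because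
  words are concatenated; the rest follows by bilinearity.
\<close>

lemma free_algebra_lift_hom:
  assumes f: "f ` X \<subseteq> carrier A"
  shows "free_algebra_lift A f \<in> algebra_hom (free_algebra X) A"
proof -
  let ?v = "\<lambda>w. ordered_product A f (letters w)"
  have v: "?v ` words X \<subseteq> carrier A"
    using f by (auto intro!: ordered_product_closed)
  note add = linear_extension_add[OF v] and closed = linear_extension_closed[OF v]
    and scale = linear_extension_scale[OF v]
  have single: "linear_extension A ?v (Poly_Mapping.single w c * q)
      = (c \<odot> ?v w) \<otimes> linear_extension A ?v q"
    if w: "w \<in> words X" and q: "Poly_Mapping.keys q \<subseteq> words X" for w c q
    using q
  proof (induction rule: poly_mapping_keys_induct)
    case zero
    then show ?case using w v by (auto simp: linear_extension_zero image_subset_iff)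
  next
    case (single_add u d q)
    have vc: "?v w \<in> carrier A" "?v u \<in> carrier A" using v w single_add by auto
    have vwu: "?v (w + u) = ?v w \<otimes> ?v u"
      using ordered_product_append[of f "letters w" "letters u"] w single_add f by fastforce
    have eq: "Poly_Mapping.single w c * (Poly_Mapping.single u d + q)
        = Poly_Mapping.single (w + u) (c * d) + Poly_Mapping.single w c * q"
      by (simp add: distrib_left mult_single)
    have "linear_extension A ?v (Poly_Mapping.single w c * (Poly_Mapping.single u d + q))
      = linear_extension A ?v (Poly_Mapping.single (w + u) (c * d))
        \<oplus> linear_extension A ?v (Poly_Mapping.single w c * q)"
      unfolding eq by (intro add keys_mult_words) (use w single_add in auto)
    also have "\<dots> = (c * d) \<odot> (?v w \<otimes> ?v u) \<oplus> (c \<odot> ?v w) \<otimes> linear_extension A ?v q"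
      using vc vwu single_add.IH by (simp add: linear_extension_single)
    also have "\<dots> = (c \<odot> ?v w) \<otimes> (d \<odot> ?v u \<oplus> linear_extension A ?v q)"
      using vc closed[OF single_add.hyps(2)]
      by (simp add: r_distr smult_mult_left smult_mult_right smult_smult mult.commute)
    also have "d \<odot> ?v u \<oplus> linear_extension A ?v q
        = linear_extension A ?v (Poly_Mapping.single u d + q)"
      using add[of "Poly_Mapping.single u d" q] single_add vc by (simp add: linear_extension_single)
    finally show ?case .
  qed
  have mult: "linear_extension A ?v (p * q) = linear_extension A ?v p \<otimes> linear_extension A ?v q"
    if p: "Poly_Mapping.keys p \<subseteq> words X" and q: "Poly_Mapping.keys q \<subseteq> words X" for p q
    using p
  proof (induction rule: poly_mapping_keys_induct)
    case zero
    then show ?case using closed[OF q] by (simp add: linear_extension_zero)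
  next
    case (single_add w c p)
    have vc: "?v w \<in> carrier A" using v single_add by auto
    have "linear_extension A ?v ((Poly_Mapping.single w c + p) * q)
      = linear_extension A ?v (Poly_Mapping.single w c * q) \<oplus> linear_extension A ?v (p * q)"
      unfolding distrib_right using single_add q by (intro add keys_mult_words) auto
    also have "\<dots> = (c \<odot> ?v w \<oplus> linear_extension A ?v p) \<otimes> linear_extension A ?v q"
      using single single_add q vc closed by (simp add: l_distr)
    also have "c \<odot> ?v w \<oplus> linear_extension A ?v p = linear_extension A ?v (Poly_Mapping.single w c + p)"
      using add[of "Poly_Mapping.single w c" p] single_add vc by (simp add: linear_extension_single)
    finally show ?case .
  qed
  have "linear_extension A ?v 1 = \<one>"
    by (simp add: one_poly_mapping linear_extension_single del: single_one)
  then show ?thesis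
    using add closed scale mult by (auto simp: free_algebra_lift_eq algebra_hom_def ring_hom_def)
qed

lemma free_algebra_lift_generator:
  "f x \<in> carrier A \<Longrightarrow> free_algebra_lift A f (generator x) = f x"
  by (simp add: free_algebra_lift_eq generator_def linear_extension_single)

end

lemma algebra_homD:
  assumes "h \<in> algebra_hom A B"
  shows "\<And>x. x \<in> carrier A \<Longrightarrow> h x \<in> carrier B"
    "\<And>x y. \<lbrakk>x \<in> carrier A; y \<in> carrier A\<rbrakk> \<Longrightarrow> h (x \<otimes>\<^bsub>A\<^esub> y) = h x \<otimes>\<^bsub>B\<^esub> h y"
    "\<And>x y. \<lbrakk>x \<in> carrier A; y \<in> carrier A\<rbrakk> \<Longrightarrow> h (x \<oplus>\<^bsub>A\<^esub> y) = h x \<oplus>\<^bsub>B\<^esub> h y"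
    "\<And>c x. x \<in> carrier A \<Longrightarrow> h (c \<odot>\<^bsub>A\<^esub> x) = c \<odot>\<^bsub>B\<^esub> h x"
    "h \<one>\<^bsub>A\<^esub> = \<one>\<^bsub>B\<^esub>"
  using assms by (auto simp: algebra_hom_def ring_hom_def)

lemma algebra_hom_zero_diff:
  fixes A :: "(complex, 'a) module" and B :: "(complex, 'b) module"
  assumes "complex_algebra A" "complex_algebra B" "h \<in> algebra_hom A B"
  shows "h \<zero>\<^bsub>A\<^esub> = \<zero>\<^bsub>B\<^esub>"
    "\<And>x y. \<lbrakk>x \<in> carrier A; y \<in> carrier A\<rbrakk> \<Longrightarrow> h (x \<ominus>\<^bsub>A\<^esub> y) = h x \<ominus>\<^bsub>B\<^esub> h y"
proof -
  interpret A: assoc_algebra A by (rule assoc_algebra.intro) fact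
  interpret B: assoc_algebra B by (rule assoc_algebra.intro) fact
  note h = algebra_homD[OF assms(3)]
  show "h \<zero>\<^bsub>A\<^esub> = \<zero>\<^bsub>B\<^esub>"
    using h(4)[OF A.one_closed, of 0] h(5) by simp
  show "h (x \<ominus>\<^bsub>A\<^esub> y) = h x \<ominus>\<^bsub>B\<^esub> h y" if "x \<in> carrier A" "y \<in> carrier A" for x y
  proof -
    have "x \<ominus>\<^bsub>A\<^esub> y = x \<oplus>\<^bsub>A\<^esub> (-1) \<odot>\<^bsub>A\<^esub> y"
      using that by (simp add: A.minus_one_smult a_minus_def)
    then show ?thesis
      using that h by (simp add: B.minus_one_smult a_minus_def)
  qed
qed

locale matrix_lie_algebra =
  fixes g :: "complex mat set"
  assumes add_in: "\<lbrakk>X \<in> g; Y \<in> g\<rbrakk> \<Longrightarrow> X + Y \<in> g"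
    and smult_in: "X \<in> g \<Longrightarrow> c \<cdot>\<^sub>m X \<in> g"
    and bracket_in: "\<lbrakk>X \<in> g; Y \<in> g\<rbrakk> \<Longrightarrow> lie_bracket X Y \<in> g"
begin

abbreviation "F \<equiv> free_algebra g"
abbreviation "U \<equiv> enveloping_algebra g"
abbreviation "\<iota> \<equiv> enveloping_map g"

sublocale F: assoc_algebra F
  by (rule assoc_algebra.intro) (rule free_algebra_algebra)

lemma generator_F: "X \<in> g \<Longrightarrow> generator X \<in> carrier F"
  by (rule generator_in_free_algebra)

lemma relations_F: "enveloping_relations g \<subseteq> carrier F"
proof -
  have k: "Poly_Mapping.keys (generator X) \<subseteq> words g" if "X \<in> g" for X
    using generator_F[OF that] by simp
  show ?thesis
  proof
    fix r assume "r \<in> enveloping_relations g"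
    then consider (add) X Y where "X \<in> g" "Y \<in> g" "r = generator (X + Y) - (generator X + generator Y)"
      | (smult) c X where "X \<in> g" "r = generator (c \<cdot>\<^sub>m X) - Poly_Mapping.map ((*) c) (generator X)"
      | (bracket) X Y where "X \<in> g" "Y \<in> g"
        "r = generator X * generator Y - generator Y * generator X - generator (lie_bracket X Y)"
      unfolding enveloping_relations_def by blast
    then have "Poly_Mapping.keys r \<subseteq> words g"
    proof cases
      case add
      show ?thesis unfolding add(3)
        by (intro keys_diff_subset keys_add_subset k add_in add(1,2))
    next
      case smult
      show ?thesis unfolding smult(2)
        by (intro keys_diff_subset keys_scale_subset k smult_in smult(1))
    next
      case bracket
      show ?thesis unfolding bracket(3)
        by (intro keys_diff_subset keys_mult_words k bracket_in bracket(1,2))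
    qed
    then show "r \<in> carrier F" by simp
  qed
qed

lemma ideal: "ideal (enveloping_ideal g) F"
  unfolding enveloping_ideal_def by (rule F.genideal_ideal[OF relations_F])

lemma relation_in: "r \<in> enveloping_relations g \<Longrightarrow> r \<in> enveloping_ideal g"
  unfolding enveloping_ideal_def using F.genideal_self[OF relations_F] by blast

lemma U_algebra: "complex_algebra U"
  unfolding enveloping_algebra_def by (rule quotient_algebra(1)[OF F.complex_algebra_axioms ideal])

sublocale U: assoc_algebra U
  by (rule assoc_algebra.intro) (rule U_algebra)

definition proj :: "(complex mat free_word \<Rightarrow>\<^sub>0 complex) \<Rightarrow> enveloping" where
  "proj p = enveloping_ideal g +>\<^bsub>F\<^esub> p"

lemma proj_hom: "proj \<in> algebra_hom F U"
  unfolding proj_def enveloping_algebra_def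
  by (rule quotient_algebra(2)[OF F.complex_algebra_axioms ideal])

lemma proj_onto: "proj ` carrier F = carrier U"
  unfolding proj_def enveloping_algebra_def
  by (rule quotient_algebra(3)[OF F.complex_algebra_axioms ideal])

lemma proj_eq_iff:
  "\<lbrakk>p \<in> carrier F; q \<in> carrier F\<rbrakk> \<Longrightarrow> proj p = proj q \<longleftrightarrow> p - q \<in> enveloping_ideal g"
  unfolding proj_def
  using quotient_algebra(4)[OF F.complex_algebra_axioms ideal, of p q] free_algebra_minus[of p g q]
  by (simp only:)

lemmas proj = algebra_homD[OF proj_hom]

lemma \<iota>_eq: "\<iota> X = proj (generator X)"
  by (simp add: enveloping_map_def proj_def)

lemma \<iota>_closed [simp]: "X \<in> g \<Longrightarrow> \<iota> X \<in> carrier U"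
  unfolding \<iota>_eq by (rule proj(1)[OF generator_F])

lemma \<iota>_add: "\<lbrakk>X \<in> g; Y \<in> g\<rbrakk> \<Longrightarrow> \<iota> (X + Y) = \<iota> X \<oplus>\<^bsub>U\<^esub> \<iota> Y"
proof -
  assume X: "X \<in> g" "Y \<in> g"
  have "generator (X + Y) - (generator X + generator Y) \<in> enveloping_ideal g"
    using X by (intro relation_in, unfold enveloping_relations_def) blast
  then have "proj (generator (X + Y)) = proj (generator X \<oplus>\<^bsub>F\<^esub> generator Y)"
    using X generator_F[OF add_in] F.a_closed[OF generator_F generator_F] by (subst proj_eq_iff) auto
  then show ?thesis unfolding \<iota>_eq using proj(3)[OF generator_F generator_F] X by simp
qed

lemma \<iota>_smult: "X \<in> g \<Longrightarrow> \<iota> (c \<cdot>\<^sub>m X) = c \<odot>\<^bsub>U\<^esub> \<iota> X"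
proof -
  assume X: "X \<in> g"
  have "generator (c \<cdot>\<^sub>m X) - Poly_Mapping.map ((*) c) (generator X) \<in> enveloping_ideal g"
    using X by (intro relation_in, unfold enveloping_relations_def) blast
  then have "proj (generator (c \<cdot>\<^sub>m X)) = proj (c \<odot>\<^bsub>F\<^esub> generator X)"
    using X generator_F[OF smult_in] F.smult_closed'[OF generator_F] by (subst proj_eq_iff) auto
  then show ?thesis unfolding \<iota>_eq using proj(4)[OF generator_F] X by simp
qed

lemma \<iota>_bracket: "\<lbrakk>X \<in> g; Y \<in> g\<rbrakk> \<Longrightarrow> commutator U (\<iota> X) (\<iota> Y) = \<iota> (lie_bracket X Y)"
proof -
  assume X: "X \<in> g" "Y \<in> g"
  note gens = generator_F[OF X(1)] generator_F[OF X(2)] generator_F[OF bracket_in[OF X]]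
  have comm: "commutator F (generator X) (generator Y) = generator X * generator Y - generator Y * generator X"
    unfolding commutator_def free_algebra_minus[OF F.m_closed[OF gens(1,2)] F.m_closed[OF gens(2,1)]]
    by (simp only: free_algebra_simps)
  have "generator X * generator Y - generator Y * generator X - generator (lie_bracket X Y)
      \<in> enveloping_ideal g"
    using X by (intro relation_in, unfold enveloping_relations_def) blast
  then have "proj (commutator F (generator X) (generator Y)) = proj (generator (lie_bracket X Y))"
    by (subst proj_eq_iff[OF F.commutator_closed[OF gens(1,2)] gens(3)]) (simp only: comm)
  moreover have "proj (commutator F (generator X) (generator Y)) = commutator U (\<iota> X) (\<iota> Y)"
    unfolding commutator_def \<iota>_eq
    using algebra_hom_zero_diff(2)[OF F.complex_algebra_axioms U_algebra proj_hom]
      F.m_closed[OF gens(1,2)] F.m_closed[OF gens(2,1)] gens proj(2) by metis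
  ultimately show ?thesis by (simp add: \<iota>_eq)
qed

lemma U_generated: "carrier U \<subseteq> generated_subalgebra U (\<iota> ` g)"
proof
  fix u assume "u \<in> carrier U"
  then obtain p where p: "p \<in> carrier F" "u = proj p" using proj_onto by blast
  have gF: "generator ` g \<subseteq> carrier F" using generator_F by blast
  have "proj q \<in> generated_subalgebra U (\<iota> ` g)"
    if "q \<in> generated_subalgebra F (generator ` g)" for q
    using that
  proof induction
    case one
    then show ?case using generated_subalgebra.one proj(5) by metis
  next
    case (mult x a)
    then obtain X where X: "X \<in> g" "x = generator X" by blast
    have "proj (x \<otimes>\<^bsub>F\<^esub> a) = \<iota> X \<otimes>\<^bsub>U\<^esub> proj a"
      unfolding \<iota>_eq X(2)
      by (rule proj(2)[OF generator_F[OF X(1)] F.generated_subalgebra_closed[OF gF mult(2)]])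
    then show ?case using generated_subalgebra.mult[OF imageI[OF X(1)] mult.IH] by simp
  next
    case (add a b)
    have "proj (a \<oplus>\<^bsub>F\<^esub> b) = proj a \<oplus>\<^bsub>U\<^esub> proj b"
      by (intro proj(3) F.generated_subalgebra_closed[OF gF] add)
    then show ?case using generated_subalgebra.add[OF add.IH] by simp
  next
    case (smult a c)
    have "proj (c \<odot>\<^bsub>F\<^esub> a) = c \<odot>\<^bsub>U\<^esub> proj a"
      by (intro proj(4) F.generated_subalgebra_closed[OF gF] smult)
    then show ?case using generated_subalgebra.smult[OF smult.IH] by simp
  qed
  then show "u \<in> generated_subalgebra U (\<iota> ` g)"
    using free_algebra_generated[OF p(1)] p(2) by blast
qed

lemma U_induct [consumes 1, case_names one mult add smult]:
  assumes "u \<in> carrier U" and "P \<one>\<^bsub>U\<^esub>"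
    and "\<And>X u. \<lbrakk>X \<in> g; u \<in> carrier U; P u\<rbrakk> \<Longrightarrow> P (\<iota> X \<otimes>\<^bsub>U\<^esub> u)"
    and "\<And>u v. \<lbrakk>u \<in> carrier U; v \<in> carrier U; P u; P v\<rbrakk> \<Longrightarrow> P (u \<oplus>\<^bsub>U\<^esub> v)"
    and "\<And>c u. \<lbrakk>u \<in> carrier U; P u\<rbrakk> \<Longrightarrow> P (c \<odot>\<^bsub>U\<^esub> u)"
  shows "P u"
proof -
  have gU: "\<iota> ` g \<subseteq> carrier U" by auto
  have "u \<in> generated_subalgebra U (\<iota> ` g)" using assms(1) U_generated by blast
  then show ?thesis
  proof induction
    case (mult x a)
    then show ?case using assms(3) U.generated_subalgebra_closed[OF gU] by blast
  qed (use assms U.generated_subalgebra_closed[OF gU] in blast)+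
qed

end

lemma algebra_homI:
  assumes "\<And>x. x \<in> carrier A \<Longrightarrow> h x \<in> carrier B" "h \<one>\<^bsub>A\<^esub> = \<one>\<^bsub>B\<^esub>"
    "\<And>c x. x \<in> carrier A \<Longrightarrow> h (c \<odot>\<^bsub>A\<^esub> x) = c \<odot>\<^bsub>B\<^esub> h x"
    "\<And>x y. \<lbrakk>x \<in> carrier A; y \<in> carrier A\<rbrakk> \<Longrightarrow> h (x \<otimes>\<^bsub>A\<^esub> y) = h x \<otimes>\<^bsub>B\<^esub> h y"
    "\<And>x y. \<lbrakk>x \<in> carrier A; y \<in> carrier A\<rbrakk> \<Longrightarrow> h (x \<oplus>\<^bsub>A\<^esub> y) = h x \<oplus>\<^bsub>B\<^esub> h y"
  shows "h \<in> algebra_hom A B"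
  using assms by (auto simp: algebra_hom_def ring_hom_def)

context matrix_lie_algebra
begin

text \<open>
  The kernel of the lift to the free algebra is an ideal that contains the defining relations, so the
  lift is constant on cosets of \<^const>\<open>enveloping_ideal\<close>.
\<close>

lemma enveloping_lift_hom:
  fixes A :: "(complex, 'a) module"
  assumes A: "complex_algebra A" and f: "f ` g \<subseteq> carrier A"
    and add: "\<And>X Y. \<lbrakk>X \<in> g; Y \<in> g\<rbrakk> \<Longrightarrow> f (X + Y) = f X \<oplus>\<^bsub>A\<^esub> f Y"
    and smult: "\<And>c X. X \<in> g \<Longrightarrow> f (c \<cdot>\<^sub>m X) = c \<odot>\<^bsub>A\<^esub> f X"
    and bracket: "\<And>X Y. \<lbrakk>X \<in> g; Y \<in> g\<rbrakk> \<Longrightarrow> commutator A (f X) (f Y) = f (lie_bracket X Y)"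
  shows "enveloping_lift A f \<in> algebra_hom U A" and "\<And>X. X \<in> g \<Longrightarrow> enveloping_lift A f (\<iota> X) = f X"
proof -
  interpret A: assoc_algebra A by (rule assoc_algebra.intro[OF A])
  let ?l = "free_algebra_lift A f"
  note hom = A.free_algebra_lift_hom[OF f]
  note l = algebra_homD[OF hom]
  note l_diff = algebra_hom_zero_diff(2)[OF F.complex_algebra_axioms A hom]
  have l_gen: "?l (generator X) = f X" if "X \<in> g" for X
    by (rule A.free_algebra_lift_generator[of f X, OF subsetD[OF f imageI[OF that]]])
  have l_diff': "?l (p - q) = ?l p \<ominus>\<^bsub>A\<^esub> ?l q" if "p \<in> carrier F" "q \<in> carrier F" for p q
    using l_diff[OF that] free_algebra_minus[OF that] by simp
  let ?N = "{p \<in> carrier F. ?l p = \<zero>\<^bsub>A\<^esub>}"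
  have ringhom: "ring_hom_ring F A ?l"
    using hom by (intro ring_hom_ringI2 F.ring_axioms A.ring_axioms) (simp add: algebra_hom_def)
  have "ideal ?N F"
    using ring_hom_ring.kernel_is_ideal[OF ringhom] by (simp add: a_kernel_def')
  moreover have "enveloping_relations g \<subseteq> ?N"
  proof
    fix r assume r: "r \<in> enveloping_relations g"
    have "?l r = \<zero>\<^bsub>A\<^esub>"
    proof -
      have fc: "X \<in> g \<Longrightarrow> f X \<in> carrier A" for X by (rule subsetD[OF f imageI])
      from r consider (add) X Y where "X \<in> g" "Y \<in> g" "r = generator (X + Y) - (generator X + generator Y)"
        | (smult) c X where "X \<in> g" "r = generator (c \<cdot>\<^sub>m X) - Poly_Mapping.map ((*) c) (generator X)"
        | (bracket) X Y where "X \<in> g" "Y \<in> g"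
          "r = generator X * generator Y - generator Y * generator X - generator (lie_bracket X Y)"
        unfolding enveloping_relations_def by blast
      then show ?thesis
      proof cases
        case add
        note gen = generator_F[OF add(1)] generator_F[OF add(2)] generator_F[OF add_in[OF add(1,2)]]
        have "?l r = ?l (generator (X + Y)) \<ominus>\<^bsub>A\<^esub> ?l (generator X \<oplus>\<^bsub>F\<^esub> generator Y)"
          unfolding add(3) using l_diff'[OF gen(3) F.a_closed[OF gen(1,2)]] by simp
        also have "\<dots> = \<zero>\<^bsub>A\<^esub>"
          unfolding l(3)[OF gen(1,2)] using add l_gen add_in fc assms(3) by simp
        finally show ?thesis .
      next
        case smult
        note gen = generator_F[OF smult(1)] generator_F[OF smult_in[OF smult(1)]]
        have "?l r = ?l (generator (c \<cdot>\<^sub>m X)) \<ominus>\<^bsub>A\<^esub> ?l (c \<odot>\<^bsub>F\<^esub> generator X)"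
          unfolding smult(2) using l_diff'[OF gen(2) F.smult_closed'[OF gen(1)]] by simp
        also have "\<dots> = \<zero>\<^bsub>A\<^esub>"
          unfolding l(4)[OF gen(1)] using smult l_gen smult_in fc assms(4) by simp
        finally show ?thesis .
      next
        case bracket
        note gen = generator_F[OF bracket(1)] generator_F[OF bracket(2)]
          generator_F[OF bracket_in[OF bracket(1,2)]]
        note m = F.m_closed[OF gen(1,2)] F.m_closed[OF gen(2,1)]
        have d: "generator X * generator Y - generator Y * generator X \<in> carrier F"
          using F.minus_closed[OF m] free_algebra_minus[OF m] by simp
        have "?l r = (?l (generator X \<otimes>\<^bsub>F\<^esub> generator Y) \<ominus>\<^bsub>A\<^esub> ?l (generator Y \<otimes>\<^bsub>F\<^esub> generator X))
            \<ominus>\<^bsub>A\<^esub> ?l (generator (lie_bracket X Y))"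
          unfolding bracket(3) using l_diff'[OF d gen(3)] l_diff'[OF m] by simp
        also have "\<dots> = \<zero>\<^bsub>A\<^esub>"
          unfolding l(2)[OF gen(1,2)] l(2)[OF gen(2,1)]
          using bracket l_gen bracket_in fc assms(5)[OF bracket(1,2)] by (simp add: commutator_def)
        finally show ?thesis .
      qed
    qed
    then show "r \<in> ?N" using r relations_F by blast
  qed
  ultimately have N: "enveloping_ideal g \<subseteq> ?N"
    unfolding enveloping_ideal_def by (rule F.genideal_minimal)
  have lift: "enveloping_lift A f (proj p) = ?l p" if p: "p \<in> carrier F" for p
  proof -
    have "?l q = ?l p" if q: "q \<in> proj p" for q
    proof -
      obtain k where k: "k \<in> enveloping_ideal g" "q = k \<oplus>\<^bsub>F\<^esub> p"
        using q unfolding proj_def a_r_coset_def' by auto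
      have "k \<in> ?N" using k(1) N by blast
      then have k': "k \<in> carrier F" "?l k = \<zero>\<^bsub>A\<^esub>" by blast+
      show ?thesis using k l(3)[OF k'(1) p] k'(2) l(1)[OF p] by simp
    qed
    moreover have "p \<in> proj p"
      using F.a_rcos_zero[OF ideal] ideal p unfolding proj_def
      by (meson abelian_subgroup.a_rcos_self abelian_subgroupI3 ideal.axioms(1) F.abelian_group_axioms)
    ultimately have "?l ` proj p = {?l p}" by blast
    then show ?thesis by (simp add: enveloping_lift_def)
  qed
  have U: "u \<in> carrier U \<Longrightarrow> \<exists>p\<in>carrier F. u = proj p" for u using proj_onto by blast
  show "enveloping_lift A f \<in> algebra_hom U A"
  proof (rule algebra_homI)
    show "enveloping_lift A f \<one>\<^bsub>U\<^esub> = \<one>\<^bsub>A\<^esub>"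
      using lift[OF F.one_closed] proj(5) l(5) by simp
    fix u assume "u \<in> carrier U"
    then obtain p where p: "p \<in> carrier F" "u = proj p" using U by blast
    show "enveloping_lift A f u \<in> carrier A" using p lift l(1) by simp
    show "enveloping_lift A f (c \<odot>\<^bsub>U\<^esub> u) = c \<odot>\<^bsub>A\<^esub> enveloping_lift A f u" for c
      using lift[OF F.smult_closed'[OF p(1)]] lift[OF p(1)] proj(4)[OF p(1)] l(4)[OF p(1)] p(2) by simp
    fix v assume "v \<in> carrier U"
    then obtain q where q: "q \<in> carrier F" "v = proj q" using U by blast
    show "enveloping_lift A f (u \<otimes>\<^bsub>U\<^esub> v) = enveloping_lift A f u \<otimes>\<^bsub>A\<^esub> enveloping_lift A f v"
      using lift[OF F.m_closed[OF p(1) q(1)]] lift[OF p(1)] lift[OF q(1)] proj(2)[OF p(1) q(1)]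
        l(2)[OF p(1) q(1)] p(2) q(2) by simp
    show "enveloping_lift A f (u \<oplus>\<^bsub>U\<^esub> v) = enveloping_lift A f u \<oplus>\<^bsub>A\<^esub> enveloping_lift A f v"
      using lift[OF F.a_closed[OF p(1) q(1)]] lift[OF p(1)] lift[OF q(1)] proj(3)[OF p(1) q(1)]
        l(3)[OF p(1) q(1)] p(2) q(2) by simp
  qed
  show "enveloping_lift A f (\<iota> X) = f X" if "X \<in> g" for X
    using lift[OF generator_F[OF that]] l_gen[OF that] by (simp add: \<iota>_eq)
qed

end

section \<open>Traceless matrices\<close>

lemma matrix_unit_carrier [simp]: "matrix_unit n i j \<in> carrier_mat (n + 1) (n + 1)"
  by (simp add: matrix_unit_def)

lemma matrix_unit_carrier_Suc [simp]: "matrix_unit n i j \<in> carrier_mat (Suc n) (Suc n)"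
  by (simp add: matrix_unit_def)

lemma index_matrix_unit [simp]:
  "a \<le> n \<Longrightarrow> b \<le> n \<Longrightarrow> matrix_unit n i j $$ (a, b) = (if a = i \<and> b = j then 1 else 0)"
  by (simp add: matrix_unit_def)

lemma index_mult_square:
  assumes "X \<in> carrier_mat (n + 1) (n + 1)" "Y \<in> carrier_mat (n + 1) (n + 1)" "a \<le> n" "b \<le> n"
  shows "(X * Y) $$ (a, b) = (\<Sum>k\<le>n. X $$ (a, k) * Y $$ (k, b))"
  using assms by (auto simp: scalar_prod_def atLeast0LessThan lessThan_Suc_atMost intro!: sum.cong)

lemma trace_square: "X \<in> carrier_mat (n + 1) (n + 1) \<Longrightarrow> trace X = (\<Sum>i\<le>n. X $$ (i, i))"
  by (simp add: trace_def lessThan_Suc_atMost)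

lemma trace_add:
  assumes "X \<in> carrier_mat (n + 1) (n + 1)" "Y \<in> carrier_mat (n + 1) (n + 1)"
  shows "trace (X + Y) = trace X + trace Y"
  using assms by (simp add: trace_square[of _ n] sum.distrib)

lemma trace_smult: "X \<in> carrier_mat (n + 1) (n + 1) \<Longrightarrow> trace (c \<cdot>\<^sub>m X) = c * trace X"
  by (simp add: trace_square[of _ n] sum_distrib_left)

lemma trace_mult_commute:
  assumes "X \<in> carrier_mat (n + 1) (n + 1)" "Y \<in> carrier_mat (n + 1) (n + 1)"
  shows "trace (X * Y) = trace (Y * X)"
proof -
  have "trace (X * Y) = (\<Sum>i\<le>n. \<Sum>k\<le>n. X $$ (i, k) * Y $$ (k, i))"
    using assms by (simp add: trace_square[of _ n] index_mult_square[of _ n] del: index_mult_mat)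
  also have "\<dots> = (\<Sum>k\<le>n. \<Sum>i\<le>n. Y $$ (k, i) * X $$ (i, k))"
    by (subst sum.swap) (simp add: mult.commute)
  also have "\<dots> = trace (Y * X)"
    using assms by (simp add: trace_square[of _ n] index_mult_square[of _ n] del: index_mult_mat)
  finally show ?thesis .
qed

lemma lie_bracket_carrier:
  "\<lbrakk>X \<in> carrier_mat (n + 1) (n + 1); Y \<in> carrier_mat (n + 1) (n + 1)\<rbrakk> \<Longrightarrow>
    lie_bracket X Y \<in> carrier_mat (n + 1) (n + 1)"
  by (auto simp: lie_bracket_def)

lemma index_lie_bracket:
  assumes "X \<in> carrier_mat (n + 1) (n + 1)" "Y \<in> carrier_mat (n + 1) (n + 1)" "a \<le> n" "b \<le> n"
  shows "lie_bracket X Y $$ (a, b) =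
    (\<Sum>k\<le>n. X $$ (a, k) * Y $$ (k, b)) - (\<Sum>k\<le>n. Y $$ (a, k) * X $$ (k, b))"
proof -
  have "dim_row (Y * X) = n + 1" "dim_col (Y * X) = n + 1" using assms by auto
  then have "lie_bracket X Y $$ (a, b) = (X * Y) $$ (a, b) - (Y * X) $$ (a, b)"
    unfolding lie_bracket_def using assms by (intro index_minus_mat) auto
  then show ?thesis using assms by (simp only: index_mult_square[of _ n])
qed

lemma eq_mat_square:
  assumes "X \<in> carrier_mat (n + 1) (n + 1)" "Y \<in> carrier_mat (n + 1) (n + 1)"
    and "\<And>a b. \<lbrakk>a \<le> n; b \<le> n\<rbrakk> \<Longrightarrow> X $$ (a, b) = Y $$ (a, b)"
  shows "X = Y"
  using assms by (intro eq_matI) auto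

lemma sl_carrier: "X \<in> sl n \<Longrightarrow> X \<in> carrier_mat (n + 1) (n + 1)"
  by (simp add: sl_def)

lemma mm_carrier: "X \<in> mm n \<Longrightarrow> X \<in> carrier_mat (n + 1) (n + 1)"
  by (simp add: mm_def)

lemma mm_index: "\<lbrakk>X \<in> mm n; a \<le> n; b \<le> n; a \<noteq> 0 \<or> b = 0\<rbrakk> \<Longrightarrow> X $$ (a, b) = 0"
  by (auto simp: mm_def)

lemma mm_sl: "X \<in> mm n \<Longrightarrow> X \<in> sl n"
proof -
  assume X: "X \<in> mm n"
  have "(\<Sum>i\<le>n. X $$ (i, i)) = 0"
    by (rule sum.neutral) (use mm_index[OF X] in auto)
  then show ?thesis using mm_carrier[OF X] by (simp add: sl_def trace_square)
qed

lemma matrix_lie_algebra_sl: "matrix_lie_algebra (sl n)"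
proof
  fix X Y assume X: "X \<in> sl n" "Y \<in> sl n"
  note c = sl_carrier[OF X(1)] sl_carrier[OF X(2)]
  show "X + Y \<in> sl n" using X c trace_add[OF c] by (simp add: sl_def)
  have m: "X * Y \<in> carrier_mat (n + 1) (n + 1)" "Y * X \<in> carrier_mat (n + 1) (n + 1)"
    using c by auto
  have "lie_bracket X Y = X * Y + (-1) \<cdot>\<^sub>m (Y * X)"
    unfolding lie_bracket_def using m by (intro eq_mat_square[of _ n]) (auto simp del: index_mult_mat)
  then have "trace (lie_bracket X Y) = 0"
    using trace_add[of "X * Y" n "(-1) \<cdot>\<^sub>m (Y * X)"] trace_smult[OF m(2), of "-1"] m
      trace_mult_commute[OF c] by simp
  then show "lie_bracket X Y \<in> sl n"
    using lie_bracket_carrier[OF c] by (simp add: sl_def)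
next
  fix c X assume X: "X \<in> sl n"
  show "c \<cdot>\<^sub>m X \<in> sl n" using X sl_carrier[OF X] trace_smult[OF sl_carrier[OF X]] by (simp add: sl_def)
qed

lemma zero_mm: "0\<^sub>m (n + 1) (n + 1) \<in> mm n"
  by (auto simp: mm_def)

lemma mm_bracket:
  assumes X: "X \<in> mm n" and Y: "Y \<in> mm n"
  shows "lie_bracket X Y = 0\<^sub>m (n + 1) (n + 1)"
proof (rule eq_mat_square[of _ n])
  fix a b assume ab: "a \<le> n" "b \<le> n"
  have "(\<Sum>k\<le>n. X $$ (a, k) * Y $$ (k, b)) = 0"
    by (rule sum.neutral) (use ab mm_index[OF X ab(1)] mm_index[OF Y _ ab(2)] in fastforce)
  moreover have "(\<Sum>k\<le>n. Y $$ (a, k) * X $$ (k, b)) = 0"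
    by (rule sum.neutral) (use ab mm_index[OF Y ab(1)] mm_index[OF X _ ab(2)] in fastforce)
  ultimately show "lie_bracket X Y $$ (a, b) = 0\<^sub>m (n + 1) (n + 1) $$ (a, b)"
    using index_lie_bracket[OF mm_carrier[OF X] mm_carrier[OF Y] ab] ab by simp
qed (use lie_bracket_carrier mm_carrier X Y in auto)

lemma matrix_lie_algebra_mm: "matrix_lie_algebra (mm n)"
proof
  fix X Y assume X: "X \<in> mm n" "Y \<in> mm n"
  show "X + Y \<in> mm n"
    using X by (auto simp: mm_def) (metis add_0)+
  show "lie_bracket X Y \<in> mm n" using mm_bracket[OF X] zero_mm by simp
qed (auto simp: mm_def)

lemma matrix_unit_mm: "\<lbrakk>1 \<le> i; i \<le> n\<rbrakk> \<Longrightarrow> matrix_unit n 0 i \<in> mm n"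
  by (auto simp: mm_def split: if_splits)

lemma matrix_unit_sl: "i \<noteq> j \<Longrightarrow> matrix_unit n i j \<in> sl n"
  by (auto simp: sl_def trace_square[of _ n] intro!: sum.neutral)

text \<open>
  Subtracting a multiple of a matrix unit removes one nonzero off-diagonal entry.  The restriction to
  places where \<open>X\<close> does not vanish allows the rule to be used for subspaces such as \<^const>\<open>mm\<close>.
\<close>

lemma off_diagonal_induct:
  assumes X: "X \<in> carrier_mat (n + 1) (n + 1)"
    and diagonal: "\<And>D. \<lbrakk>D \<in> carrier_mat (n + 1) (n + 1); diagonal_mat D;
        \<And>a. a \<le> n \<Longrightarrow> D $$ (a, a) = X $$ (a, a)\<rbrakk> \<Longrightarrow> P D"
    and unit: "\<And>i j. \<lbrakk>i \<le> n; j \<le> n; i \<noteq> j; X $$ (i, j) \<noteq> 0\<rbrakk> \<Longrightarrow> P (matrix_unit n i j)"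
    and add: "\<And>A B. \<lbrakk>A \<in> carrier_mat (n + 1) (n + 1); B \<in> carrier_mat (n + 1) (n + 1); P A; P B\<rbrakk> \<Longrightarrow> P (A + B)"
    and smult: "\<And>c A. \<lbrakk>A \<in> carrier_mat (n + 1) (n + 1); P A\<rbrakk> \<Longrightarrow> P (c \<cdot>\<^sub>m A)"
  shows "P X"
proof -
  define E where "E Y = {(i, j). i \<le> n \<and> j \<le> n \<and> i \<noteq> j \<and> Y $$ (i, j) \<noteq> 0}" for Y :: "complex mat"
  have fin: "finite (E Y)" for Y
    by (rule finite_subset[of _ "{..n} \<times> {..n}"]) (auto simp: E_def)
  have "P Y" if "Y \<in> carrier_mat (n + 1) (n + 1)" "E Y \<subseteq> E X" "\<And>a. a \<le> n \<Longrightarrow> Y $$ (a, a) = X $$ (a, a)"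
    for Y
    using that
  proof (induction "card (E Y)" arbitrary: Y rule: less_induct)
    case (less Y)
    show ?case
    proof (cases "E Y = {}")
      case True
      then have "diagonal_mat Y"
        using less.prems(1) by (auto simp: diagonal_mat_def E_def) (metis less_Suc_eq_le)
      then show ?thesis using diagonal less.prems by blast
    next
      case False
      then obtain i j where ij: "i \<le> n" "j \<le> n" "i \<noteq> j" "Y $$ (i, j) \<noteq> 0"
        by (auto simp: E_def)
      define Z where "Z = mat (n + 1) (n + 1) (\<lambda>(a, b). if a = i \<and> b = j then 0 else Y $$ (a, b))"
      have Z: "Z \<in> carrier_mat (n + 1) (n + 1)" by (simp add: Z_def)
      have EZ: "E Z = E Y - {(i, j)}" by (auto simp: E_def Z_def split: if_splits)
      have "card (E Z) < card (E Y)"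
        unfolding EZ using fin ij by (intro card_Diff1_less) (auto simp: E_def)
      moreover have "Z $$ (a, a) = X $$ (a, a)" if "a \<le> n" for a
        using that less.prems(3) ij by (auto simp: Z_def)
      ultimately have "P Z" using less.hyps Z EZ less.prems(2) by blast
      moreover have "P (Y $$ (i, j) \<cdot>\<^sub>m matrix_unit n i j)"
        using less.prems(2) ij by (intro smult unit) (auto simp: E_def)
      ultimately have "P (Z + Y $$ (i, j) \<cdot>\<^sub>m matrix_unit n i j)"
        using Z by (intro add) auto
      also have "Z + Y $$ (i, j) \<cdot>\<^sub>m matrix_unit n i j = Y"
        using Z less.prems(1) ij by (intro eq_mat_square[of _ n]) (auto simp: Z_def matrix_unit_def)
      finally show ?thesis .
    qed
  qed
  then show ?thesis using X by blast
qed

text \<open>The basis of the Cartan subalgebra dual to the weights of the \<open>e\<^sub>0\<^sub>k\<close>.\<close>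

definition coweight :: "nat \<Rightarrow> nat \<Rightarrow> complex mat" where
  "coweight n k = mat (n + 1) (n + 1)
    (\<lambda>(a, b). if a = b then 1 / of_nat (n + 1) - (if a = k then 1 else 0) else 0)"

lemma coweight_carrier [simp]: "coweight n k \<in> carrier_mat (n + 1) (n + 1)"
  by (simp add: coweight_def)

lemma coweight_carrier_Suc [simp]: "coweight n k \<in> carrier_mat (Suc n) (Suc n)"
  by (simp add: coweight_def)

lemma index_coweight [simp]:
  "a \<le> n \<Longrightarrow> b \<le> n \<Longrightarrow> coweight n k $$ (a, b) =
    (if a = b then 1 / of_nat (n + 1) - (if a = k then 1 else 0) else 0)"
  by (simp add: coweight_def)

lemma coweight_cartan: "k \<le> n \<Longrightarrow> coweight n k \<in> cartan n"
proof -
  assume k: "k \<le> n"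
  have "trace (coweight n k) = (\<Sum>i\<le>n. 1 / of_nat (n + 1) - (if i = k then 1 else 0))"
    by (simp add: trace_square[of _ n])
  also have "\<dots> = 0"
    using k by (simp add: sum_subtractf del: of_nat_Suc)
  finally have "trace (coweight n k) = 0" .
  then show ?thesis
    by (auto simp: cartan_def sl_def diagonal_mat_def coweight_def)
qed

text \<open>
  Subtracting a multiple of \<open>coweight n k\<close> makes the entry at \<open>k\<close> equal to the entry at \<open>0\<close> and
  shifts all the others by the same amount.  If all diagonal entries agree, the trace condition
  forces the matrix to vanish.
\<close>

lemma cartan_induct [consumes 1, case_names zero coweight add smult]:
  assumes X: "X \<in> cartan n"
    and zero: "P (0\<^sub>m (n + 1) (n + 1))"
    and coweight: "\<And>k. k \<in> {1..n} \<Longrightarrow> P (coweight n k)"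
    and add: "\<And>A B. \<lbrakk>A \<in> sl n; B \<in> sl n; P A; P B\<rbrakk> \<Longrightarrow> P (A + B)"
    and smult: "\<And>c A. \<lbrakk>A \<in> sl n; P A\<rbrakk> \<Longrightarrow> P (c \<cdot>\<^sub>m A)"
  shows "P X"
proof -
  interpret matrix_lie_algebra "sl n" by (rule matrix_lie_algebra_sl)
  define E where "E Y = {k \<in> {1..n}. Y $$ (k, k) \<noteq> Y $$ (0, 0)}" for Y :: "complex mat"
  show ?thesis
    using X
  proof (induction "card (E X)" arbitrary: X rule: less_induct)
    case (less X)
    have X: "X \<in> carrier_mat (n + 1) (n + 1)" "X \<in> sl n" "trace X = 0" "diagonal_mat X"
      using less.prems by (auto simp: cartan_def sl_def)
    have off: "X $$ (a, b) = 0" if "a \<le> n" "b \<le> n" "a \<noteq> b" for a b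
      using X that by (auto simp: diagonal_mat_def)
    show ?case
    proof (cases "E X = {}")
      case True
      then have eq: "X $$ (k, k) = X $$ (0, 0)" if "k \<le> n" for k
        using that by (cases "k = 0") (auto simp: E_def)
      have "0 = (\<Sum>i\<le>n. X $$ (i, i))" using X by (simp add: trace_square[of _ n])
      also have "\<dots> = (\<Sum>i\<le>n. X $$ (0, 0))" by (intro sum.cong eq) auto
      also have "\<dots> = of_nat (n + 1) * X $$ (0, 0)" by simp
      finally have X00: "X $$ (0, 0) = 0" by (simp del: of_nat_Suc of_nat_add)
      have "X $$ (a, b) = 0" if "a \<le> n" "b \<le> n" for a b
        using off[OF that] eq[of a] that X00 by (cases "a = b") auto
      then have "X = 0\<^sub>m (n + 1) (n + 1)"
        using X(1) by (intro eq_mat_square[of _ n]) auto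
      then show ?thesis using zero by simp
    next
      case False
      then obtain k where k: "k \<in> {1..n}" "X $$ (k, k) \<noteq> X $$ (0, 0)" by (auto simp: E_def)
      define c where "c = X $$ (0, 0) - X $$ (k, k)"
      have h: "coweight n k \<in> sl n" using coweight_cartan[of k n] k by (simp add: cartan_def)
      define Z where "Z = X + (- c) \<cdot>\<^sub>m coweight n k"
      have Zsl: "Z \<in> sl n" unfolding Z_def by (intro add_in smult_in X h)
      have Zi: "Z $$ (a, b) = X $$ (a, b) - c * (if a = b then 1 / of_nat (n + 1) - (if a = k then 1 else 0) else 0)"
        if "a \<le> n" "b \<le> n" for a b
        using that X k by (simp add: Z_def coweight_def)
      have "diagonal_mat Z"
        using sl_carrier[OF Zsl] Zi off by (auto simp: diagonal_mat_def)
      then have Z: "Z \<in> cartan n" using Zsl by (simp add: cartan_def)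
      have "E Z = E X - {k}"
        using k by (auto simp: E_def Zi c_def algebra_simps split: if_splits)
      moreover have "k \<in> E X" "finite (E X)" using k by (auto simp: E_def)
      ultimately have "card (E Z) < card (E X)" by (metis card_Diff1_less)
      then have "P Z" using less.hyps Z by blast
      then have "P (Z + c \<cdot>\<^sub>m coweight n k)"
        using coweight[OF k(1)] smult h Zsl smult_in[OF h] by (intro add) auto
      also have "Z + c \<cdot>\<^sub>m coweight n k = X"
        using X sl_carrier[OF Zsl] by (intro eq_mat_square[of _ n]) (auto simp: Z_def coweight_def)
      finally show ?thesis .
    qed
  qed
qed

lemma sl_induct [consumes 1, case_names zero coweight unit add smult]:
  assumes X: "X \<in> sl n"
    and zero: "P (0\<^sub>m (n + 1) (n + 1))"
    and coweight: "\<And>k. k \<in> {1..n} \<Longrightarrow> P (coweight n k)"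
    and unit: "\<And>i j. \<lbrakk>i \<le> n; j \<le> n; i \<noteq> j\<rbrakk> \<Longrightarrow> P (matrix_unit n i j)"
    and add: "\<And>A B. \<lbrakk>A \<in> sl n; B \<in> sl n; P A; P B\<rbrakk> \<Longrightarrow> P (A + B)"
    and smult: "\<And>c A. \<lbrakk>A \<in> sl n; P A\<rbrakk> \<Longrightarrow> P (c \<cdot>\<^sub>m A)"
  shows "P X"
proof -
  interpret matrix_lie_algebra "sl n" by (rule matrix_lie_algebra_sl)
  have "X \<in> sl n \<and> P X"
  proof (rule off_diagonal_induct[OF sl_carrier[OF X]])
    fix D assume D: "D \<in> carrier_mat (n + 1) (n + 1)" "diagonal_mat D"
      "\<And>a. a \<le> n \<Longrightarrow> D $$ (a, a) = X $$ (a, a)"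
    have "trace D = trace X"
      using D X sl_carrier[OF X] by (simp add: trace_square[of _ n])
    then have "D \<in> cartan n" using D X by (simp add: cartan_def sl_def)
    then show "D \<in> sl n \<and> P D"
      using cartan_induct[of D n P] assms by (auto simp: cartan_def)
  next
    fix i j assume "i \<le> n" "j \<le> n" "i \<noteq> j"
    then show "matrix_unit n i j \<in> sl n \<and> P (matrix_unit n i j)"
      by (simp add: unit matrix_unit_sl)
  qed (simp_all add: add smult add_in smult_in)
  then show ?thesis by simp
qed

lemma mm_induct [consumes 1, case_names zero unit add smult]:
  assumes X: "X \<in> mm n"
    and zero: "P (0\<^sub>m (n + 1) (n + 1))"
    and unit: "\<And>i. i \<in> {1..n} \<Longrightarrow> P (matrix_unit n 0 i)"
    and add: "\<And>A B. \<lbrakk>A \<in> mm n; B \<in> mm n; P A; P B\<rbrakk> \<Longrightarrow> P (A + B)"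
    and smult: "\<And>c A. \<lbrakk>A \<in> mm n; P A\<rbrakk> \<Longrightarrow> P (c \<cdot>\<^sub>m A)"
  shows "P X"
proof -
  interpret matrix_lie_algebra "mm n" by (rule matrix_lie_algebra_mm)
  have "X \<in> mm n \<and> P X"
  proof (rule off_diagonal_induct[OF mm_carrier[OF X]])
    fix D assume D: "D \<in> carrier_mat (n + 1) (n + 1)" "diagonal_mat D"
      "\<And>a. a \<le> n \<Longrightarrow> D $$ (a, a) = X $$ (a, a)"
    have "D = 0\<^sub>m (n + 1) (n + 1)"
    proof (rule eq_mat_square[of _ n])
      fix a b assume ab: "a \<le> n" "b \<le> n"
      show "D $$ (a, b) = 0\<^sub>m (n + 1) (n + 1) $$ (a, b)"
        using D(1,2) D(3)[of a] mm_index[OF X, of a a] ab by (cases "a = b") (auto simp: diagonal_mat_def)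
    qed (use D in auto)
    then show "D \<in> mm n \<and> P D" using zero zero_mm by simp
  next
    fix i j assume ij: "i \<le> n" "j \<le> n" "i \<noteq> j" "X $$ (i, j) \<noteq> 0"
    then have "i = 0" using mm_index[OF X, of i j] by blast
    then show "matrix_unit n i j \<in> mm n \<and> P (matrix_unit n i j)"
      using ij unit[of j] matrix_unit_mm[of j n] by auto
  qed (simp_all add: add smult add_in smult_in)
  then show ?thesis by simp
qed

lemma bracket_diagonal_unit:
  assumes D: "D \<in> carrier_mat (n + 1) (n + 1)" "diagonal_mat D" and ij: "i \<le> n" "j \<le> n"
  shows "lie_bracket D (matrix_unit n i j) = (D $$ (i, i) - D $$ (j, j)) \<cdot>\<^sub>m matrix_unit n i j"
proof (rule eq_mat_square[of _ n])
  fix a b assume ab: "a \<le> n" "b \<le> n"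
  have off: "D $$ (a, b) = 0" if "a \<le> n" "b \<le> n" "a \<noteq> b" for a b
    using D that by (auto simp: diagonal_mat_def)
  have "(\<Sum>k\<le>n. D $$ (a, k) * matrix_unit n i j $$ (k, b)) = (if b = j then D $$ (a, i) else 0)"
    using ab ij by (simp add: if_distrib[of "\<lambda>x. _ * x"] cong: if_cong)
  moreover have "(\<Sum>k\<le>n. matrix_unit n i j $$ (a, k) * D $$ (k, b)) = (if a = i then D $$ (j, b) else 0)"
    using ab ij by (simp add: if_distrib[of "\<lambda>x. x * _"] cong: if_cong)
  ultimately show "lie_bracket D (matrix_unit n i j) $$ (a, b)
      = ((D $$ (i, i) - D $$ (j, j)) \<cdot>\<^sub>m matrix_unit n i j) $$ (a, b)"
    using index_lie_bracket[OF D(1) matrix_unit_carrier ab] ab ij off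
    by (auto simp: matrix_unit_def)
qed (use D lie_bracket_carrier in auto)

lemma bracket_diagonal:
  assumes D: "D \<in> carrier_mat (n + 1) (n + 1)" "diagonal_mat D"
    and E: "E \<in> carrier_mat (n + 1) (n + 1)" "diagonal_mat E"
  shows "lie_bracket D E = 0\<^sub>m (n + 1) (n + 1)"
proof (rule eq_mat_square[of _ n])
  fix a b assume ab: "a \<le> n" "b \<le> n"
  have off: "D $$ (a, b) = 0" "E $$ (a, b) = 0" if "a \<le> n" "b \<le> n" "a \<noteq> b" for a b
    using D E that by (auto simp: diagonal_mat_def)
  have "(\<Sum>k\<le>n. D $$ (a, k) * E $$ (k, b)) = (\<Sum>k\<le>n. E $$ (a, k) * D $$ (k, b))"
    by (rule sum.cong) (use off ab in \<open>auto, metis mult.commute mult_zero_left mult_zero_right\<close>)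
  then show "lie_bracket D E $$ (a, b) = 0\<^sub>m (n + 1) (n + 1) $$ (a, b)"
    using index_lie_bracket[OF D(1) E(1) ab] ab by simp
qed (use D E lie_bracket_carrier in auto)

lemma coweight_diagonal: "diagonal_mat (coweight n k)"
  by (auto simp: diagonal_mat_def coweight_def)

text \<open>
  For \<open>e = e\<^sub>0\<^sub>i\<close> one has \<open>e\<^sup>2 = 0\<close>, so \<open>[e, [e, X]] = - 2 e X e\<close>, and \<open>e X e\<close> is a multiple of \<open>e\<close>.
  In particular a third bracket with \<open>e\<close> vanishes.
\<close>

lemma bracket_unit_twice:
  assumes X: "X \<in> carrier_mat (n + 1) (n + 1)" and i: "i \<in> {1..n}"
  shows "lie_bracket (matrix_unit n 0 i) (lie_bracket (matrix_unit n 0 i) X)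
    = (- 2 * X $$ (i, 0)) \<cdot>\<^sub>m matrix_unit n 0 i"
proof -
  have idx: "lie_bracket (matrix_unit n 0 i) Y $$ (a, b)
      = (if a = 0 then Y $$ (i, b) else 0) - (if b = i then Y $$ (a, 0) else 0)"
    if Y: "Y \<in> carrier_mat (n + 1) (n + 1)" and ab: "a \<le> n" "b \<le> n" for Y a b
  proof -
    have "(\<Sum>k\<le>n. matrix_unit n 0 i $$ (a, k) * Y $$ (k, b)) = (if a = 0 then Y $$ (i, b) else 0)"
      using ab i by (simp add: if_distrib[of "\<lambda>x. x * _"] cong: if_cong)
    moreover have "(\<Sum>k\<le>n. Y $$ (a, k) * matrix_unit n 0 i $$ (k, b)) = (if b = i then Y $$ (a, 0) else 0)"
      using ab i by (simp add: if_distrib[of "\<lambda>x. _ * x"] cong: if_cong)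
    ultimately show ?thesis using index_lie_bracket[OF matrix_unit_carrier Y ab] by simp
  qed
  have Y: "lie_bracket (matrix_unit n 0 i) X \<in> carrier_mat (n + 1) (n + 1)"
    using X lie_bracket_carrier by simp
  show ?thesis
    by (rule eq_mat_square[of _ n])
      (use Y X i lie_bracket_carrier in \<open>auto simp: idx[OF Y] idx[OF X] simp del: One_nat_def, auto simp: matrix_unit_def\<close>)
qed

lemma character_mm: "X \<in> mm n \<Longrightarrow> \<theta> n X = (\<Sum>k=1..n. X $$ (0, k))"
proof -
  assume X: "X \<in> mm n"
  have e: "min_nilpotent n \<in> carrier_mat (n + 1) (n + 1)" by (simp add: min_nilpotent_def)
  have "\<theta> n X = (\<Sum>a\<le>n. \<Sum>k\<le>n. X $$ (a, k) * min_nilpotent n $$ (k, a))"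
    using mm_carrier[OF X] e mult_carrier_mat[OF mm_carrier[OF X] e]
    by (simp add: \<theta>_def trace_square[of _ n] index_mult_square[of _ n] del: index_mult_mat)
  also have "\<dots> = (\<Sum>a\<le>n. if a = 0 then \<Sum>k\<le>n. X $$ (0, k) * min_nilpotent n $$ (k, 0) else 0)"
    using mm_index[OF X] by (intro sum.cong) auto
  also have "\<dots> = (\<Sum>k\<le>n. X $$ (0, k) * min_nilpotent n $$ (k, 0))"
    by simp
  also have "\<dots> = (\<Sum>k=1..n. X $$ (0, k))"
    using mm_index[OF X, of 0 0] by (intro sum.mono_neutral_cong_right) (auto simp: min_nilpotent_def)
  finally show ?thesis .
qed

lemma character_unit: "i \<in> {1..n} \<Longrightarrow> \<theta> n (matrix_unit n 0 i) = 1"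
  using matrix_unit_mm[of i n] by (simp add: character_mm cong: if_cong)

lemma character_add: "\<lbrakk>X \<in> mm n; Y \<in> mm n\<rbrakk> \<Longrightarrow> \<theta> n (X + Y) = \<theta> n X + \<theta> n Y"
  using matrix_lie_algebra.add_in[OF matrix_lie_algebra_mm, of X n Y] mm_carrier[of X n] mm_carrier[of Y n]
  by (simp add: character_mm sum.distrib)

lemma character_smult: "X \<in> mm n \<Longrightarrow> \<theta> n (c \<cdot>\<^sub>m X) = c * \<theta> n X"
  using matrix_lie_algebra.smult_in[OF matrix_lie_algebra_mm, of X n c] mm_carrier[of X n]
  by (simp add: character_mm sum_distrib_left)

section \<open>The Whittaker ideal of the enveloping algebra\<close>

locale special_linear =
  fixes n :: nat
begin

sublocale matrix_lie_algebra "sl n"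
  by (rule matrix_lie_algebra_sl)

sublocale mm: matrix_lie_algebra "mm n"
  by (rule matrix_lie_algebra_mm)

abbreviation e where "e \<equiv> matrix_unit n 0"

abbreviation x where "x i \<equiv> \<iota> (e i)"

lemma e_sl: "i \<in> {1..n} \<Longrightarrow> e i \<in> sl n"
  using matrix_unit_sl[of 0 i n] by auto

lemma e_mm: "i \<in> {1..n} \<Longrightarrow> e i \<in> mm n"
  using matrix_unit_mm[of i n] by auto

lemma x_closed: "i \<in> {1..n} \<Longrightarrow> x i \<in> carrier U"
  using e_sl by simp

lemma \<iota>_zero: "\<iota> (0\<^sub>m (n + 1) (n + 1)) = \<zero>\<^bsub>U\<^esub>"
proof -
  have "0\<^sub>m (n + 1) (n + 1) \<in> sl n" using zero_mm mm_sl by blast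
  moreover have "0\<^sub>m (n + 1) (n + 1) = (0::complex) \<cdot>\<^sub>m 0\<^sub>m (n + 1) (n + 1)" by auto
  ultimately show ?thesis using \<iota>_smult[of "0\<^sub>m (n + 1) (n + 1)" 0] by simp
qed

lemma mm_commute:
  assumes "X \<in> mm n" "Y \<in> mm n" shows "\<iota> X \<otimes>\<^bsub>U\<^esub> \<iota> Y = \<iota> Y \<otimes>\<^bsub>U\<^esub> \<iota> X"
  using \<iota>_bracket[of X Y] U.commutator_eq_zero_iff[of "\<iota> X" "\<iota> Y"] assms mm_bracket[of X n Y] mm_sl \<iota>_zero
  by simp

lemma x_commute: "\<lbrakk>i \<in> {1..n}; j \<in> {1..n}\<rbrakk> \<Longrightarrow> x i \<otimes>\<^bsub>U\<^esub> x j = x j \<otimes>\<^bsub>U\<^esub> x i"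
  using mm_commute e_mm by blast

definition I :: "enveloping set" where
  "I = left_ideal U ((\<lambda>i. x i \<ominus>\<^bsub>U\<^esub> \<one>\<^bsub>U\<^esub>) ` {1..n})"

lemma I_gens: "(\<lambda>i. x i \<ominus>\<^bsub>U\<^esub> \<one>\<^bsub>U\<^esub>) ` {1..n} \<subseteq> carrier U"
  using x_closed by auto

lemmas I_closed = U.left_ideal_closed[OF I_gens, folded I_def]
  and I_mult = U.left_ideal_mult[OF I_gens, folded I_def]
  and I_smult = U.left_ideal_smult[OF I_gens, folded I_def]
  and I_uminus = U.left_ideal_uminus[OF I_gens, folded I_def]
  and I_diff = U.left_ideal_diff[OF I_gens, folded I_def]
  and I_trans = U.left_ideal_trans[OF I_gens, folded I_def]
  and I_add = left_ideal.add[where A = U and G = "(\<lambda>i. x i \<ominus>\<^bsub>U\<^esub> \<one>\<^bsub>U\<^esub>) ` {1..n}", folded I_def]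
  and I_zero = left_ideal.zero[where A = U and G = "(\<lambda>i. x i \<ominus>\<^bsub>U\<^esub> \<one>\<^bsub>U\<^esub>) ` {1..n}", folded I_def]

lemma I_gen: "i \<in> {1..n} \<Longrightarrow> x i \<ominus>\<^bsub>U\<^esub> \<one>\<^bsub>U\<^esub> \<in> I"
  using left_ideal.gen[of "\<one>\<^bsub>U\<^esub>" U "x i \<ominus>\<^bsub>U\<^esub> \<one>\<^bsub>U\<^esub>"] x_closed by (simp add: I_def)

text \<open>
  The ideal is generated by \<open>x i - 1\<close> with \<open>1 = \<theta> n (e i)\<close>, and \<open>\<iota> X - \<theta> n X\<close> is linear in \<open>X\<close>.
\<close>

lemma mm_acts_by_character: "X \<in> mm n \<Longrightarrow> \<iota> X \<ominus>\<^bsub>U\<^esub> \<theta> n X \<odot>\<^bsub>U\<^esub> \<one>\<^bsub>U\<^esub> \<in> I"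
proof (induction rule: mm_induct)
  case zero
  have "\<theta> n (0\<^sub>m (n + 1) (n + 1)) = 0" using zero_mm[of n] by (simp add: character_mm)
  then show ?case using \<iota>_zero I_zero by (simp add: U.minus_eq)
next
  case (unit i)
  then show ?case using I_gen by (simp add: character_unit)
next
  case (add A B)
  have c: "\<iota> A \<in> carrier U" "\<iota> B \<in> carrier U" using add mm_sl by auto
  let ?a = "\<theta> n A \<odot>\<^bsub>U\<^esub> \<one>\<^bsub>U\<^esub>" and ?b = "\<theta> n B \<odot>\<^bsub>U\<^esub> \<one>\<^bsub>U\<^esub>"
  have "?a \<in> carrier U" "?b \<in> carrier U" by auto
  then have "(\<iota> A \<oplus>\<^bsub>U\<^esub> \<iota> B) \<ominus>\<^bsub>U\<^esub> (?a \<oplus>\<^bsub>U\<^esub> ?b) = (\<iota> A \<ominus>\<^bsub>U\<^esub> ?a) \<oplus>\<^bsub>U\<^esub> (\<iota> B \<ominus>\<^bsub>U\<^esub> ?b)"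
    using c by algebra
  moreover have "\<iota> (A + B) \<ominus>\<^bsub>U\<^esub> \<theta> n (A + B) \<odot>\<^bsub>U\<^esub> \<one>\<^bsub>U\<^esub> = (\<iota> A \<oplus>\<^bsub>U\<^esub> \<iota> B) \<ominus>\<^bsub>U\<^esub> (?a \<oplus>\<^bsub>U\<^esub> ?b)"
    using add mm_sl by (simp add: \<iota>_add character_add U.smult_add_left)
  ultimately show ?case using add I_add by simp
next
  case (smult c A)
  have "\<iota> (c \<cdot>\<^sub>m A) \<ominus>\<^bsub>U\<^esub> \<theta> n (c \<cdot>\<^sub>m A) \<odot>\<^bsub>U\<^esub> \<one>\<^bsub>U\<^esub> = c \<odot>\<^bsub>U\<^esub> (\<iota> A \<ominus>\<^bsub>U\<^esub> \<theta> n A \<odot>\<^bsub>U\<^esub> \<one>\<^bsub>U\<^esub>)"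
    using smult mm_sl
    by (simp add: \<iota>_smult character_smult U.smult_add_right U.smult_minus_right U.smult_smult U.minus_eq)
  then show ?case using smult I_smult by simp
qed

definition nilpotent_mod_I :: "nat \<Rightarrow> enveloping \<Rightarrow> bool" where
  "nilpotent_mod_I i u \<longleftrightarrow> (\<exists>N. ((\<lambda>v. (x i \<ominus>\<^bsub>U\<^esub> \<one>\<^bsub>U\<^esub>) \<otimes>\<^bsub>U\<^esub> v) ^^ N) u \<in> I)"

context
  fixes i assumes i: "i \<in> {1..n}"
begin

abbreviation y where "y \<equiv> x i \<ominus>\<^bsub>U\<^esub> \<one>\<^bsub>U\<^esub>"

abbreviation Y where "Y \<equiv> (\<lambda>v. y \<otimes>\<^bsub>U\<^esub> v)"

lemma y_closed: "y \<in> carrier U"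
  using x_closed[OF i] by simp

lemma Y_eq: "u \<in> carrier U \<Longrightarrow> Y u = x i \<otimes>\<^bsub>U\<^esub> u \<ominus>\<^bsub>U\<^esub> u"
  using x_closed[OF i] by (simp add: U.minus_eq U.l_distr U.l_minus)

lemma Y_pow_closed: "u \<in> carrier U \<Longrightarrow> (Y ^^ N) u \<in> carrier U"
  using y_closed by (induction N) auto

lemma Y_pow_I: "u \<in> I \<Longrightarrow> (Y ^^ N) u \<in> I"
  using y_closed I_mult by (induction N) auto

lemma Y_pow_add: "\<lbrakk>u \<in> carrier U; v \<in> carrier U\<rbrakk> \<Longrightarrow> (Y ^^ N) (u \<oplus>\<^bsub>U\<^esub> v) = (Y ^^ N) u \<oplus>\<^bsub>U\<^esub> (Y ^^ N) v"
  using y_closed Y_pow_closed by (induction N) (auto simp: U.r_distr)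

lemma Y_pow_smult: "u \<in> carrier U \<Longrightarrow> (Y ^^ N) (c \<odot>\<^bsub>U\<^esub> u) = c \<odot>\<^bsub>U\<^esub> (Y ^^ N) u"
  using y_closed Y_pow_closed by (induction N) (auto simp: U.smult_mult_right)

lemma nilpotent_I: "u \<in> I \<Longrightarrow> nilpotent_mod_I i u"
  unfolding nilpotent_mod_I_def by (rule exI[of _ 0]) simp

lemma nilpotent_add:
  assumes u: "u \<in> carrier U" "nilpotent_mod_I i u" and v: "v \<in> carrier U" "nilpotent_mod_I i v"
  shows "nilpotent_mod_I i (u \<oplus>\<^bsub>U\<^esub> v)"
proof -
  obtain M N where M: "(Y ^^ M) u \<in> I" and N: "(Y ^^ N) v \<in> I"
    using u v unfolding nilpotent_mod_I_def by blast
  have "(Y ^^ (N + M)) u \<in> I" using Y_pow_I[OF M, of N] by (simp add: funpow_add)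
  moreover have "(Y ^^ (N + M)) v \<in> I" using Y_pow_I[OF N, of M] by (simp add: funpow_add add.commute[of N])
  ultimately have "(Y ^^ (N + M)) (u \<oplus>\<^bsub>U\<^esub> v) \<in> I"
    using Y_pow_add[OF u(1) v(1), of "N + M"] I_add by simp
  then show ?thesis unfolding nilpotent_mod_I_def by blast
qed

lemma nilpotent_smult: "\<lbrakk>u \<in> carrier U; nilpotent_mod_I i u\<rbrakk> \<Longrightarrow> nilpotent_mod_I i (c \<odot>\<^bsub>U\<^esub> u)"
  unfolding nilpotent_mod_I_def using Y_pow_smult I_smult by metis

lemma nilpotent_Y: "nilpotent_mod_I i (Y u) \<Longrightarrow> nilpotent_mod_I i u"
proof -
  assume "nilpotent_mod_I i (Y u)"
  then obtain N where "(Y ^^ N) (Y u) \<in> I" unfolding nilpotent_mod_I_def by blast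
  then have "(Y ^^ Suc N) u \<in> I" by (simp add: funpow_swap1)
  then show ?thesis unfolding nilpotent_mod_I_def by blast
qed

text \<open>
  Since \<open>y a u = a y u + [x i, a] u\<close>, induction on the exponent that kills \<open>u\<close> transfers the
  property from \<open>[x i, a]\<close> to \<open>a\<close>.
\<close>

lemma nilpotent_mult_if_commutator:
  assumes a: "a \<in> carrier U"
    and comm: "\<And>u. \<lbrakk>u \<in> carrier U; nilpotent_mod_I i u\<rbrakk> \<Longrightarrow>
      nilpotent_mod_I i (commutator U (x i) a \<otimes>\<^bsub>U\<^esub> u)"
    and u: "u \<in> carrier U" "nilpotent_mod_I i u"
  shows "nilpotent_mod_I i (a \<otimes>\<^bsub>U\<^esub> u)"
proof -
  obtain N where "(Y ^^ N) u \<in> I" using u unfolding nilpotent_mod_I_def by blast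
  then show ?thesis
    using u(1)
  proof (induction N arbitrary: u)
    case 0
    then show ?case using a by (auto intro!: nilpotent_I I_mult)
  next
    case (Suc N)
    have Yu: "Y u \<in> carrier U" "(Y ^^ N) (Y u) \<in> I"
      using Suc.prems y_closed by (auto simp: funpow_swap1)
    have "nilpotent_mod_I i u" using Suc.prems unfolding nilpotent_mod_I_def by blast
    then have "nilpotent_mod_I i (a \<otimes>\<^bsub>U\<^esub> Y u \<oplus>\<^bsub>U\<^esub> commutator U (x i) a \<otimes>\<^bsub>U\<^esub> u)"
      using Suc Yu a comm x_closed[OF i] by (intro nilpotent_add) auto
    also have "a \<otimes>\<^bsub>U\<^esub> Y u \<oplus>\<^bsub>U\<^esub> commutator U (x i) a \<otimes>\<^bsub>U\<^esub> u = Y (a \<otimes>\<^bsub>U\<^esub> u)"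
      unfolding commutator_def Y_eq[OF Suc.prems(2)] Y_eq[OF U.m_closed[OF a Suc.prems(2)]]
      using a Suc.prems(2) x_closed[OF i] by algebra
    finally show ?case by (rule nilpotent_Y)
  qed
qed

lemma nilpotent_zero_mult: "u \<in> carrier U \<Longrightarrow> nilpotent_mod_I i (\<zero>\<^bsub>U\<^esub> \<otimes>\<^bsub>U\<^esub> u)"
  using nilpotent_I[OF I_zero] by simp

text \<open>
  The third bracket of \<open>X\<close> with \<open>e i\<close> vanishes, and the transfer from a commutator is applied three
  times on the way back to \<open>X\<close>.
\<close>

lemma nilpotent_mult_\<iota>:
  assumes X: "X \<in> sl n" and u: "u \<in> carrier U" "nilpotent_mod_I i u"
  shows "nilpotent_mod_I i (\<iota> X \<otimes>\<^bsub>U\<^esub> u)"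
proof -
  note e = e_sl[OF i]
  define X1 where "X1 = lie_bracket (e i) X"
  define X2 where "X2 = lie_bracket (e i) X1"
  have X1: "X1 \<in> sl n" unfolding X1_def using e X by (rule bracket_in)
  have X2: "X2 \<in> sl n" unfolding X2_def using e X1 by (rule bracket_in)
  have c1: "commutator U (x i) (\<iota> X) = \<iota> X1" unfolding X1_def using \<iota>_bracket[OF e X] .
  have c2: "commutator U (x i) (\<iota> X1) = \<iota> X2" unfolding X2_def using \<iota>_bracket[OF e X1] .
  have "X2 = (- 2 * X $$ (i, 0)) \<cdot>\<^sub>m e i"
    unfolding X2_def X1_def by (rule bracket_unit_twice[OF sl_carrier[OF X] i])
  then have "commutator U (x i) (\<iota> X2) = (- 2 * X $$ (i, 0)) \<odot>\<^bsub>U\<^esub> commutator U (x i) (x i)"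
    using \<iota>_smult[OF e] U.commutator_smult_right[OF x_closed[OF i] x_closed[OF i]] by simp
  then have c3: "commutator U (x i) (\<iota> X2) = \<zero>\<^bsub>U\<^esub>"
    using x_closed[OF i] by (simp add: commutator_def)
  have 2: "nilpotent_mod_I i (\<iota> X2 \<otimes>\<^bsub>U\<^esub> u)" if "u \<in> carrier U" "nilpotent_mod_I i u" for u
    by (rule nilpotent_mult_if_commutator) (simp_all add: that X2 c3 nilpotent_zero_mult del: U.l_null)
  have 1: "nilpotent_mod_I i (\<iota> X1 \<otimes>\<^bsub>U\<^esub> u)" if "u \<in> carrier U" "nilpotent_mod_I i u" for u
    by (rule nilpotent_mult_if_commutator) (simp_all add: that X1 c2 2)
  show ?thesis
    by (rule nilpotent_mult_if_commutator) (simp_all add: u X c1 1)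
qed

lemma nilpotent_all: "u \<in> carrier U \<Longrightarrow> nilpotent_mod_I i u"
proof (induction rule: U_induct)
  case one
  have "Y \<one>\<^bsub>U\<^esub> \<in> I" using I_gen[OF i] y_closed by simp
  then show ?case using nilpotent_Y nilpotent_I by blast
qed (use nilpotent_mult_\<iota> nilpotent_add nilpotent_smult in auto)

text \<open>
  The identity \<open>u = x i u - y u\<close> reduces injectivity and surjectivity of \<open>x i\<close> modulo \<open>I\<close> from \<open>u\<close> to
  \<open>y u\<close>, so induction on the exponent applies.
\<close>

lemma x_injective_mod_I:
  assumes u: "u \<in> carrier U" and xu: "x i \<otimes>\<^bsub>U\<^esub> u \<in> I"
  shows "u \<in> I"
proof -
  obtain N where "(Y ^^ N) u \<in> I" using nilpotent_all[OF u] unfolding nilpotent_mod_I_def by blast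
  then show ?thesis
    using u xu
  proof (induction N arbitrary: u)
    case (Suc N)
    note xi = x_closed[OF i]
    have "x i \<otimes>\<^bsub>U\<^esub> Y u = Y (x i \<otimes>\<^bsub>U\<^esub> u)"
      unfolding Y_eq[OF Suc.prems(2)] Y_eq[OF U.m_closed[OF xi Suc.prems(2)]]
      using xi Suc.prems(2) by algebra
    then have "x i \<otimes>\<^bsub>U\<^esub> Y u \<in> I" using I_mult[OF Suc.prems(3) y_closed] by simp
    moreover have "(Y ^^ N) (Y u) \<in> I" using Suc.prems(1) by (simp add: funpow_swap1)
    ultimately have "Y u \<in> I" using Suc.IH y_closed Suc.prems(2) by simp
    then have "x i \<otimes>\<^bsub>U\<^esub> u \<ominus>\<^bsub>U\<^esub> Y u \<in> I" using I_diff Suc.prems(3) by blast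
    also have "x i \<otimes>\<^bsub>U\<^esub> u \<ominus>\<^bsub>U\<^esub> Y u = u"
      unfolding Y_eq[OF Suc.prems(2)] using xi Suc.prems(2) by algebra
    finally show ?case .
  qed simp
qed

lemma x_surjective_mod_I:
  assumes u: "u \<in> carrier U"
  shows "\<exists>v\<in>carrier U. u \<ominus>\<^bsub>U\<^esub> x i \<otimes>\<^bsub>U\<^esub> v \<in> I"
proof -
  obtain N where "(Y ^^ N) u \<in> I" using nilpotent_all[OF u] unfolding nilpotent_mod_I_def by blast
  then show ?thesis
    using u
  proof (induction N arbitrary: u)
    case 0
    then show ?case
      using x_closed[OF i] by (intro bexI[of _ "\<zero>\<^bsub>U\<^esub>"]) (auto simp: U.minus_eq)
  next
    case (Suc N)
    note xi = x_closed[OF i]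
    have "(Y ^^ N) (Y u) \<in> I" using Suc.prems(1) by (simp add: funpow_swap1)
    then obtain v where v: "v \<in> carrier U" "Y u \<ominus>\<^bsub>U\<^esub> x i \<otimes>\<^bsub>U\<^esub> v \<in> I"
      using Suc.IH[of "Y u"] y_closed Suc.prems by auto
    have "u \<ominus>\<^bsub>U\<^esub> x i \<otimes>\<^bsub>U\<^esub> (u \<ominus>\<^bsub>U\<^esub> v) = \<ominus>\<^bsub>U\<^esub> (Y u \<ominus>\<^bsub>U\<^esub> x i \<otimes>\<^bsub>U\<^esub> v)"
      unfolding Y_eq[OF Suc.prems(2)] using xi Suc.prems(2) v(1) by algebra
    then show ?case
      using I_uminus[OF v(2)] v(1) Suc.prems(2) by (intro bexI[of _ "u \<ominus>\<^bsub>U\<^esub> v"]) auto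
  qed
qed

end

definition S :: "enveloping set" where "S = denominators n"

lemma S_eq: "S = range (\<lambda>k. ordered_product U (\<lambda>j. x j [^]\<^bsub>U\<^esub> (k j :: nat)) [1..<n + 1])"
  unfolding S_def denominators_def ordered_product_def by auto

lemma S_mult: "\<lbrakk>s \<in> S; t \<in> S\<rbrakk> \<Longrightarrow> s \<otimes>\<^bsub>U\<^esub> t \<in> S"
proof -
  assume "s \<in> S" "t \<in> S"
  then obtain k l where kl: "s = ordered_product U (\<lambda>j. x j [^]\<^bsub>U\<^esub> (k j :: nat)) [1..<n + 1]"
    "t = ordered_product U (\<lambda>j. x j [^]\<^bsub>U\<^esub> (l j :: nat)) [1..<n + 1]"
    unfolding S_eq by blast
  have comm: "x i [^]\<^bsub>U\<^esub> (a::nat) \<otimes>\<^bsub>U\<^esub> x j [^]\<^bsub>U\<^esub> (b::nat) = x j [^]\<^bsub>U\<^esub> b \<otimes>\<^bsub>U\<^esub> x i [^]\<^bsub>U\<^esub> a"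
    if "i \<in> {1..n}" "j \<in> {1..n}" for i j a b
  proof -
    have "x j \<otimes>\<^bsub>U\<^esub> x i [^]\<^bsub>U\<^esub> a = x i [^]\<^bsub>U\<^esub> a \<otimes>\<^bsub>U\<^esub> x j"
      using U.group_commutes_pow[of "x i" "x j" a] x_commute that x_closed by simp
    then show ?thesis
      using U.group_commutes_pow[of "x j" "x i [^]\<^bsub>U\<^esub> a" b] that x_closed by simp
  qed
  have "s \<otimes>\<^bsub>U\<^esub> t = ordered_product U (\<lambda>j. x j [^]\<^bsub>U\<^esub> k j \<otimes>\<^bsub>U\<^esub> x j [^]\<^bsub>U\<^esub> l j) [1..<n + 1]"
    unfolding kl using x_closed comm by (intro U.ordered_product_mult) auto
  also have "\<dots> = ordered_product U (\<lambda>j. x j [^]\<^bsub>U\<^esub> (k j + l j)) [1..<n + 1]"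
    by (intro ordered_product_cong) (use x_closed U.nat_pow_mult in auto)
  finally show ?thesis unfolding S_eq by (rule range_eqI[where x = "\<lambda>j. k j + l j"])
qed

lemma S_one: "\<one>\<^bsub>U\<^esub> \<in> S"
proof -
  have "ordered_product U (\<lambda>j. x j [^]\<^bsub>U\<^esub> (0::nat)) js = \<one>\<^bsub>U\<^esub>" for js
    by (induction js) auto
  then show ?thesis unfolding S_eq by (intro image_eqI[of _ _ "\<lambda>_. 0"]) auto
qed

lemma S_x: "i \<in> {1..n} \<Longrightarrow> x i \<in> S"
proof -
  assume i: "i \<in> {1..n}"
  have "x i = ordered_product U (\<lambda>j. if j = i then x i else \<one>\<^bsub>U\<^esub>) [1..<n + 1]"
    using i x_closed by (intro U.ordered_product_single[symmetric]) auto
  also have "\<dots> = ordered_product U (\<lambda>j. x j [^]\<^bsub>U\<^esub> (if j = i then 1 else 0 :: nat)) [1..<n + 1]"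
    using i x_closed by (intro ordered_product_cong) auto
  finally show ?thesis
    unfolding S_eq by (rule range_eqI[where x = "\<lambda>j. if j = i then 1 else 0"])
qed

text \<open>
  Denominators are built from the \<open>x i\<close> by left multiplication.  Membership in the carrier is part of
  the conclusion because the induction needs it.
\<close>

lemma S_induct [consumes 1, case_names one mult]:
  assumes "s \<in> S" and one: "P \<one>\<^bsub>U\<^esub>"
    and mult: "\<And>i t. \<lbrakk>i \<in> {1..n}; t \<in> carrier U; P t\<rbrakk> \<Longrightarrow> P (x i \<otimes>\<^bsub>U\<^esub> t)"
  shows "s \<in> carrier U \<and> P s"
proof -
  have pow: "x i [^]\<^bsub>U\<^esub> m \<otimes>\<^bsub>U\<^esub> t \<in> carrier U \<and> P (x i [^]\<^bsub>U\<^esub> m \<otimes>\<^bsub>U\<^esub> t)"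
    if i: "i \<in> {1..n}" and t: "t \<in> carrier U" "P t" for i t and m :: nat
    using t
  proof (induction m arbitrary: t)
    case (Suc m)
    then show ?case
      using mult[OF i] x_closed[OF i] Suc.IH[of "x i \<otimes>\<^bsub>U\<^esub> t"] by (simp add: U.m_assoc)
  qed simp
  have "ordered_product U (\<lambda>j. x j [^]\<^bsub>U\<^esub> (k j :: nat)) js \<in> carrier U \<and>
      P (ordered_product U (\<lambda>j. x j [^]\<^bsub>U\<^esub> (k j :: nat)) js)"
    if "set js \<subseteq> {1..n}" for js k
    using that by (induction js) (use one pow in auto)
  moreover have "set [1..<n + 1] \<subseteq> {1..n}" by auto
  ultimately show ?thesis
    using assms(1) unfolding S_eq by (auto simp del: upt_Suc)
qed

lemma S_closed: "s \<in> S \<Longrightarrow> s \<in> carrier U"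
  using S_induct[of s "\<lambda>_. True"] by simp

lemma S_commute: "\<lbrakk>s \<in> S; t \<in> S\<rbrakk> \<Longrightarrow> s \<otimes>\<^bsub>U\<^esub> t = t \<otimes>\<^bsub>U\<^esub> s"
proof -
  have *: "s \<otimes>\<^bsub>U\<^esub> v = v \<otimes>\<^bsub>U\<^esub> s"
    if s: "s \<in> S" and v: "v \<in> carrier U" "\<And>i. i \<in> {1..n} \<Longrightarrow> x i \<otimes>\<^bsub>U\<^esub> v = v \<otimes>\<^bsub>U\<^esub> x i" for s v
  proof -
    have "s \<in> carrier U \<and> s \<otimes>\<^bsub>U\<^esub> v = v \<otimes>\<^bsub>U\<^esub> s"
      using s
    proof (induction rule: S_induct)
      case (mult i t)
      have "x i \<otimes>\<^bsub>U\<^esub> t \<otimes>\<^bsub>U\<^esub> v = x i \<otimes>\<^bsub>U\<^esub> v \<otimes>\<^bsub>U\<^esub> t"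
        using mult x_closed v(1) by (simp add: U.m_assoc)
      also have "\<dots> = v \<otimes>\<^bsub>U\<^esub> (x i \<otimes>\<^bsub>U\<^esub> t)"
        using mult x_closed v(1) by (simp add: v(2) U.m_assoc)
      finally show ?case .
    qed (use v in simp)
    then show ?thesis by simp
  qed
  assume s: "s \<in> S" and t: "t \<in> S"
  show ?thesis
    by (rule *[OF s S_closed[OF t]], rule *[OF t x_closed, symmetric]) (simp_all add: x_commute)
qed

lemma S_injective_mod_I: "\<lbrakk>s \<in> S; u \<in> carrier U; s \<otimes>\<^bsub>U\<^esub> u \<in> I\<rbrakk> \<Longrightarrow> u \<in> I"
proof -
  assume s: "s \<in> S" and u: "u \<in> carrier U" "s \<otimes>\<^bsub>U\<^esub> u \<in> I"
  have "s \<in> carrier U \<and> (\<forall>u\<in>carrier U. s \<otimes>\<^bsub>U\<^esub> u \<in> I \<longrightarrow> u \<in> I)"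
    using s
  proof (induction rule: S_induct)
    case (mult i t)
    show ?case
    proof (intro ballI impI)
      fix u assume u: "u \<in> carrier U" "x i \<otimes>\<^bsub>U\<^esub> t \<otimes>\<^bsub>U\<^esub> u \<in> I"
      then have "x i \<otimes>\<^bsub>U\<^esub> (t \<otimes>\<^bsub>U\<^esub> u) \<in> I"
        using U.m_assoc[OF x_closed[OF mult(1)] mult(2) u(1)] by simp
      then have "t \<otimes>\<^bsub>U\<^esub> u \<in> I"
        by (rule x_injective_mod_I[OF mult(1) U.m_closed[OF mult(2) u(1)]])
      then show "u \<in> I" using mult(3) u(1) by blast
    qed
  qed simp
  then show ?thesis using u by blast
qed

lemma S_surjective_mod_I: "\<lbrakk>s \<in> S; u \<in> carrier U\<rbrakk> \<Longrightarrow> \<exists>v\<in>carrier U. u \<ominus>\<^bsub>U\<^esub> s \<otimes>\<^bsub>U\<^esub> v \<in> I"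
proof -
  assume s: "s \<in> S" and u: "u \<in> carrier U"
  have "s \<in> carrier U \<and> (\<forall>u\<in>carrier U. \<exists>v\<in>carrier U. u \<ominus>\<^bsub>U\<^esub> s \<otimes>\<^bsub>U\<^esub> v \<in> I)"
    using s
  proof (induction rule: S_induct)
    case one
    show ?case using I_zero by (intro ballI bexI) auto
  next
    case (mult i t)
    show ?case
    proof
      fix u assume u: "u \<in> carrier U"
      obtain v where v: "v \<in> carrier U" "u \<ominus>\<^bsub>U\<^esub> x i \<otimes>\<^bsub>U\<^esub> v \<in> I"
        using x_surjective_mod_I[OF mult(1) u] by blast
      obtain w where w: "w \<in> carrier U" "v \<ominus>\<^bsub>U\<^esub> t \<otimes>\<^bsub>U\<^esub> w \<in> I"
        using mult(3) v(1) by blast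
      note xi = x_closed[OF mult(1)]
      have "x i \<otimes>\<^bsub>U\<^esub> (v \<ominus>\<^bsub>U\<^esub> t \<otimes>\<^bsub>U\<^esub> w) = x i \<otimes>\<^bsub>U\<^esub> v \<ominus>\<^bsub>U\<^esub> x i \<otimes>\<^bsub>U\<^esub> t \<otimes>\<^bsub>U\<^esub> w"
        using xi v w mult(2) by (simp add: U.minus_eq U.r_distr U.r_minus U.m_assoc)
      then have "x i \<otimes>\<^bsub>U\<^esub> v \<ominus>\<^bsub>U\<^esub> x i \<otimes>\<^bsub>U\<^esub> t \<otimes>\<^bsub>U\<^esub> w \<in> I"
        using I_mult[OF w(2) xi] by simp
      then show "\<exists>w\<in>carrier U. u \<ominus>\<^bsub>U\<^esub> x i \<otimes>\<^bsub>U\<^esub> t \<otimes>\<^bsub>U\<^esub> w \<in> I"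
        using I_trans[OF v(2)] u v w xi mult(2) by (intro bexI[of _ w]) auto
    qed
  qed
  then show ?thesis using u by blast
qed

end

section \<open>The module \<open>Q\<close> as a quotient of the enveloping algebra\<close>

lemma linear_span_submodule:
  assumes "Module.module complex_alg V" "X \<subseteq> carrier V"
  shows "submodule (linear_span V X) complex_alg V"
proof -
  interpret Module.module complex_alg V by fact
  have top: "submodule (carrier V) complex_alg V" by (rule submoduleI) auto
  show ?thesis
  proof (rule submoduleI)
    show "linear_span V X \<subseteq> carrier V"
      unfolding linear_span_def using top assms(2) by blast
    show "\<zero>\<^bsub>V\<^esub> \<in> linear_span V X"
      unfolding linear_span_def using submodule.axioms(1) subgroup.one_closed by fastforce
    show "\<ominus>\<^bsub>V\<^esub> a \<in> linear_span V X" if "a \<in> linear_span V X" for a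
      using that submoduleE(3) unfolding linear_span_def by blast
    show "a \<oplus>\<^bsub>V\<^esub> b \<in> linear_span V X" if "a \<in> linear_span V X" "b \<in> linear_span V X" for a b
      using that submoduleE(5) unfolding linear_span_def by blast
    show "c \<odot>\<^bsub>V\<^esub> a \<in> linear_span V X" if "c \<in> carrier complex_alg" "a \<in> linear_span V X" for c a
      using that submoduleE(4) unfolding linear_span_def by blast
  qed
qed

lemma linear_span_incl: "X \<subseteq> linear_span V X"
  by (auto simp: linear_span_def)

lemma linear_span_free_space_induct [consumes 1, case_names subset gen zero add scale]:
  assumes p: "p \<in> linear_span (free_space X) R" and R: "R \<subseteq> carrier (free_space X)"
    and gen: "\<And>r. r \<in> R \<Longrightarrow> P r" and zero: "P 0"
    and add: "\<And>p q. \<lbrakk>p \<in> carrier (free_space X); q \<in> carrier (free_space X); P p; P q\<rbrakk> \<Longrightarrow> P (p + q)"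
    and scale: "\<And>c p. \<lbrakk>p \<in> carrier (free_space X); P p\<rbrakk> \<Longrightarrow> P (Poly_Mapping.map ((*) c) p)"
  shows "P p"
proof -
  interpret Module.module complex_alg "free_space X" by (rule module_free_space)
  let ?H = "{p \<in> carrier (free_space X). P p}"
  have "submodule ?H complex_alg (free_space X)"
  proof (rule submoduleI)
    fix p assume p: "p \<in> ?H"
    have "Poly_Mapping.map ((*) (- 1)) p = - p" by (rule poly_mapping_eqI) simp
    moreover have "\<ominus>\<^bsub>free_space X\<^esub> p = - p"
      using minus_free_space[of 0 X p] p by (simp add: M.minus_eq)
    ultimately show "\<ominus>\<^bsub>free_space X\<^esub> p \<in> ?H"
      using scale[of p "- 1"] p by (simp add: keys_uminus)
  next
    fix p q assume "p \<in> ?H" "q \<in> ?H"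
    then show "p \<oplus>\<^bsub>free_space X\<^esub> q \<in> ?H" using add[of p q] keys_add_subset[of p X q] by simp
  next
    fix c p assume "p \<in> ?H"
    then show "c \<odot>\<^bsub>free_space X\<^esub> p \<in> ?H" using scale[of p c] keys_scale_subset[of p X c] by simp
  qed (use zero in auto)
  moreover have "R \<subseteq> ?H" using R gen by blast
  ultimately have "linear_span (free_space X) R \<subseteq> ?H"
    unfolding linear_span_def by blast
  then show ?thesis using p by blast
qed

lemma push_forward_add: "push_forward f (p + q) = push_forward f p + push_forward f q"
  unfolding push_forward_def
  by (rule setsum_keys_plus_distrib[of "\<lambda>x c. Poly_Mapping.single (f x) c"]) (auto simp: single_add)

lemma push_forward_single: "push_forward f (Poly_Mapping.single x c) = Poly_Mapping.single (f x) c"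
  by (cases "c = 0") (simp_all add: push_forward_def)

lemma push_forward_zero: "push_forward f 0 = 0"
  by (simp add: push_forward_def)

lemma push_forward_scale:
  "push_forward f (Poly_Mapping.map ((*) c) p) = Poly_Mapping.map ((*) c) (push_forward f p)"
proof -
  have "Poly_Mapping.keys p \<subseteq> UNIV" by simp
  then show ?thesis
    by (induction rule: poly_mapping_keys_induct)
      (simp_all add: push_forward_zero scale_zero_right scale_add_right push_forward_add
        push_forward_single)
qed

lemma push_forward_diff: "push_forward f (p - q) = push_forward f p - push_forward f (q :: _ \<Rightarrow>\<^sub>0 complex)"
  using push_forward_add[of f "p - q" q] by simp

lemma keys_push_forward:
  "Poly_Mapping.keys p \<subseteq> X \<Longrightarrow> Poly_Mapping.keys (push_forward f p) \<subseteq> f ` X"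
proof (induction rule: poly_mapping_keys_induct)
  case (single_add x c q)
  then show ?case
    unfolding push_forward_add push_forward_single by (intro keys_add_subset keys_single_subset) auto
qed (simp add: push_forward_zero)

context special_linear
begin

abbreviation R where "R \<equiv> carrier (enveloping_algebra (mm n))"

abbreviation incl :: "enveloping \<Rightarrow> enveloping" where "incl \<equiv> enveloping_lift U \<iota>"

abbreviation char :: "enveloping \<Rightarrow> complex" where "char \<equiv> enveloping_lift complex_alg (\<theta> n)"

lemma incl_hom: "incl \<in> algebra_hom mm.U U"
  and incl_\<iota>: "X \<in> mm n \<Longrightarrow> incl (mm.\<iota> X) = \<iota> X"
  using mm.enveloping_lift_hom[OF U_algebra, of \<iota>] mm_sl \<iota>_add \<iota>_smult \<iota>_bracket
  by (auto simp: image_subset_iff)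

lemma char_hom: "char \<in> algebra_hom mm.U complex_alg"
  and char_\<iota>: "X \<in> mm n \<Longrightarrow> char (mm.\<iota> X) = \<theta> n X"
proof -
  interpret C: assoc_algebra complex_alg by (rule assoc_algebra.intro[OF complex_algebra_complex_alg])
  have zero: "\<theta> n (0\<^sub>m (n + 1) (n + 1)) = 0" using zero_mm[of n] by (simp add: character_mm)
  have comm: "commutator complex_alg a b = 0" for a b
    using C.commutator_eq_zero_iff[of a b] by (simp add: mult.commute)
  show "char \<in> algebra_hom mm.U complex_alg"
    and "X \<in> mm n \<Longrightarrow> char (mm.\<iota> X) = \<theta> n X"
    using mm.enveloping_lift_hom[OF complex_algebra_complex_alg, of "\<theta> n"]
      mm_bracket zero comm by (simp_all add: character_add character_smult)
qed

lemmas incl = algebra_homD[OF incl_hom] and char = algebra_homD[OF char_hom, simplified]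

text \<open>
  By induction on words:
  \<open>\<iota> X r - \<theta>(X) \<chi>(r) = \<iota> X (r - \<chi>(r)) + \<chi>(r) (\<iota> X - \<theta>(X))\<close>, where \<open>\<chi>\<close> extends \<open>\<theta>\<close> to the
  enveloping algebra.  This is what the balancing relation of the tensor product amounts to.
\<close>

lemma incl_minus_char: "r \<in> R \<Longrightarrow> incl r \<ominus>\<^bsub>U\<^esub> char r \<odot>\<^bsub>U\<^esub> \<one>\<^bsub>U\<^esub> \<in> I"
proof (induction rule: mm.U_induct)
  case one
  then show ?case using I_zero by (simp add: incl char)
next
  case (mult X r)
  have c: "\<iota> X \<in> carrier U" "incl r \<in> carrier U" using mult mm_sl incl(1) by auto
  have "incl (mm.\<iota> X \<otimes>\<^bsub>mm.U\<^esub> r) \<ominus>\<^bsub>U\<^esub> char (mm.\<iota> X \<otimes>\<^bsub>mm.U\<^esub> r) \<odot>\<^bsub>U\<^esub> \<one>\<^bsub>U\<^esub>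
      = \<iota> X \<otimes>\<^bsub>U\<^esub> incl r \<ominus>\<^bsub>U\<^esub> (char r * \<theta> n X) \<odot>\<^bsub>U\<^esub> \<one>\<^bsub>U\<^esub>"
    using mult by (simp add: incl(2) char(2) incl_\<iota> char_\<iota> mult.commute)
  also have "\<dots> = (\<iota> X \<otimes>\<^bsub>U\<^esub> incl r \<ominus>\<^bsub>U\<^esub> char r \<odot>\<^bsub>U\<^esub> \<iota> X)
      \<oplus>\<^bsub>U\<^esub> (char r \<odot>\<^bsub>U\<^esub> \<iota> X \<ominus>\<^bsub>U\<^esub> (char r * \<theta> n X) \<odot>\<^bsub>U\<^esub> \<one>\<^bsub>U\<^esub>)"
  proof -
    have "\<iota> X \<otimes>\<^bsub>U\<^esub> incl r \<in> carrier U" "char r \<odot>\<^bsub>U\<^esub> \<iota> X \<in> carrier U"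
      "(char r * \<theta> n X) \<odot>\<^bsub>U\<^esub> \<one>\<^bsub>U\<^esub> \<in> carrier U" using c by auto
    then show ?thesis by algebra
  qed
  also have "\<dots> = \<iota> X \<otimes>\<^bsub>U\<^esub> (incl r \<ominus>\<^bsub>U\<^esub> char r \<odot>\<^bsub>U\<^esub> \<one>\<^bsub>U\<^esub>)
      \<oplus>\<^bsub>U\<^esub> char r \<odot>\<^bsub>U\<^esub> (\<iota> X \<ominus>\<^bsub>U\<^esub> \<theta> n X \<odot>\<^bsub>U\<^esub> \<one>\<^bsub>U\<^esub>)"
    using c by (simp add: U.minus_eq U.r_distr U.r_minus U.smult_mult_right U.smult_add_right
        U.smult_minus_right U.smult_smult)
  finally show ?case
    using I_add[OF I_mult[OF mult.IH c(1)] I_smult[OF mm_acts_by_character[OF mult(1)]]] by simp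
next
  case (add r s)
  have c: "incl r \<in> carrier U" "incl s \<in> carrier U" using add incl(1) by auto
  have "(incl r \<oplus>\<^bsub>U\<^esub> incl s) \<ominus>\<^bsub>U\<^esub> (char r \<odot>\<^bsub>U\<^esub> \<one>\<^bsub>U\<^esub> \<oplus>\<^bsub>U\<^esub> char s \<odot>\<^bsub>U\<^esub> \<one>\<^bsub>U\<^esub>)
    = (incl r \<ominus>\<^bsub>U\<^esub> char r \<odot>\<^bsub>U\<^esub> \<one>\<^bsub>U\<^esub>) \<oplus>\<^bsub>U\<^esub> (incl s \<ominus>\<^bsub>U\<^esub> char s \<odot>\<^bsub>U\<^esub> \<one>\<^bsub>U\<^esub>)"
    using c U.smult_closed'[OF U.one_closed, of "char r"] U.smult_closed'[OF U.one_closed, of "char s"]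
    by algebra
  then show ?case
    using I_add[OF add.IH] add by (simp add: incl(3) char(3) U.smult_add_left)
next
  case (smult c r)
  have "c \<odot>\<^bsub>U\<^esub> (incl r \<ominus>\<^bsub>U\<^esub> char r \<odot>\<^bsub>U\<^esub> \<one>\<^bsub>U\<^esub>) = c \<odot>\<^bsub>U\<^esub> incl r \<ominus>\<^bsub>U\<^esub> (c * char r) \<odot>\<^bsub>U\<^esub> \<one>\<^bsub>U\<^esub>"
    using smult incl(1) by (simp add: U.minus_eq U.smult_add_right U.smult_minus_right U.smult_smult)
  then show ?case
    using I_smult[OF smult.IH, of c] smult by (simp add: incl(4) char(4))
qed

definition pairs :: "(enveloping \<times> complex) set" where "pairs = carrier U \<times> UNIV"

definition relations :: "(enveloping \<times> complex \<Rightarrow>\<^sub>0 complex) set" where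
  "relations = tensor_relations R U (right_action n) complex_alg (character_action n)"

definition K :: "(enveloping \<times> complex \<Rightarrow>\<^sub>0 complex) set" where
  "K = tensor_kernel R U (right_action n) complex_alg (character_action n)"

abbreviation b :: "enveloping \<Rightarrow> complex \<Rightarrow> (enveloping \<times> complex \<Rightarrow>\<^sub>0 complex)" where
  "b u c \<equiv> Poly_Mapping.single (u, c) 1"

lemma K_eq: "K = linear_span (free_space pairs) relations"
  by (simp add: K_def tensor_kernel_def pairs_def relations_def)

lemma Q_eq: "Q_module n = quotient_module (free_space pairs) K"
  by (simp add: Q_module_def tensor_product_def K_def pairs_def)

lemma relationsE [consumes 1, case_names add_left add_right scale_left scale_right balanced]:
  assumes "r \<in> relations"
  obtains u v c where "u \<in> carrier U" "v \<in> carrier U" "r = b (u \<oplus>\<^bsub>U\<^esub> v) c - (b u c + b v c)"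
  | u c d where "u \<in> carrier U" "r = b u (c + d) - (b u c + b u d)"
  | a u c where "u \<in> carrier U" "r = b (a \<odot>\<^bsub>U\<^esub> u) c - Poly_Mapping.map ((*) a) (b u c)"
  | a u c where "u \<in> carrier U" "r = b u (a * c) - Poly_Mapping.map ((*) a) (b u c)"
  | u t c where "u \<in> carrier U" "t \<in> R" "r = b (u \<otimes>\<^bsub>U\<^esub> incl t) c - b u (char t * c)"
  using assms unfolding relations_def tensor_relations_def Let_def right_action_def character_action_def
    complex_alg_simps Un_iff mem_Collect_eq
  by (elim disjE exE conjE) (rule that; assumption)+

lemma relationsI:
  "\<lbrakk>u \<in> carrier U; v \<in> carrier U\<rbrakk> \<Longrightarrow> b (u \<oplus>\<^bsub>U\<^esub> v) c - (b u c + b v c) \<in> relations"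
  "u \<in> carrier U \<Longrightarrow> b (a \<odot>\<^bsub>U\<^esub> u) c - Poly_Mapping.map ((*) a) (b u c) \<in> relations"
  "u \<in> carrier U \<Longrightarrow> b u (a * c) - Poly_Mapping.map ((*) a) (b u c) \<in> relations"
  "u \<in> carrier U \<Longrightarrow> b u (c + d) - (b u c + b u d) \<in> relations"
  "\<lbrakk>u \<in> carrier U; t \<in> R\<rbrakk> \<Longrightarrow> b (u \<otimes>\<^bsub>U\<^esub> incl t) c - b u (char t * c) \<in> relations"
proof -
  note defs = relations_def tensor_relations_def Let_def right_action_def character_action_def
    complex_alg_simps Un_iff mem_Collect_eq
  show "b (u \<oplus>\<^bsub>U\<^esub> v) c - (b u c + b v c) \<in> relations" if "u \<in> carrier U" "v \<in> carrier U"
    unfolding defs by (rule disjI1, rule disjI1, rule disjI1, rule disjI1) (use that in blast)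
  show "b u (c + d) - (b u c + b u d) \<in> relations" if "u \<in> carrier U"
    unfolding defs by (rule disjI1, rule disjI1, rule disjI1, rule disjI2) (use that in blast)
  show "b (a \<odot>\<^bsub>U\<^esub> u) c - Poly_Mapping.map ((*) a) (b u c) \<in> relations" if "u \<in> carrier U"
    unfolding defs by (rule disjI1, rule disjI1, rule disjI2) (use that in blast)
  show "b u (a * c) - Poly_Mapping.map ((*) a) (b u c) \<in> relations" if "u \<in> carrier U"
    unfolding defs by (rule disjI1, rule disjI2) (use that in blast)
  show "b (u \<otimes>\<^bsub>U\<^esub> incl t) c - b u (char t * c) \<in> relations" if "u \<in> carrier U" "t \<in> R"
    unfolding defs by (rule disjI2) (use that in blast)
qed

lemma b_pairs: "u \<in> carrier U \<Longrightarrow> Poly_Mapping.keys (b u c) \<subseteq> pairs"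
  by (simp add: pairs_def)

lemma relations_subset: "relations \<subseteq> carrier (free_space pairs)"
proof
  fix r assume "r \<in> relations"
  then have "Poly_Mapping.keys r \<subseteq> pairs"
  proof (cases rule: relationsE)
    case (add_left u v c)
    show ?thesis unfolding add_left(3)
      by (intro keys_diff_subset keys_add_subset b_pairs U.a_closed add_left(1,2))
  next
    case (add_right u c d)
    show ?thesis unfolding add_right(2)
      by (intro keys_diff_subset keys_add_subset b_pairs add_right(1))
  next
    case (scale_left a u c)
    show ?thesis unfolding scale_left(2)
      by (intro keys_diff_subset keys_scale_subset b_pairs U.smult_closed' scale_left(1))
  next
    case (scale_right a u c)
    show ?thesis unfolding scale_right(2)
      by (intro keys_diff_subset keys_scale_subset b_pairs scale_right(1))
  next
    case (balanced u t c)
    show ?thesis unfolding balanced(3)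
      by (intro keys_diff_subset b_pairs U.m_closed incl(1) balanced(1,2))
  qed
  then show "r \<in> carrier (free_space pairs)" by simp
qed

sublocale Q: complex_subspace "free_space pairs" K
  unfolding K_eq
  by (intro complex_subspace.intro complex_subspace_axioms.intro module_free_space
      linear_span_submodule relations_subset)

lemma K_add: "p \<in> K \<Longrightarrow> q \<in> K \<Longrightarrow> p + q \<in> K"
  using Q.K.a_closed by simp

lemma K_scale: "p \<in> K \<Longrightarrow> Poly_Mapping.map ((*) c) p \<in> K"
  using Q.smult_in by simp

lemma K_uminus: "p \<in> K \<Longrightarrow> - p \<in> K"
proof -
  have "Poly_Mapping.map ((*) (- 1)) p = - p" by (rule poly_mapping_eqI) simp
  then show "p \<in> K \<Longrightarrow> - p \<in> K" using K_scale[of p "- 1"] by simp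
qed

lemma K_diff: "p \<in> K \<Longrightarrow> q \<in> K \<Longrightarrow> p - q \<in> K"
  using K_add[OF _ K_uminus] by fastforce

lemma K_rel: "r \<in> relations \<Longrightarrow> r \<in> K"
  unfolding K_eq by (rule subsetD[OF linear_span_incl])

definition \<tau> :: "enveloping \<Rightarrow> whittaker" where
  "\<tau> u = K +>\<^bsub>free_space pairs\<^esub> b u 1"

lemma \<tau>_eq_iff_K: "\<lbrakk>u \<in> carrier U; v \<in> carrier U\<rbrakk> \<Longrightarrow> \<tau> u = \<tau> v \<longleftrightarrow> b u 1 - b v 1 \<in> K"
  unfolding \<tau>_def using Q.coset_eq_iff[of "b u 1" "b v 1"] b_pairs[of u 1] b_pairs[of v 1]
  by (simp add: minus_free_space)

lemma \<tau>_add: "\<lbrakk>u \<in> carrier U; v \<in> carrier U\<rbrakk> \<Longrightarrow> \<tau> (u \<oplus>\<^bsub>U\<^esub> v) = \<tau> u \<oplus>\<^bsub>Q_module n\<^esub> \<tau> v"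
proof -
  assume uv: "u \<in> carrier U" "v \<in> carrier U"
  note k = b_pairs[OF uv(1), of 1] b_pairs[OF uv(2), of 1] b_pairs[OF U.a_closed[OF uv], of 1]
  have "\<tau> u \<oplus>\<^bsub>Q_module n\<^esub> \<tau> v = K +>\<^bsub>free_space pairs\<^esub> (b u 1 + b v 1)"
    unfolding \<tau>_def Q_eq using Q.quotient_add[of "b u 1" "b v 1"] k by simp
  also have "\<dots> = \<tau> (u \<oplus>\<^bsub>U\<^esub> v)"
    unfolding \<tau>_def
    using Q.coset_eq_iff[of "b u 1 + b v 1" "b (u \<oplus>\<^bsub>U\<^esub> v) 1"] k keys_add_subset[OF k(1,2)]
      K_uminus[OF K_rel[OF relationsI(1)[OF uv, of 1]]]
    by (simp add: minus_free_space)
  finally show ?thesis by simp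
qed

lemma \<tau>_smult: "u \<in> carrier U \<Longrightarrow> \<tau> (a \<odot>\<^bsub>U\<^esub> u) = a \<odot>\<^bsub>Q_module n\<^esub> \<tau> u"
proof -
  assume u: "u \<in> carrier U"
  note k = b_pairs[OF u, of 1] b_pairs[OF U.smult_closed'[OF u], of a 1]
  have "a \<odot>\<^bsub>Q_module n\<^esub> \<tau> u = K +>\<^bsub>free_space pairs\<^esub> (Poly_Mapping.map ((*) a) (b u 1))"
    unfolding \<tau>_def Q_eq using Q.quotient_smult[of "b u 1" a] k by simp
  also have "\<dots> = \<tau> (a \<odot>\<^bsub>U\<^esub> u)"
    unfolding \<tau>_def
    using Q.coset_eq_iff[of "Poly_Mapping.map ((*) a) (b u 1)" "b (a \<odot>\<^bsub>U\<^esub> u) 1"] k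
      keys_scale_subset[OF k(1), of a] K_uminus[OF K_rel[OF relationsI(2)[OF u, of a 1]]]
    by (simp add: minus_free_space)
  finally show ?thesis by simp
qed

text \<open>
  The relations move scalars and sums into the first factor, so every tensor is pure with second
  factor \<open>1\<close>.
\<close>

lemma free_space_mod_K:
  assumes "Poly_Mapping.keys p \<subseteq> pairs" shows "\<exists>u\<in>carrier U. p - b u 1 \<in> K"
  using assms
proof (induction rule: poly_mapping_keys_induct)
  case zero
  have "b (0 \<odot>\<^bsub>U\<^esub> \<one>\<^bsub>U\<^esub>) 1 - Poly_Mapping.map ((*) 0) (b \<one>\<^bsub>U\<^esub> 1) \<in> K"
    by (intro K_rel relationsI U.one_closed)
  then have "b \<zero>\<^bsub>U\<^esub> 1 \<in> K" by (simp add: scale_zero)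
  then have "0 - b \<zero>\<^bsub>U\<^esub> 1 \<in> K" using K_uminus by simp
  then show ?case using U.zero_closed by blast
next
  case (single_add z c q)
  obtain v d where z: "z = (v, d)" by (cases z)
  have v: "v \<in> carrier U" using single_add(1) unfolding z by (simp add: pairs_def)
  obtain u where u: "u \<in> carrier U" "q - b u 1 \<in> K" using single_add.IH by blast
  let ?w = "(c * d) \<odot>\<^bsub>U\<^esub> v"
  have w: "?w \<in> carrier U" using v by simp
  have "b v (d * 1) - Poly_Mapping.map ((*) d) (b v 1) \<in> K" by (intro K_rel relationsI v)
  then have "Poly_Mapping.map ((*) c) (b v (d * 1) - Poly_Mapping.map ((*) d) (b v 1)) \<in> K"
    by (rule K_scale)
  then have 1: "Poly_Mapping.single (v, d) c - Poly_Mapping.single (v, 1) (c * d) \<in> K"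
    by (simp add: scale_diff)
  have "b ?w 1 - Poly_Mapping.map ((*) (c * d)) (b v 1) \<in> K" by (intro K_rel relationsI v)
  then have 2: "b ?w 1 - Poly_Mapping.single (v, 1) (c * d) \<in> K" by simp
  have 3: "b (?w \<oplus>\<^bsub>U\<^esub> u) 1 - (b ?w 1 + b u 1) \<in> K" by (intro K_rel relationsI w u)
  have "(Poly_Mapping.single (v, d) c - Poly_Mapping.single (v, 1) (c * d))
      - (b ?w 1 - Poly_Mapping.single (v, 1) (c * d)) + (q - b u 1)
      - (b (?w \<oplus>\<^bsub>U\<^esub> u) 1 - (b ?w 1 + b u 1)) \<in> K"
    by (intro K_add K_diff 1 2 3 u)
  then have "Poly_Mapping.single z c + q - b (?w \<oplus>\<^bsub>U\<^esub> u) 1 \<in> K"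
    unfolding z by (simp add: algebra_simps)
  then show ?case using U.a_closed[OF w u(1)] by blast
qed

lemma \<tau>_onto: "\<tau> ` carrier U = carrier (Q_module n)"
proof
  show "\<tau> ` carrier U \<subseteq> carrier (Q_module n)"
    unfolding Q_eq Q.quotient_carrier \<tau>_def using b_pairs by auto
  show "carrier (Q_module n) \<subseteq> \<tau> ` carrier U"
  proof
    fix P assume "P \<in> carrier (Q_module n)"
    then obtain p where p: "Poly_Mapping.keys p \<subseteq> pairs" "P = K +>\<^bsub>free_space pairs\<^esub> p"
      unfolding Q_eq Q.quotient_carrier by auto
    obtain u where u: "u \<in> carrier U" "p - b u 1 \<in> K" using free_space_mod_K[OF p(1)] by blast
    have "P = \<tau> u"
      unfolding p(2) \<tau>_def using Q.coset_eq_iff[of p "b u 1"] p(1) b_pairs[OF u(1), of 1] u(2)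
      by (simp add: minus_free_space)
    then show "P \<in> \<tau> ` carrier U" using u by blast
  qed
qed

text \<open>
  Balancing with \<open>e i\<close>, on which the character is \<open>1\<close>, identifies \<open>a x\<^sub>i \<otimes> 1\<close> with \<open>a \<otimes> 1\<close>.
\<close>

lemma I_imp_K: "u \<in> I \<Longrightarrow> b u 1 \<in> K"
  unfolding I_def
proof (induction rule: left_ideal.induct)
  case zero
  have "b (0 \<odot>\<^bsub>U\<^esub> \<one>\<^bsub>U\<^esub>) 1 - Poly_Mapping.map ((*) 0) (b \<one>\<^bsub>U\<^esub> 1) \<in> K"
    by (intro K_rel relationsI U.one_closed)
  then show ?case by (simp add: scale_zero)
next
  case (gen a g)
  then obtain i where i: "i \<in> {1..n}" "g = x i \<ominus>\<^bsub>U\<^esub> \<one>\<^bsub>U\<^esub>" by auto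
  note xi = x_closed[OF i(1)]
  have m: "mm.\<iota> (e i) \<in> R" using e_mm[OF i(1)] by simp
  have "b (a \<otimes>\<^bsub>U\<^esub> incl (mm.\<iota> (e i))) 1 - b a (char (mm.\<iota> (e i)) * 1) \<in> K"
    by (intro K_rel relationsI gen m)
  then have 1: "b (a \<otimes>\<^bsub>U\<^esub> x i) 1 - b a 1 \<in> K"
    using e_mm[OF i(1)] i(1) by (simp add: incl_\<iota> char_\<iota> character_unit)
  have ag: "a \<otimes>\<^bsub>U\<^esub> g \<in> carrier U" unfolding i using gen xi by simp
  have "b (a \<otimes>\<^bsub>U\<^esub> g \<oplus>\<^bsub>U\<^esub> a) 1 - (b (a \<otimes>\<^bsub>U\<^esub> g) 1 + b a 1) \<in> K"
    by (intro K_rel relationsI gen ag)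
  moreover have "a \<otimes>\<^bsub>U\<^esub> g \<oplus>\<^bsub>U\<^esub> a = a \<otimes>\<^bsub>U\<^esub> x i"
    unfolding i(2) using gen(1) xi by (simp add: U.minus_eq U.r_distr U.r_minus U.a_assoc U.l_neg)
  ultimately have 2: "b (a \<otimes>\<^bsub>U\<^esub> x i) 1 - (b (a \<otimes>\<^bsub>U\<^esub> g) 1 + b a 1) \<in> K" by simp
  show ?case using K_diff[OF 1 2] by simp
next
  case (add u v)
  have uv: "u \<in> carrier U" "v \<in> carrier U" using add I_closed by (auto simp: I_def)
  have "b (u \<oplus>\<^bsub>U\<^esub> v) 1 - (b u 1 + b v 1) \<in> K" by (intro K_rel relationsI uv)
  then show ?case using K_add[OF _ K_add[OF add.IH]] by fastforce
qed

text \<open>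
  The converse inclusion comes from the linear map \<open>(u, c) \<mapsto> c u\<close>, which sends the relations of
  the tensor product into \<open>I\<close>.
\<close>

lemma K_imp_I:
  assumes u: "u \<in> carrier U" and bu: "b u 1 \<in> K" shows "u \<in> I"
proof -
  define G where "G = linear_extension U (\<lambda>(u, c). c \<odot>\<^bsub>U\<^esub> u)"
  have img: "(\<lambda>(u, c). c \<odot>\<^bsub>U\<^esub> u) ` pairs \<subseteq> carrier U" by (auto simp: pairs_def)
  have G_b: "G (b v c) = c \<odot>\<^bsub>U\<^esub> v" if "v \<in> carrier U" for v c
    using U.linear_extension_single[of "\<lambda>(u, c). c \<odot>\<^bsub>U\<^esub> u" "(v, c)" 1] that by (simp add: G_def)
  note G_add = U.linear_extension_add[OF img, folded G_def]
    and G_diff = U.linear_extension_diff[OF img, folded G_def]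
    and G_scale = U.linear_extension_scale[OF img, folded G_def]
  have "G p \<in> I" if "p \<in> K" for p
    using that unfolding K_eq
  proof (induction rule: linear_span_free_space_induct)
    show "relations \<subseteq> carrier (free_space pairs)" by (rule relations_subset)
  next
    fix r assume "r \<in> relations"
    then show "G r \<in> I"
    proof (cases rule: relationsE)
      case (add_left u v c)
      note k = b_pairs[OF add_left(1), of c] b_pairs[OF add_left(2), of c]
        b_pairs[OF U.a_closed[OF add_left(1,2)], of c]
      have "G r = c \<odot>\<^bsub>U\<^esub> (u \<oplus>\<^bsub>U\<^esub> v) \<ominus>\<^bsub>U\<^esub> (c \<odot>\<^bsub>U\<^esub> u \<oplus>\<^bsub>U\<^esub> c \<odot>\<^bsub>U\<^esub> v)"
        unfolding add_left(3) G_diff[OF k(3) keys_add_subset[OF k(1,2)]] G_add[OF k(1,2)]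
        using add_left(1,2) by (simp add: G_b)
      then show ?thesis using add_left(1,2) I_zero by (simp add: U.smult_add_right)
    next
      case (add_right u c d)
      note k = b_pairs[OF add_right(1), of c] b_pairs[OF add_right(1), of d]
        b_pairs[OF add_right(1), of "c + d"]
      have "G r = (c + d) \<odot>\<^bsub>U\<^esub> u \<ominus>\<^bsub>U\<^esub> (c \<odot>\<^bsub>U\<^esub> u \<oplus>\<^bsub>U\<^esub> d \<odot>\<^bsub>U\<^esub> u)"
        unfolding add_right(2) G_diff[OF k(3) keys_add_subset[OF k(1,2)]] G_add[OF k(1,2)]
        using add_right(1) by (simp add: G_b)
      then show ?thesis using add_right(1) I_zero by (simp add: U.smult_add_left)
    next
      case (scale_left a u c)
      note k = b_pairs[OF scale_left(1), of c] b_pairs[OF U.smult_closed'[OF scale_left(1)], of a c]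
      have "G r = c \<odot>\<^bsub>U\<^esub> (a \<odot>\<^bsub>U\<^esub> u) \<ominus>\<^bsub>U\<^esub> a \<odot>\<^bsub>U\<^esub> (c \<odot>\<^bsub>U\<^esub> u)"
        unfolding scale_left(2) G_diff[OF k(2) keys_scale_subset[OF k(1)]] G_scale[OF k(1)]
        using scale_left(1) by (simp add: G_b)
      then show ?thesis using scale_left(1) I_zero by (simp add: U.smult_smult mult.commute)
    next
      case (scale_right a u c)
      note k = b_pairs[OF scale_right(1), of c] b_pairs[OF scale_right(1), of "a * c"]
      have "G r = (a * c) \<odot>\<^bsub>U\<^esub> u \<ominus>\<^bsub>U\<^esub> a \<odot>\<^bsub>U\<^esub> (c \<odot>\<^bsub>U\<^esub> u)"
        unfolding scale_right(2) G_diff[OF k(2) keys_scale_subset[OF k(1)]] G_scale[OF k(1)]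
        using scale_right(1) by (simp add: G_b)
      then show ?thesis using scale_right(1) I_zero by (simp add: U.smult_smult)
    next
      case (balanced u t c)
      have t: "incl t \<in> carrier U" using balanced incl(1) by blast
      have ut: "u \<otimes>\<^bsub>U\<^esub> incl t \<in> carrier U" using balanced t by simp
      note k = b_pairs[OF ut, of c] b_pairs[OF balanced(1), of "char t * c"]
      have "G r = c \<odot>\<^bsub>U\<^esub> (u \<otimes>\<^bsub>U\<^esub> incl t) \<ominus>\<^bsub>U\<^esub> (char t * c) \<odot>\<^bsub>U\<^esub> u"
        unfolding balanced(3) G_diff[OF k] using balanced(1) ut by (simp add: G_b)
      also have "\<dots> = c \<odot>\<^bsub>U\<^esub> (u \<otimes>\<^bsub>U\<^esub> (incl t \<ominus>\<^bsub>U\<^esub> char t \<odot>\<^bsub>U\<^esub> \<one>\<^bsub>U\<^esub>))"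
        using balanced(1) t by (simp add: U.minus_eq U.r_distr U.r_minus U.smult_add_right
            U.smult_minus_right U.smult_mult_right U.smult_smult mult.commute)
      finally show ?thesis
        using I_smult[OF I_mult[OF incl_minus_char[OF balanced(2)] balanced(1)]] by simp
    qed
  next
    show "G 0 \<in> I" unfolding G_def using I_zero by (simp add: U.linear_extension_zero)
  next
    fix p q assume "p \<in> carrier (free_space pairs)" "q \<in> carrier (free_space pairs)" "G p \<in> I" "G q \<in> I"
    then show "G (p + q) \<in> I" using G_add I_add by simp
  next
    fix c p assume "p \<in> carrier (free_space pairs)" "G p \<in> I"
    then show "G (Poly_Mapping.map ((*) c) p) \<in> I" using G_scale I_smult by simp
  qed
  from this[OF bu] show ?thesis using G_b[OF u, of 1] u by simp
qed

lemma \<tau>_eq_iff: "\<lbrakk>u \<in> carrier U; v \<in> carrier U\<rbrakk> \<Longrightarrow> \<tau> u = \<tau> v \<longleftrightarrow> u \<ominus>\<^bsub>U\<^esub> v \<in> I"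
proof -
  assume u: "u \<in> carrier U" and v: "v \<in> carrier U"
  let ?w = "u \<ominus>\<^bsub>U\<^esub> v"
  have w: "?w \<in> carrier U" using u v by simp
  have "b (?w \<oplus>\<^bsub>U\<^esub> v) 1 - (b ?w 1 + b v 1) \<in> K" by (intro K_rel relationsI w v)
  moreover have "?w \<oplus>\<^bsub>U\<^esub> v = u" using u v by algebra
  ultimately have r: "b u 1 - (b ?w 1 + b v 1) \<in> K" by simp
  have "b u 1 - b v 1 \<in> K \<longleftrightarrow> b ?w 1 \<in> K"
    using K_diff[OF _ r, of "b u 1 - b v 1"] K_add[OF r, of "b ?w 1"] by auto
  then show ?thesis using \<tau>_eq_iff_K[OF u v] K_imp_I[OF w] I_imp_K by blast
qed

lemma \<tau>_zero: "\<tau> \<zero>\<^bsub>U\<^esub> = \<zero>\<^bsub>Q_module n\<^esub>"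
proof -
  have "b \<zero>\<^bsub>U\<^esub> 1 \<in> K" using I_imp_K I_zero by blast
  then show ?thesis unfolding \<tau>_def Q_eq Q.quotient_zero by (rule Q.K.a_rcos_const)
qed

text \<open>
  Left multiplication commutes with the right action, so it maps the relations of the tensor product
  to relations.
\<close>

lemma Q_action_\<tau>:
  assumes X: "X \<in> sl n" and u: "u \<in> carrier U"
  shows "Q_action n X (\<tau> u) = \<tau> (\<iota> X \<otimes>\<^bsub>U\<^esub> u)"
proof -
  define f where "f = push_forward (\<lambda>(m, c :: complex). (\<iota> X \<otimes>\<^bsub>U\<^esub> m, c))"
  note Xc = \<iota>_closed[OF X]
  have f_b: "f (b v c) = b (\<iota> X \<otimes>\<^bsub>U\<^esub> v) c" for v c
    by (simp add: f_def push_forward_single)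
  have f_add: "f (p + q) = f p + f q" for p q unfolding f_def by (rule push_forward_add)
  have f_diff: "f (p - q) = f p - f q" for p q unfolding f_def by (rule push_forward_diff)
  have f_scale: "f (Poly_Mapping.map ((*) c) p) = Poly_Mapping.map ((*) c) (f p)" for c p
    unfolding f_def by (rule push_forward_scale)
  have f_closed: "Poly_Mapping.keys (f p) \<subseteq> pairs" if "Poly_Mapping.keys p \<subseteq> pairs" for p
    using keys_push_forward[OF that, of "\<lambda>(m, c). (\<iota> X \<otimes>\<^bsub>U\<^esub> m, c)"] Xc
    unfolding f_def by (fastforce simp: pairs_def)
  have f_K: "f p \<in> K" if "p \<in> K" for p
    using that unfolding K_eq
  proof (induction rule: linear_span_free_space_induct)
    show "relations \<subseteq> carrier (free_space pairs)" by (rule relations_subset)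
  next
    fix r assume "r \<in> relations"
    then have "f r \<in> relations"
    proof (cases rule: relationsE)
      case (add_left u v c)
      have "f r = b (\<iota> X \<otimes>\<^bsub>U\<^esub> u \<oplus>\<^bsub>U\<^esub> \<iota> X \<otimes>\<^bsub>U\<^esub> v) c - (b (\<iota> X \<otimes>\<^bsub>U\<^esub> u) c + b (\<iota> X \<otimes>\<^bsub>U\<^esub> v) c)"
        unfolding add_left(3) f_diff f_add f_b using add_left(1,2) Xc by (simp add: U.r_distr)
      then show ?thesis using relationsI(1) add_left(1,2) Xc by simp
    next
      case (add_right u c d)
      show ?thesis unfolding add_right(2) f_diff f_add f_b
        by (intro relationsI U.m_closed Xc add_right(1))
    next
      case (scale_left a u c)
      have "f r = b (a \<odot>\<^bsub>U\<^esub> (\<iota> X \<otimes>\<^bsub>U\<^esub> u)) c - Poly_Mapping.map ((*) a) (b (\<iota> X \<otimes>\<^bsub>U\<^esub> u) c)"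
        unfolding scale_left(2) f_diff f_scale f_b using scale_left(1) Xc by (simp add: U.smult_mult_right)
      moreover have "\<dots> \<in> relations" by (intro relationsI U.m_closed Xc scale_left(1))
      ultimately show ?thesis by (simp only:)
    next
      case (scale_right a u c)
      show ?thesis unfolding scale_right(2) f_diff f_scale f_b
        by (intro relationsI U.m_closed Xc scale_right(1))
    next
      case (balanced u t c)
      have "f r = b (\<iota> X \<otimes>\<^bsub>U\<^esub> u \<otimes>\<^bsub>U\<^esub> incl t) c - b (\<iota> X \<otimes>\<^bsub>U\<^esub> u) (char t * c)"
        unfolding balanced(3) f_diff f_b using balanced(1,2) Xc incl(1) by (simp add: U.m_assoc)
      moreover have "\<dots> \<in> relations" by (intro relationsI U.m_closed Xc balanced(1,2))
      ultimately show ?thesis by (simp only:)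
    qed
    then show "f r \<in> linear_span (free_space pairs) relations"
      by (rule subsetD[OF linear_span_incl])
  next
    show "f 0 \<in> linear_span (free_space pairs) relations"
      using Q.K.zero_closed by (simp add: f_def push_forward_zero K_eq)
  qed (use K_add K_scale in \<open>simp_all add: f_add f_scale K_eq\<close>)
  have "Q_action n X (\<tau> u) = (\<Union>p\<in>K +>\<^bsub>free_space pairs\<^esub> b u 1. K +>\<^bsub>free_space pairs\<^esub> f p)"
    by (simp add: Q_action_def tensor_map_left_def \<tau>_def f_def K_def pairs_def)
  also have "\<dots> = K +>\<^bsub>free_space pairs\<^esub> f (b u 1)"
    by (rule Q.coset_map) (use b_pairs[OF u, of 1] f_closed f_add f_K in simp_all)
  finally show ?thesis by (simp add: f_b \<tau>_def)
qed

end

section \<open>The localization\<close>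

locale localized_special_linear = special_linear n
  for n :: nat and L :: "(complex, 'b) module" (structure) and \<phi> :: "enveloping \<Rightarrow> 'b" +
  assumes localization: "is_localization U (denominators n) L \<phi>"
begin

sublocale L: assoc_algebra L
  using localization by (intro assoc_algebra.intro) (simp add: is_localization_def)

lemma \<phi>_hom: "\<phi> \<in> algebra_hom U L"
  using localization by (simp add: is_localization_def)

lemmas \<phi> = algebra_homD[OF \<phi>_hom]
  and \<phi>_zero = algebra_hom_zero_diff(1)[OF U_algebra L.complex_algebra_axioms \<phi>_hom]
  and \<phi>_diff = algebra_hom_zero_diff(2)[OF U_algebra L.complex_algebra_axioms \<phi>_hom]

lemma \<phi>_unit: "s \<in> S \<Longrightarrow> \<phi> s \<in> Units L"
  using localization by (simp add: is_localization_def S_def)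

lemma fractions:
  assumes "l \<in> carrier L"
  obtains s r where "s \<in> S" "r \<in> carrier U" "l = inv (\<phi> s) \<otimes> \<phi> r"
  using localization assms unfolding is_localization_def S_def by blast

lemma \<phi>_kernel:
  assumes "r \<in> carrier U" "\<phi> r = \<zero>" obtains s where "s \<in> S" "s \<otimes>\<^bsub>U\<^esub> r = \<zero>\<^bsub>U\<^esub>"
  using localization assms unfolding is_localization_def S_def by blast

lemma \<phi>_commutator:
  "\<lbrakk>u \<in> carrier U; v \<in> carrier U\<rbrakk> \<Longrightarrow> commutator L (\<phi> u) (\<phi> v) = \<phi> (commutator U u v)"
  by (simp add: commutator_def \<phi>_diff \<phi>(2))

definition H :: "nat \<Rightarrow> 'b" where
  "H k = (if k \<in> {1..n} then \<phi> (\<iota> (coweight n k)) else \<zero>)"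

definition xL :: "nat \<Rightarrow> 'b" where "xL i = \<phi> (x i)"

lemma coweight_sl: "k \<in> {1..n} \<Longrightarrow> coweight n k \<in> sl n"
  using coweight_cartan[of k n] by (simp add: cartan_def)

lemma commutator_H_unit:
  assumes "i \<le> n" "j \<le> n" "i \<noteq> j"
  shows "commutator L (H k) (\<phi> (\<iota> (matrix_unit n i j))) = of_int (if k \<in> {1..n} then
    (if j = k then 1 else 0) - (if i = k then 1 else 0) else 0) \<odot> \<phi> (\<iota> (matrix_unit n i j))"
proof (cases "k \<in> {1..n}")
  case True
  have sl: "coweight n k \<in> sl n" "matrix_unit n i j \<in> sl n"
    using coweight_sl[OF True] matrix_unit_sl assms by auto
  have "commutator U (\<iota> (coweight n k)) (\<iota> (matrix_unit n i j))
      = (coweight n k $$ (i, i) - coweight n k $$ (j, j)) \<odot>\<^bsub>U\<^esub> \<iota> (matrix_unit n i j)"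
    using \<iota>_bracket[OF sl] bracket_diagonal_unit[OF coweight_carrier coweight_diagonal assms(1,2)]
      \<iota>_smult[OF sl(2)] by simp
  also have "coweight n k $$ (i, i) - coweight n k $$ (j, j)
      = of_int ((if j = k then 1 else 0) - (if i = k then 1 else 0))"
    using assms by simp
  finally show ?thesis
    using True sl by (simp add: H_def \<phi>_commutator \<phi>(4))
next
  case False
  have "\<phi> (\<iota> (matrix_unit n i j)) \<in> carrier L" using \<phi>(1) matrix_unit_sl assms by simp
  then have "commutator L (H k) (\<phi> (\<iota> (matrix_unit n i j))) = \<zero>"
    using False by (auto simp: H_def commutator_def)
  then show ?thesis
    using False \<open>\<phi> (\<iota> (matrix_unit n i j)) \<in> carrier L\<close> by auto
qed

sublocale T: torus_algebra L n H xL
proof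
  show "H k \<in> carrier L" for k using \<phi>(1) coweight_sl by (simp add: H_def)
  show "H k = \<zero>" if "k \<notin> {1..n}" for k using that by (auto simp: H_def)
  show "xL i \<in> Units L" if "i \<in> {1..n}" for i using \<phi>_unit S_x that by (simp add: xL_def)
  show "xL i \<otimes> xL j = xL j \<otimes> xL i" if "i \<in> {1..n}" "j \<in> {1..n}" for i j
    unfolding xL_def using \<phi>(2)[OF x_closed x_closed, symmetric] that x_commute by simp
  show "commutator L (H k) (xL i) = (if k = i then xL i else \<zero>)" if "i \<in> {1..n}" for k i
    using commutator_H_unit[of 0 i k] that \<phi>(1)[OF x_closed[OF that]] by (auto simp: xL_def)
qed

lemma unit_weight:
  assumes "i \<le> n" "j \<le> n" "i \<noteq> j"
  shows "T.weight (\<lambda>k. if k \<in> {1..n} then (if j = k then 1 else 0) - (if i = k then 1 else 0) else 0)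
    (\<phi> (\<iota> (matrix_unit n i j)))"
  unfolding L.weight_vector_def
  using commutator_H_unit[OF assms] \<phi>(1) matrix_unit_sl assms(3) by simp

lemma coweight_weight: "k \<in> {1..n} \<Longrightarrow> T.weight (\<lambda>_. 0) (\<phi> (\<iota> (coweight n k)))"
proof -
  assume k: "k \<in> {1..n}"
  have c: "\<phi> (\<iota> (coweight n k)) \<in> carrier L" using \<phi>(1) coweight_sl[OF k] by simp
  have "commutator L (H j) (\<phi> (\<iota> (coweight n k))) = \<zero>" for j
  proof (cases "j \<in> {1..n}")
    case True
    have "commutator U (\<iota> (coweight n j)) (\<iota> (coweight n k)) = \<zero>\<^bsub>U\<^esub>"
      using \<iota>_bracket[OF coweight_sl[OF True] coweight_sl[OF k]] \<iota>_zero
        bracket_diagonal[OF coweight_carrier coweight_diagonal coweight_carrier coweight_diagonal, of n j k]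
      by simp
    then show ?thesis
      using True coweight_sl k by (simp add: H_def \<phi>_commutator \<phi>_zero)
  next
    case False
    then show ?thesis using c by (auto simp: H_def commutator_def)
  qed
  then show ?thesis using c by (simp add: L.weight_vector_def)
qed

text \<open>
  That weight vectors span \<open>L\<close> is proved from left to right: \<open>L\<close> consists of the products of an
  inverted denominator, which is a weight vector, with words in \<open>\<ss>\<ll>\<close>, and \<open>\<ss>\<ll>\<close> is spanned by
  weight vectors.
\<close>

definition weight_span :: "'b set" where
  "weight_span = {u. \<exists>u'. T.untwist u u'}"

lemma weight_span_closed: "u \<in> weight_span \<Longrightarrow> u \<in> carrier L"
  using T.untwist_closed by (auto simp: weight_span_def)

lemma weight_span_weight: "T.weight \<mu> u \<Longrightarrow> u \<in> weight_span"
  unfolding weight_span_def using T.untwist.weight by blast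

lemma weight_span_add: "\<lbrakk>u \<in> weight_span; v \<in> weight_span\<rbrakk> \<Longrightarrow> u \<oplus> v \<in> weight_span"
  unfolding weight_span_def using T.untwist.add by blast

lemma weight_span_smult: "u \<in> weight_span \<Longrightarrow> c \<odot> u \<in> weight_span"
  unfolding weight_span_def using T.untwist_smult by blast

lemma weight_span_mult: "\<lbrakk>T.weight \<nu> c; u \<in> weight_span\<rbrakk> \<Longrightarrow> c \<otimes> u \<in> weight_span"
proof -
  assume c: "T.weight \<nu> c"
  note cc = L.weight_vector_closed[OF c]
  have "c \<otimes> u \<in> weight_span" if "T.untwist u u'" for u u'
    using that
  proof (induction rule: T.untwist.induct)
    case zero
    then show ?case
      using cc weight_span_weight[OF L.weight_vector_zero[OF T.H_range]] by simp
  next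
    case (weight \<mu> d)
    then show ?case
      using weight_span_weight[OF L.weight_vector_mult[OF T.H_range c weight]] by simp
  next
    case (add a a' d d')
    then show ?case
      using cc T.untwist_closed weight_span_add by (simp add: L.r_distr)
  qed
  then show "u \<in> weight_span \<Longrightarrow> ?thesis" by (auto simp: weight_span_def)
qed

lemma weight_span_mult_\<iota>:
  assumes "X \<in> sl n" shows "\<forall>u\<in>weight_span. \<phi> (\<iota> X) \<otimes> u \<in> weight_span"
  using assms
proof (induction rule: sl_induct)
  case zero
  show ?case
    using weight_span_weight[OF L.weight_vector_zero[OF T.H_range]] weight_span_closed
    by (simp only: \<iota>_zero \<phi>_zero) simp
next
  case (coweight k)
  then show ?case using weight_span_mult coweight_weight by blast
next
  case (unit i j)
  then show ?case using weight_span_mult unit_weight by blast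
next
  case (add A B)
  then show ?case
    using \<phi>(1) weight_span_closed weight_span_add by (simp add: \<iota>_add \<phi>(3) L.l_distr)
next
  case (smult c A)
  then show ?case
    using \<phi>(1) weight_span_closed weight_span_smult by (simp add: \<iota>_smult \<phi>(4) L.smult_mult_left)
qed

lemma weight_span_\<phi>: "u \<in> carrier U \<Longrightarrow> \<phi> u \<in> weight_span"
proof (induction rule: U_induct)
  case one
  then show ?case using weight_span_weight[OF L.weight_vector_one[OF T.H_range]] by (simp add: \<phi>(5))
next
  case (mult X u)
  then show ?case using weight_span_mult_\<iota> by (simp add: \<phi>(2))
next
  case (add u v)
  then show ?case using weight_span_add by (simp add: \<phi>(3))
next
  case (smult c u)
  then show ?case using weight_span_smult by (simp add: \<phi>(4))
qed

lemma denominator_weight: "s \<in> S \<Longrightarrow> \<exists>\<mu>. T.weight \<mu> (\<phi> s)"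
proof -
  assume "s \<in> S"
  then have "s \<in> carrier U \<and> (\<exists>\<mu>. T.weight \<mu> (\<phi> s))"
  proof (induction rule: S_induct)
    case one
    then show ?case using L.weight_vector_one[OF T.H_range] by (auto simp: \<phi>(5))
  next
    case (mult i t)
    then obtain \<mu> where "T.weight \<mu> (\<phi> t)" by blast
    then show ?case
      using L.weight_vector_mult[OF T.H_range T.x_weight_vector[OF mult(1)]] mult x_closed
      by (auto simp: \<phi>(2) xL_def)
  qed
  then show ?thesis by blast
qed

sublocale T: spanned_torus_algebra L n H xL
proof
  fix u assume "u \<in> carrier L"
  then obtain s r where s: "s \<in> S" and r: "r \<in> carrier U" and u: "u = inv (\<phi> s) \<otimes> \<phi> r"
    by (rule fractions)
  obtain \<mu> where "T.weight \<mu> (\<phi> s)" using denominator_weight[OF s] by blast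
  then have "T.weight (\<lambda>k. - \<mu> k) (inv (\<phi> s))"
    using L.weight_vector_inv[OF T.H_range] \<phi>_unit[OF s] by blast
  then have "u \<in> weight_span" unfolding u by (rule weight_span_mult[OF _ weight_span_\<phi>[OF r]])
  then show "\<exists>u'. T.untwist u u'" by (simp add: weight_span_def)
qed

lemma \<phi>_I: "u \<in> I \<Longrightarrow> \<phi> u \<in> T.J"
  unfolding I_def
proof (induction rule: left_ideal.induct)
  case zero
  then show ?case using T.J_zero by (simp add: \<phi>_zero)
next
  case (gen a g)
  then obtain i where i: "i \<in> {1..n}" "g = x i \<ominus>\<^bsub>U\<^esub> \<one>\<^bsub>U\<^esub>" by auto
  have "\<phi> (a \<otimes>\<^bsub>U\<^esub> g) = \<phi> a \<otimes> (xL i \<ominus> \<one>)"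
    using gen(1) i x_closed[OF i(1)] by (simp add: \<phi>(2) \<phi>_diff \<phi>(5) xL_def)
  then show ?case
    unfolding T.J_def using left_ideal.gen[of "\<phi> a" L] \<phi>(1)[OF gen(1)] i(1) by auto
next
  case (add u v)
  then show ?case using I_closed T.J_add by (simp add: \<phi>(3) I_def)
qed

text \<open>
  Denominators commute with each other, so two fractions have the product of their denominators as a
  common denominator.
\<close>

lemma J_common_denominator:
  assumes "l \<in> T.J" shows "\<exists>s\<in>S. \<exists>v\<in>I. \<phi> s \<otimes> l = \<phi> v"
  using assms
proof (induction rule: T.J_induct)
  case zero
  show ?case
    using S_one I_zero L.one_closed by (intro bexI[of _ "\<one>\<^bsub>U\<^esub>"] bexI[of _ "\<zero>\<^bsub>U\<^esub>"]) (auto simp: \<phi>(5) \<phi>_zero)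
next
  case (gen a i)
  obtain s r where s: "s \<in> S" and r: "r \<in> carrier U" and a: "a = inv (\<phi> s) \<otimes> \<phi> r"
    using fractions[OF gen(1)] .
  note u = \<phi>_unit[OF s] and rc = \<phi>(1)[OF r] and xi = x_closed[OF gen(2)]
  have sa: "\<phi> s \<otimes> a = \<phi> r"
    unfolding a using u rc by (simp add: L.m_assoc[symmetric] L.Units_closed)
  have "\<phi> s \<otimes> (a \<otimes> xL i \<ominus> a) = (\<phi> s \<otimes> a) \<otimes> xL i \<ominus> \<phi> s \<otimes> a"
    using gen(1) T.x_closed[OF gen(2)] L.Units_closed[OF u] by algebra
  also have "\<dots> = \<phi> (r \<otimes>\<^bsub>U\<^esub> x i \<ominus>\<^bsub>U\<^esub> r)"
    unfolding sa xL_def using r xi by (simp add: \<phi>(2) \<phi>_diff)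
  also have "r \<otimes>\<^bsub>U\<^esub> x i \<ominus>\<^bsub>U\<^esub> r = r \<otimes>\<^bsub>U\<^esub> (x i \<ominus>\<^bsub>U\<^esub> \<one>\<^bsub>U\<^esub>)"
    using r xi by (simp add: U.minus_eq U.r_distr U.r_minus)
  finally show ?case using s I_mult[OF I_gen[OF gen(2)] r] by blast
next
  case (add l m)
  obtain s v where s: "s \<in> S" "v \<in> I" "\<phi> s \<otimes> l = \<phi> v" using add.IH(1) by blast
  obtain t w where t: "t \<in> S" "w \<in> I" "\<phi> t \<otimes> m = \<phi> w" using add.IH(2) by blast
  have c: "s \<in> carrier U" "t \<in> carrier U" "v \<in> carrier U" "w \<in> carrier U"
    "l \<in> carrier L" "m \<in> carrier L"
    using s t S_closed I_closed add T.J_closed by auto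
  note p = \<phi>(1)[OF c(1)] \<phi>(1)[OF c(2)]
  have "\<phi> (s \<otimes>\<^bsub>U\<^esub> t) \<otimes> (l \<oplus> m) = \<phi> (t \<otimes>\<^bsub>U\<^esub> s) \<otimes> l \<oplus> \<phi> (s \<otimes>\<^bsub>U\<^esub> t) \<otimes> m"
    using S_commute[OF s(1) t(1)] c \<phi>(1)[of "t \<otimes>\<^bsub>U\<^esub> s"] by (simp add: L.r_distr)
  also have "\<dots> = \<phi> t \<otimes> \<phi> v \<oplus> \<phi> s \<otimes> \<phi> w"
    using c p by (simp add: \<phi>(2) L.m_assoc s(3) t(3))
  also have "\<dots> = \<phi> (t \<otimes>\<^bsub>U\<^esub> v \<oplus>\<^bsub>U\<^esub> s \<otimes>\<^bsub>U\<^esub> w)"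
    using c by (simp add: \<phi>(2) \<phi>(3))
  finally show ?case
    using S_mult[OF s(1) t(1)] I_add[OF I_mult[OF s(2) c(2)] I_mult[OF t(2) c(1)]] by blast
qed

text \<open>
  Clearing denominators gives \<open>s u \<in> I\<close> up to an element annihilated by a denominator, and
  denominators act injectively on \<open>U / I\<close>.
\<close>

lemma \<phi>_J_imp_I:
  assumes u: "u \<in> carrier U" and J: "\<phi> u \<in> T.J" shows "u \<in> I"
proof -
  obtain s v where s: "s \<in> S" "v \<in> I" "\<phi> s \<otimes> \<phi> u = \<phi> v" using J_common_denominator[OF J] by blast
  note c = S_closed[OF s(1)] I_closed[OF s(2)]
  have "\<phi> (s \<otimes>\<^bsub>U\<^esub> u \<ominus>\<^bsub>U\<^esub> v) = \<zero>"
    using c u s(3) \<phi>(1)[OF c(2)] by (simp add: \<phi>_diff \<phi>(2))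
  then obtain t where t: "t \<in> S" "t \<otimes>\<^bsub>U\<^esub> (s \<otimes>\<^bsub>U\<^esub> u \<ominus>\<^bsub>U\<^esub> v) = \<zero>\<^bsub>U\<^esub>"
    using \<phi>_kernel[of "s \<otimes>\<^bsub>U\<^esub> u \<ominus>\<^bsub>U\<^esub> v"] c u by auto
  have "s \<otimes>\<^bsub>U\<^esub> u \<ominus>\<^bsub>U\<^esub> v \<in> I"
    by (rule S_injective_mod_I[OF t(1)]) (use t c u I_zero in auto)
  then have "(s \<otimes>\<^bsub>U\<^esub> u \<ominus>\<^bsub>U\<^esub> v) \<oplus>\<^bsub>U\<^esub> v \<in> I" using I_add s(2) by blast
  also have "(s \<otimes>\<^bsub>U\<^esub> u \<ominus>\<^bsub>U\<^esub> v) \<oplus>\<^bsub>U\<^esub> v = s \<otimes>\<^bsub>U\<^esub> u" using c u by algebra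
  finally show ?thesis by (rule S_injective_mod_I[OF s(1) u])
qed

text \<open>
  Since \<open>s\<close> acts surjectively on \<open>U / I\<close>, the fraction \<open>s\<^sup>-\<^sup>1 r\<close> is congruent to some \<open>v \<in> U\<close>.
\<close>

lemma lift_mod_J:
  assumes "l \<in> carrier L" shows "\<exists>u\<in>carrier U. \<phi> u \<ominus> l \<in> T.J"
proof -
  obtain s r where s: "s \<in> S" and r: "r \<in> carrier U" and l: "l = inv (\<phi> s) \<otimes> \<phi> r"
    using fractions[OF assms] .
  obtain v where v: "v \<in> carrier U" "r \<ominus>\<^bsub>U\<^esub> s \<otimes>\<^bsub>U\<^esub> v \<in> I" using S_surjective_mod_I[OF s r] by blast
  note u = \<phi>_unit[OF s] and sc = S_closed[OF s]
  have ic: "inv (\<phi> s) \<in> carrier L" using u by simp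
  note p = \<phi>(1)[OF r] \<phi>(1)[OF v(1)] \<phi>(1)[OF sc]
  have "inv (\<phi> s) \<otimes> \<phi> (r \<ominus>\<^bsub>U\<^esub> s \<otimes>\<^bsub>U\<^esub> v) \<in> T.J"
    using T.J_mult[OF \<phi>_I[OF v(2)] ic] .
  also have "inv (\<phi> s) \<otimes> \<phi> (r \<ominus>\<^bsub>U\<^esub> s \<otimes>\<^bsub>U\<^esub> v)
      = l \<ominus> (inv (\<phi> s) \<otimes> \<phi> s) \<otimes> \<phi> v"
    unfolding l using r v(1) sc ic p
    by (simp add: \<phi>_diff \<phi>(2) L.minus_eq L.r_distr L.r_minus L.m_assoc)
  also have "\<dots> = l \<ominus> \<phi> v" using u p by simp
  finally have "\<phi> v \<ominus> l \<in> T.J" using T.J_sym assms p(2) by blast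
  then show ?thesis using v(1) by blast
qed

text \<open>
  The inverse of the bijection \<open>U / I \<rightarrow> L / J\<close> induced by \<open>\<phi>\<close>, composed with \<open>U / I = Q\<close>.
\<close>

definition \<rho> :: "'b \<Rightarrow> whittaker" where
  "\<rho> l = \<tau> (SOME u. u \<in> carrier U \<and> \<phi> u \<ominus> l \<in> T.J)"

lemma \<tau>_eq_iff_J: "\<lbrakk>u \<in> carrier U; v \<in> carrier U\<rbrakk> \<Longrightarrow> \<tau> u = \<tau> v \<longleftrightarrow> \<phi> u \<ominus> \<phi> v \<in> T.J"
  using \<tau>_eq_iff[of u v] \<phi>_I[of "u \<ominus>\<^bsub>U\<^esub> v"] \<phi>_J_imp_I[of "u \<ominus>\<^bsub>U\<^esub> v"] by (auto simp: \<phi>_diff)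

lemma \<rho>_eqI:
  assumes "l \<in> carrier L" "u \<in> carrier U" "\<phi> u \<ominus> l \<in> T.J" shows "\<rho> l = \<tau> u"
proof -
  define v where "v = (SOME u. u \<in> carrier U \<and> \<phi> u \<ominus> l \<in> T.J)"
  have v: "v \<in> carrier U \<and> \<phi> v \<ominus> l \<in> T.J"
    unfolding v_def by (rule someI[of _ u]) (use assms in simp)
  have "\<phi> v \<ominus> \<phi> u \<in> T.J"
    using T.J_trans[of "\<phi> v" l "\<phi> u"] T.J_sym[OF assms(3)] v assms \<phi>(1) by auto
  then show ?thesis unfolding \<rho>_def v_def[symmetric] using \<tau>_eq_iff_J v assms(2) by simp
qed

lemma \<rho>_cases:
  assumes "l \<in> carrier L"
  obtains u where "u \<in> carrier U" "\<phi> u \<ominus> l \<in> T.J" "\<rho> l = \<tau> u"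
  using lift_mod_J[OF assms] \<rho>_eqI[OF assms] by blast

lemma \<phi>_generated: "u \<in> carrier U \<Longrightarrow> \<phi> u \<in> generated_subalgebra L ((\<lambda>X. \<phi> (\<iota> X)) ` sl n)"
proof (induction rule: U_induct)
  case one
  then show ?case using generated_subalgebra.one[of L] by (simp add: \<phi>(5))
next
  case (mult X u)
  then show ?case using generated_subalgebra.mult[OF imageI[OF mult(1)] mult(3)] by (simp add: \<phi>(2))
next
  case (add u v)
  then show ?case using generated_subalgebra.add[OF add(3,4)] by (simp add: \<phi>(3))
next
  case (smult c u)
  then show ?case using generated_subalgebra.smult[OF smult(2), of c] by (simp add: \<phi>(4))
qed

sublocale M: whittaker_model L n H xL "sl n" "\<lambda>X. \<phi> (\<iota> X)" "Q_module n" "Q_action n" \<rho>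
proof
  show "\<phi> (\<iota> X) \<in> carrier L" if "X \<in> sl n" for X using \<phi>(1) that by simp
  show "\<exists>X\<in>sl n. \<phi> (\<iota> X) = xL i" if "i \<in> {1..n}" for i using e_sl[OF that] by (auto simp: xL_def)
  show "\<exists>b\<in>generated_subalgebra L ((\<lambda>X. \<phi> (\<iota> X)) ` sl n). a \<ominus> b \<in> T.J" if a: "a \<in> carrier L" for a
  proof -
    obtain u where u: "u \<in> carrier U" "\<phi> u \<ominus> a \<in> T.J" using lift_mod_J[OF a] by blast
    then show ?thesis using \<phi>_generated[OF u(1)] T.J_sym[OF u(2) \<phi>(1)[OF u(1)] a] by blast
  qed
  show "\<rho> ` carrier L = carrier (Q_module n)"
  proof
    show "\<rho> ` carrier L \<subseteq> carrier (Q_module n)"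
      using \<rho>_cases \<tau>_onto by (metis image_eqI image_subsetI)
    show "carrier (Q_module n) \<subseteq> \<rho> ` carrier L"
    proof
      fix P assume "P \<in> carrier (Q_module n)"
      then obtain u where u: "u \<in> carrier U" "P = \<tau> u" using \<tau>_onto by blast
      have "\<rho> (\<phi> u) = \<tau> u"
        by (rule \<rho>_eqI) (use u \<phi>(1) T.J_zero in auto)
      then show "P \<in> \<rho> ` carrier L" using u \<phi>(1) by (metis imageI)
    qed
  qed
  show "\<rho> a = \<rho> c \<longleftrightarrow> a \<ominus> c \<in> T.J" if a: "a \<in> carrier L" and c: "c \<in> carrier L" for a c
  proof -
    obtain u where u: "u \<in> carrier U" "\<phi> u \<ominus> a \<in> T.J" "\<rho> a = \<tau> u" using \<rho>_cases[OF a] .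
    obtain v where v: "v \<in> carrier U" "\<phi> v \<ominus> c \<in> T.J" "\<rho> c = \<tau> v" using \<rho>_cases[OF c] .
    note p = \<phi>(1)[OF u(1)] \<phi>(1)[OF v(1)]
    have "\<phi> u \<ominus> \<phi> v \<in> T.J \<longleftrightarrow> a \<ominus> c \<in> T.J"
    proof
      assume "\<phi> u \<ominus> \<phi> v \<in> T.J"
      then have "a \<ominus> \<phi> v \<in> T.J" by (rule T.J_trans[OF T.J_sym[OF u(2) p(1) a] _ a p])
      then show "a \<ominus> c \<in> T.J" by (rule T.J_trans[OF _ v(2) a p(2) c])
    next
      assume "a \<ominus> c \<in> T.J"
      then have "\<phi> u \<ominus> c \<in> T.J" by (rule T.J_trans[OF u(2) _ p(1) a c])
      then show "\<phi> u \<ominus> \<phi> v \<in> T.J" by (rule T.J_trans[OF _ T.J_sym[OF v(2) p(2) c] p(1) c p(2)])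
    qed
    then show ?thesis using \<tau>_eq_iff_J[OF u(1) v(1)] u(3) v(3) by simp
  qed
  show "\<rho> (a \<oplus> c) = \<rho> a \<oplus>\<^bsub>Q_module n\<^esub> \<rho> c" if a: "a \<in> carrier L" and c: "c \<in> carrier L" for a c
  proof -
    obtain u where u: "u \<in> carrier U" "\<phi> u \<ominus> a \<in> T.J" "\<rho> a = \<tau> u" using \<rho>_cases[OF a] .
    obtain v where v: "v \<in> carrier U" "\<phi> v \<ominus> c \<in> T.J" "\<rho> c = \<tau> v" using \<rho>_cases[OF c] .
    have "\<phi> (u \<oplus>\<^bsub>U\<^esub> v) \<ominus> (a \<oplus> c) = (\<phi> u \<ominus> a) \<oplus> (\<phi> v \<ominus> c)"
      unfolding \<phi>(3)[OF u(1) v(1)] using a c \<phi>(1)[OF u(1)] \<phi>(1)[OF v(1)] by algebra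
    then have "\<rho> (a \<oplus> c) = \<tau> (u \<oplus>\<^bsub>U\<^esub> v)"
      using a c u v T.J_add by (intro \<rho>_eqI) auto
    then show ?thesis using \<tau>_add[OF u(1) v(1)] u(3) v(3) by simp
  qed
  show "\<rho> (c \<odot> a) = c \<odot>\<^bsub>Q_module n\<^esub> \<rho> a" if a: "a \<in> carrier L" for a c
  proof -
    obtain u where u: "u \<in> carrier U" "\<phi> u \<ominus> a \<in> T.J" "\<rho> a = \<tau> u" using \<rho>_cases[OF a] .
    have "\<phi> (c \<odot>\<^bsub>U\<^esub> u) \<ominus> c \<odot> a = c \<odot> (\<phi> u \<ominus> a)"
      unfolding \<phi>(4)[OF u(1)] using a \<phi>(1)[OF u(1)]
      by (simp add: L.minus_eq L.smult_add_right L.smult_minus_right)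
    then have "\<rho> (c \<odot> a) = \<tau> (c \<odot>\<^bsub>U\<^esub> u)"
      using a u T.J_smult by (intro \<rho>_eqI) auto
    then show ?thesis using \<tau>_smult[OF u(1)] u(3) by simp
  qed
  show "\<rho> \<zero> = \<zero>\<^bsub>Q_module n\<^esub>"
    unfolding \<tau>_zero[symmetric] by (rule \<rho>_eqI) (use T.J_zero in \<open>auto simp: \<phi>_zero\<close>)
  show "\<rho> (\<phi> (\<iota> X) \<otimes> a) = Q_action n X (\<rho> a)" if X: "X \<in> sl n" and a: "a \<in> carrier L" for X a
  proof -
    obtain u where u: "u \<in> carrier U" "\<phi> u \<ominus> a \<in> T.J" "\<rho> a = \<tau> u" using \<rho>_cases[OF a] .
    note p = \<phi>(1)[OF \<iota>_closed[OF X]]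
    have "\<phi> (\<iota> X \<otimes>\<^bsub>U\<^esub> u) \<ominus> \<phi> (\<iota> X) \<otimes> a = \<phi> (\<iota> X) \<otimes> (\<phi> u \<ominus> a)"
      unfolding \<phi>(2)[OF \<iota>_closed[OF X] u(1)] using a p \<phi>(1)[OF u(1)] by algebra
    then have "\<rho> (\<phi> (\<iota> X) \<otimes> a) = \<tau> (\<iota> X \<otimes>\<^bsub>U\<^esub> u)"
      using a p u X T.J_mult[OF u(2) p] by (intro \<rho>_eqI) auto
    then show ?thesis using Q_action_\<tau>[OF X u(1)] u(3) by simp
  qed
qed

text \<open>
  The \<open>H k\<close> and the \<open>x i\<close> span the images of \<^const>\<open>cartan\<close> and \<^const>\<open>mm\<close>.
\<close>

lemma W_algebra_eq: "W_algebra n L \<phi> = L\<lparr>carrier := M.W\<rparr>"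
proof -
  have cartan: "commutator L (\<phi> (\<iota> X)) u = \<zero>"
    if X: "X \<in> cartan n" and u: "u \<in> carrier L" "\<And>k. commutator L (H k) u = \<zero>" for X u
    using X
  proof (induction rule: cartan_induct)
    case zero
    then show ?case using u by (simp only: \<iota>_zero \<phi>_zero) (simp add: commutator_def)
  next
    case (coweight k)
    then show ?case using u(2)[of k] by (simp add: H_def)
  next
    case (add A B)
    then show ?case using u(1) \<phi>(1) by (simp add: \<iota>_add \<phi>(3) L.commutator_add_left)
  next
    case (smult c A)
    then show ?case using u(1) \<phi>(1) by (simp add: \<iota>_smult \<phi>(4) L.commutator_smult_left)
  qed
  have mm: "commutator L (\<phi> (\<iota> X)) u = \<zero>"
    if X: "X \<in> mm n" and u: "u \<in> carrier L" "\<And>i. i \<in> {1..n} \<Longrightarrow> commutator L (xL i) u = \<zero>" for X u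
    using X
  proof (induction rule: mm_induct)
    case zero
    then show ?case using u by (simp only: \<iota>_zero \<phi>_zero) (simp add: commutator_def)
  next
    case (unit i)
    then show ?case using u(2)[of i] by (simp add: xL_def)
  next
    case (add A B)
    then show ?case using u(1) \<phi>(1) mm_sl by (simp add: \<iota>_add \<phi>(3) L.commutator_add_left)
  next
    case (smult c A)
    then show ?case using u(1) \<phi>(1) mm_sl by (simp add: \<iota>_smult \<phi>(4) L.commutator_smult_left)
  qed
  have "{u \<in> carrier L. (\<forall>X\<in>cartan n. commutator L (\<phi> (\<iota> X)) u = \<zero>) \<and>
      (\<forall>X\<in>mm n. commutator L (\<phi> (\<iota> X)) u = \<zero>)} = M.W"
  proof (intro subset_antisym subsetI)
    fix u assume u: "u \<in> {u \<in> carrier L. (\<forall>X\<in>cartan n. commutator L (\<phi> (\<iota> X)) u = \<zero>) \<and>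
      (\<forall>X\<in>mm n. commutator L (\<phi> (\<iota> X)) u = \<zero>)}"
    have "commutator L (H k) u = \<zero>" for k
      using u coweight_cartan[of k n] by (auto simp: H_def commutator_def)
    then show "u \<in> M.W"
      using u e_mm by (auto simp: M.W_def xL_def)
  next
    fix u assume "u \<in> M.W"
    then show "u \<in> {u \<in> carrier L. (\<forall>X\<in>cartan n. commutator L (\<phi> (\<iota> X)) u = \<zero>) \<and>
      (\<forall>X\<in>mm n. commutator L (\<phi> (\<iota> X)) u = \<zero>)}"
      using cartan mm by (simp add: M.W_def)
  qed
  then show ?thesis by (simp add: W_algebra_def)
qed

end

theorem theorem9:
  fixes n :: nat
    and US :: "(complex, 'b) module"
    and \<phi> :: "enveloping \<Rightarrow> 'b"
  assumes "n \<ge> 2"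
    and "is_localization (U_sl n) (denominators n) US \<phi>"
  shows "algebra_isomorphic (W_algebra n US \<phi>) (finite_W_algebra n)"
proof -
  interpret localized_special_linear n US \<phi>
    by (rule localized_special_linear.intro) (rule assms(2))
  show ?thesis
    unfolding W_algebra_eq finite_W_algebra_def by (rule M.W_isomorphic_endomorphisms)
qed

end
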